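(* Let $\theta,\gamma\in\mathbf{R}$, let $d\in\mathbf{Z}$, and let $f\colon S^1\to\mathbf{R}$ be a continuous function. Then $$C^*(\mathbf{Z},A_\theta,\alpha_{\theta,\gamma,d,f})\cong C^*(\mathbf{Z},A_\gamma,\alpha_{\gamma,\theta,-d,-f}).$$
   Context: For $\theta \in \mathbf{R}$, $A_\theta$ denotes the rotation algebra, the universal C*-algebra generated by unitaries $u$ and $v$ satisfying $vu = e^{2\pi i\theta}uv$. For $\theta,\gamma\in\mathbf{R}$, $d\in\mathbf{Z}$ and $f\colon S^1\to\mathbf{R}$ continuous, $\alpha_{\theta,\gamma,d,f}$ is the (unique) automorphism of $A_\theta$ such that $\alpha_{\theta,\gamma,d,f}(u) = e^{2\pi i\gamma}u$ and $\alpha_{\theta,\gamma,d,f}(v) = \exp(2\pi i f(u))u^d v$. $C^*(\mathbf{Z},A,\alpha)$ denotes the crossed product of $A$ by the action of $\mathbf{Z}$ generated by $\alpha$. *)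

theory Defs
  imports "HOL-Analysis.Analysis" "HOL-Algebra.Module"
begin

section \<open>Unital C*-algebras with explicit carriers\<close>

record 'a star_alg = "(complex, 'a) module" +
  adj :: "'a \<Rightarrow> 'a"

record 'a cstar_alg = "'a star_alg" +
  cnorm :: "'a \<Rightarrow> real"

locale star_algebra = ring A for A :: "('a, 'm) star_alg_scheme" (structure) +
  assumes smult_closed: "x \<in> carrier A \<Longrightarrow> c \<odot> x \<in> carrier A"
    and smult_add: "\<lbrakk>x \<in> carrier A; y \<in> carrier A\<rbrakk> \<Longrightarrow> c \<odot> (x \<oplus> y) = c \<odot> x \<oplus> c \<odot> y"
    and add_smult: "x \<in> carrier A \<Longrightarrow> (b + c) \<odot> x = b \<odot> x \<oplus> c \<odot> x"
    and smult_smult: "x \<in> carrier A \<Longrightarrow> (b * c) \<odot> x = b \<odot> (c \<odot> x)"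
    and one_smult: "x \<in> carrier A \<Longrightarrow> 1 \<odot> x = x"
    and smult_mult_left: "\<lbrakk>x \<in> carrier A; y \<in> carrier A\<rbrakk> \<Longrightarrow> (c \<odot> x) \<otimes> y = c \<odot> (x \<otimes> y)"
    and smult_mult_right: "\<lbrakk>x \<in> carrier A; y \<in> carrier A\<rbrakk> \<Longrightarrow> x \<otimes> (c \<odot> y) = c \<odot> (x \<otimes> y)"
    and adj_closed: "x \<in> carrier A \<Longrightarrow> adj A x \<in> carrier A"
    and adj_adj: "x \<in> carrier A \<Longrightarrow> adj A (adj A x) = x"
    and adj_add: "\<lbrakk>x \<in> carrier A; y \<in> carrier A\<rbrakk> \<Longrightarrow> adj A (x \<oplus> y) = adj A x \<oplus> adj A y"
    and adj_smult: "x \<in> carrier A \<Longrightarrow> adj A (c \<odot> x) = cnj c \<odot> adj A x"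
    and adj_mult: "\<lbrakk>x \<in> carrier A; y \<in> carrier A\<rbrakk> \<Longrightarrow> adj A (x \<otimes> y) = adj A y \<otimes> adj A x"

definition cstar_seminorm :: "('a, 'm) star_alg_scheme \<Rightarrow> ('a \<Rightarrow> real) \<Rightarrow> bool" where
  "cstar_seminorm P p \<longleftrightarrow>
     (\<forall>x \<in> carrier P. 0 \<le> p x) \<and>
     (\<forall>x \<in> carrier P. \<forall>y \<in> carrier P. p (x \<oplus>\<^bsub>P\<^esub> y) \<le> p x + p y) \<and>
     (\<forall>c. \<forall>x \<in> carrier P. p (c \<odot>\<^bsub>P\<^esub> x) = cmod c * p x) \<and>
     (\<forall>x \<in> carrier P. \<forall>y \<in> carrier P. p (x \<otimes>\<^bsub>P\<^esub> y) \<le> p x * p y) \<and>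
     (\<forall>x \<in> carrier P. p (adj P x \<otimes>\<^bsub>P\<^esub> x) = (p x)\<^sup>2)"

definition seminorm_cauchy :: "('a, 'm) star_alg_scheme \<Rightarrow> ('a \<Rightarrow> real) \<Rightarrow> (nat \<Rightarrow> 'a) \<Rightarrow> bool" where
  "seminorm_cauchy P p x \<longleftrightarrow>
     (\<forall>n. x n \<in> carrier P) \<and>
     (\<forall>e > 0. \<exists>N. \<forall>m \<ge> N. \<forall>n \<ge> N. p (x m \<ominus>\<^bsub>P\<^esub> x n) < e)"

locale cstar_algebra = star_algebra A for A :: "('a, 'm) cstar_alg_scheme" (structure) +
  assumes cnorm_seminorm: "cstar_seminorm A (cnorm A)"
    and cnorm_eq_0: "\<lbrakk>x \<in> carrier A; cnorm A x = 0\<rbrakk> \<Longrightarrow> x = \<zero>"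
    and cnorm_complete: "seminorm_cauchy A (cnorm A) X \<Longrightarrow>
          \<exists>l \<in> carrier A. (\<lambda>n. cnorm A (X n \<ominus> l)) \<longlonglongrightarrow> 0"

definition star_hom ::
  "('a, 'm) star_alg_scheme \<Rightarrow> ('b, 'n) star_alg_scheme \<Rightarrow> ('a \<Rightarrow> 'b) set" where
  "star_hom A B = {h \<in> ring_hom A B.
     (\<forall>c. \<forall>x \<in> carrier A. h (c \<odot>\<^bsub>A\<^esub> x) = c \<odot>\<^bsub>B\<^esub> h x) \<and>
     (\<forall>x \<in> carrier A. h (adj A x) = adj B (h x))}"

definition star_iso ::
  "('a, 'm) star_alg_scheme \<Rightarrow> ('b, 'n) star_alg_scheme \<Rightarrow> ('a \<Rightarrow> 'b) set" where
  "star_iso A B = {h \<in> star_hom A B. bij_betw h (carrier A) (carrier B)}"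

definition cstar_isomorphic ::
  "('a, 'm) cstar_alg_scheme \<Rightarrow> ('b, 'n) cstar_alg_scheme \<Rightarrow> bool" (infix "\<cong>\<^sub>C" 50) where
  "A \<cong>\<^sub>C B \<longleftrightarrow> cstar_algebra A \<and> cstar_algebra B \<and> star_iso A B \<noteq> {}"


section \<open>Enveloping and universal C*-algebras\<close>

definition completion_rel ::
  "('a, 'm) star_alg_scheme \<Rightarrow> ('a \<Rightarrow> real) \<Rightarrow> ((nat \<Rightarrow> 'a) \<times> (nat \<Rightarrow> 'a)) set" where
  "completion_rel P p = {(x, y). seminorm_cauchy P p x \<and> seminorm_cauchy P p y \<and>
     (\<lambda>n. p (x n \<ominus>\<^bsub>P\<^esub> y n)) \<longlonglongrightarrow> 0}"

definition completion_class ::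
  "('a, 'm) star_alg_scheme \<Rightarrow> ('a \<Rightarrow> real) \<Rightarrow> (nat \<Rightarrow> 'a) \<Rightarrow> (nat \<Rightarrow> 'a) set" where
  "completion_class P p x = completion_rel P p `` {x}"

text \<open>The Hausdorff completion: Cauchy sequences modulo sequences tending to \<open>0\<close> in the seminorm.\<close>

definition completion ::
  "('a, 'm) star_alg_scheme \<Rightarrow> ('a \<Rightarrow> real) \<Rightarrow> (nat \<Rightarrow> 'a) set cstar_alg" where
  "completion P p = \<lparr>
     carrier = {x. seminorm_cauchy P p x} // completion_rel P p,
     monoid.mult = (\<lambda>X Y. \<Union>x\<in>X. \<Union>y\<in>Y. completion_class P p (\<lambda>n. x n \<otimes>\<^bsub>P\<^esub> y n)),
     one = completion_class P p (\<lambda>n. \<one>\<^bsub>P\<^esub>),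
     zero = completion_class P p (\<lambda>n. \<zero>\<^bsub>P\<^esub>),
     add = (\<lambda>X Y. \<Union>x\<in>X. \<Union>y\<in>Y. completion_class P p (\<lambda>n. x n \<oplus>\<^bsub>P\<^esub> y n)),
     smult = (\<lambda>c X. \<Union>x\<in>X. completion_class P p (\<lambda>n. c \<odot>\<^bsub>P\<^esub> x n)),
     adj = (\<lambda>X. \<Union>x\<in>X. completion_class P p (\<lambda>n. adj P (x n))),
     cnorm = (\<lambda>X. THE l. \<forall>x\<in>X. (\<lambda>n. p (x n)) \<longlonglongrightarrow> l)\<rparr>"

text \<open>
  The C*-seminorms on a unital *-algebra \<open>P\<close> that vanish on \<open>R\<close> are exactly the functions
  \<open>x \<mapsto> \<parallel>\<rho> x\<parallel>\<close> for unital *-homomorphisms \<open>\<rho>\<close> from \<open>P\<close> to C*-algebras with \<open>\<rho> = 0\<close> on \<open>R\<close>.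
  So this is the usual supremum over all representations of the relations, without a quantifier over
  the carrier types of the target algebras. It is meaningful only if that supremum is finite for
  every \<open>x\<close>, as is the case in the two applications below.
\<close>

definition universal_seminorm :: "('a, 'm) star_alg_scheme \<Rightarrow> 'a set \<Rightarrow> 'a \<Rightarrow> real" where
  "universal_seminorm P R x = Sup {p x | p. cstar_seminorm P p \<and> (\<forall>r\<in>R. p r = 0)}"

definition enveloping_cstar ::
  "('a, 'm) star_alg_scheme \<Rightarrow> 'a set \<Rightarrow> (nat \<Rightarrow> 'a) set cstar_alg" where
  "enveloping_cstar P R = completion P (universal_seminorm P R)"

definition enveloping_map ::
  "('a, 'm) star_alg_scheme \<Rightarrow> 'a set \<Rightarrow> 'a \<Rightarrow> (nat \<Rightarrow> 'a) set" where
  "enveloping_map P R a = completion_class P (universal_seminorm P R) (\<lambda>n. a)"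

text \<open>
  The free unital *-algebra on generators of type \<open>'g\<close>: finitely supported complex functions on
  words, where the letter \<open>(g, False)\<close> stands for \<open>g\<close> and \<open>(g, True)\<close> for its adjoint.
\<close>

type_synonym 'g word_fun = "('g \<times> bool) list \<Rightarrow> complex"

definition word_adj :: "('g \<times> bool) list \<Rightarrow> ('g \<times> bool) list" where
  "word_adj w = rev (map (\<lambda>(g, b). (g, \<not> b)) w)"

definition free_star_algebra :: "'g word_fun star_alg" where
  "free_star_algebra = \<lparr>
     carrier = {a. finite {w. a w \<noteq> 0}},
     monoid.mult = (\<lambda>a b w. \<Sum>k\<le>length w. a (take k w) * b (drop k w)),
     one = (\<lambda>w. if w = [] then 1 else 0),
     zero = (\<lambda>w. 0),
     add = (\<lambda>a b w. a w + b w),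
     smult = (\<lambda>c a w. c * a w),
     adj = (\<lambda>a w. cnj (a (word_adj w)))\<rparr>"

definition free_generator :: "'g \<Rightarrow> 'g word_fun" where
  "free_generator g = (\<lambda>w. if w = [(g, False)] then 1 else 0)"


section \<open>Rotation algebras\<close>

datatype rot_gen = Gen_u | Gen_v

definition unitary_relations :: "('a, 'm) star_alg_scheme \<Rightarrow> 'a \<Rightarrow> 'a set" where
  "unitary_relations P x = {adj P x \<otimes>\<^bsub>P\<^esub> x \<ominus>\<^bsub>P\<^esub> \<one>\<^bsub>P\<^esub>, x \<otimes>\<^bsub>P\<^esub> adj P x \<ominus>\<^bsub>P\<^esub> \<one>\<^bsub>P\<^esub>}"

definition rotation_relations :: "real \<Rightarrow> rot_gen word_fun set" where
  "rotation_relations \<theta> =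
     (let P = free_star_algebra; u = free_generator Gen_u; v = free_generator Gen_v in
      unitary_relations P u \<union> unitary_relations P v \<union>
      {v \<otimes>\<^bsub>P\<^esub> u \<ominus>\<^bsub>P\<^esub> exp (2 * pi * \<i> * \<theta>) \<odot>\<^bsub>P\<^esub> (u \<otimes>\<^bsub>P\<^esub> v)})"

type_synonym rotation_elem = "(nat \<Rightarrow> rot_gen word_fun) set"

definition rotation_algebra :: "real \<Rightarrow> rotation_elem cstar_alg" where
  "rotation_algebra \<theta> = enveloping_cstar free_star_algebra (rotation_relations \<theta>)"

definition rot_u :: "real \<Rightarrow> rotation_elem" where
  "rot_u \<theta> = enveloping_map free_star_algebra (rotation_relations \<theta>) (free_generator Gen_u)"

definition rot_v :: "real \<Rightarrow> rotation_elem" where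
  "rot_v \<theta> = enveloping_map free_star_algebra (rotation_relations \<theta>) (free_generator Gen_v)"


section \<open>Functional calculus of a unitary\<close>

text \<open>\<open>C(S\<^sup>1)\<close>, its elements being extended by \<open>0\<close> off the circle.\<close>

definition circle_fun :: "(complex \<Rightarrow> complex) \<Rightarrow> complex \<Rightarrow> complex" where
  "circle_fun g = (\<lambda>z. if z \<in> sphere 0 1 then g z else 0)"

definition circle_algebra :: "(complex \<Rightarrow> complex) star_alg" where
  "circle_algebra = \<lparr>
     carrier = {g. continuous_on (sphere 0 1) g \<and> (\<forall>z. z \<notin> sphere 0 1 \<longrightarrow> g z = 0)},
     monoid.mult = (\<lambda>g h z. g z * h z),
     one = circle_fun (\<lambda>z. 1),
     zero = (\<lambda>z. 0),
     add = (\<lambda>g h z. g z + h z),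
     smult = (\<lambda>c g z. c * g z),
     adj = (\<lambda>g z. cnj (g z))\<rparr>"

text \<open>
  \<open>g(u)\<close> for a unitary \<open>u\<close> and \<open>g\<close> continuous on the circle: the image of \<open>g\<close> under the unital
  *-homomorphism from \<open>C(S\<^sup>1)\<close> that takes the identity function to \<open>u\<close>.
\<close>

definition unitary_calculus :: "('a, 'm) cstar_alg_scheme \<Rightarrow> 'a \<Rightarrow> (complex \<Rightarrow> complex) \<Rightarrow> 'a" where
  "unitary_calculus A u g =
     (THE b. \<exists>\<Phi> \<in> star_hom circle_algebra A.
        \<Phi> (circle_fun (\<lambda>z. z)) = u \<and> \<Phi> (circle_fun g) = b)"


section \<open>The automorphisms and the crossed product\<close>

definition rot_aut ::
  "real \<Rightarrow> real \<Rightarrow> int \<Rightarrow> (complex \<Rightarrow> real) \<Rightarrow> rotation_elem \<Rightarrow> rotation_elem" where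
  "rot_aut \<theta> \<gamma> d f =
     (let A = rotation_algebra \<theta>; u = rot_u \<theta>; v = rot_v \<theta> in
      THE \<alpha>. \<alpha> \<in> extensional (carrier A) \<and> \<alpha> \<in> star_iso A A \<and>
        \<alpha> u = exp (2 * pi * \<i> * \<gamma>) \<odot>\<^bsub>A\<^esub> u \<and>
        \<alpha> v = unitary_calculus A u (\<lambda>z. exp (2 * pi * \<i> * f z)) \<otimes>\<^bsub>A\<^esub> (u [^]\<^bsub>A\<^esub> d) \<otimes>\<^bsub>A\<^esub> v)"

definition int_iterate :: "'a set \<Rightarrow> ('a \<Rightarrow> 'a) \<Rightarrow> int \<Rightarrow> 'a \<Rightarrow> 'a" where
  "int_iterate S \<alpha> n =
     (if 0 \<le> n then \<alpha> ^^ nat n else inv_into S \<alpha> ^^ nat (- n))"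

text \<open>
  \<open>C\<^sub>c(\<int>, A, \<alpha>)\<close>: the function \<open>a\<close> stands for the finite sum of the \<open>a n \<cdot> w\<^sup>n\<close>, where \<open>w\<close> is the
  canonical unitary with \<open>w x w\<^sup>* = \<alpha> x\<close> for \<open>x\<close> in \<open>A\<close>.
\<close>

definition crossed_polys ::
  "('a, 'm) cstar_alg_scheme \<Rightarrow> ('a \<Rightarrow> 'a) \<Rightarrow> (int \<Rightarrow> 'a) star_alg" where
  "crossed_polys A \<alpha> = \<lparr>
     carrier = {a. (\<forall>n. a n \<in> carrier A) \<and> finite {n. a n \<noteq> \<zero>\<^bsub>A\<^esub>}},
     monoid.mult = (\<lambda>a b n.
       finsum A (\<lambda>m. a m \<otimes>\<^bsub>A\<^esub> int_iterate (carrier A) \<alpha> m (b (n - m))) {m. a m \<noteq> \<zero>\<^bsub>A\<^esub>}),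
     one = (\<lambda>n. if n = 0 then \<one>\<^bsub>A\<^esub> else \<zero>\<^bsub>A\<^esub>),
     zero = (\<lambda>n. \<zero>\<^bsub>A\<^esub>),
     add = (\<lambda>a b n. a n \<oplus>\<^bsub>A\<^esub> b n),
     smult = (\<lambda>c a n. c \<odot>\<^bsub>A\<^esub> a n),
     adj = (\<lambda>a n. int_iterate (carrier A) \<alpha> n (adj A (a (- n))))\<rparr>"

text \<open>
  For unital \<open>A\<close>, the C*-seminorms on \<open>C\<^sub>c(\<int>, A, \<alpha>)\<close> are exactly the ones induced by covariant pairs
  of a unital *-homomorphism of \<open>A\<close> and a unitary, so this is the full crossed product.
\<close>

definition crossed_product ::
  "('a, 'm) cstar_alg_scheme \<Rightarrow> ('a \<Rightarrow> 'a) \<Rightarrow> (nat \<Rightarrow> int \<Rightarrow> 'a) set cstar_alg" where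
  "crossed_product A \<alpha> = enveloping_cstar (crossed_polys A \<alpha>) {}"

end

theory Submission
  imports Defs
begin

text \<open>
  Both crossed products are the universal C*-algebra generated by unitaries \<open>u\<close>, \<open>v\<close>, \<open>w\<close> with
  \<open>v u = exp(2 \<pi> i \<theta>) u v\<close>, \<open>w u = exp(2 \<pi> i \<gamma>) u w\<close> and \<open>w v = g(u) v w\<close>, where
  \<open>g(z) = exp(2 \<pi> i f(z)) z\<^sup>d\<close>. The last
  relation is equivalent to \<open>v w = g(u)\<^sup>* w v\<close>, so exchanging \<open>v\<close> and \<open>w\<close> exchanges \<open>\<theta>\<close> with \<open>\<gamma>\<close>
  and replaces \<open>(d, f)\<close> by \<open>(-d, -f)\<close>.

  Two analytic facts make the universal properties available. A C*-seminorm on a C*-algebra is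
  dominated by the norm: if \<open>x\<close> is self-adjoint with \<open>\<parallel>x\<parallel> < 1\<close> then \<open>x\<close> is the real part of the unitary
  \<open>x + i sqrt(1 - x\<^sup>2)\<close>. And \<open>\<parallel>q(u)\<parallel>\<close> is at most the supremum of \<open>|q|\<close> on the circle for a Laurent
  polynomial \<open>q\<close> and a unitary \<open>u\<close>: for self-adjoint \<open>q\<close>, \<open>\<parallel>q(u)\<parallel>\<close> to the power \<open>2\<^sup>n\<close> is the norm of a
  Laurent polynomial with \<open>O(2\<^sup>n)\<close> coefficients, each of them at most the \<open>2\<^sup>n\<close>-th power of that supremum.
\<close>

section \<open>C*-seminorms on *-algebras\<close>

text \<open>The difficulty is that \<open>universal_seminorm\<close> is a supremum over seminorms,
  while a universal property speaks of homomorphisms. One mechanism connects them: the norm of the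
  target, pulled back along a homomorphism that kills the relations, takes part in the supremum; so
  the homomorphism is dominated by it and extends to the completion. For this the supremum must be
  finite. For finitely supported functions with values in a C*-algebra, finiteness is exactly the
  domination of C*-seminorms by the norm. The same domination makes homomorphisms contractive, so
  that they are determined on dense subalgebras. The functions of u in the relations and the
  automorphisms themselves are definite descriptions. The estimate for Laurent polynomials gives
  existence of the functional calculus by extension, and their density gives uniqueness. Naturality
  of the calculus under homomorphisms then lets the relation that contains g(u) pass to any target,
  so the two crossed products can be compared through three generators alone.\<close>

context star_algebra
begin

declare smult_closed [simp, intro] adj_closed [simp, intro] adj_adj [simp] one_smult [simp]

lemma zero_smult [simp]:
  assumes "x \<in> carrier A"
  shows "0 \<odot> x = \<zero>"
proof -
  have "0 \<odot> x \<oplus> 0 \<odot> x = 0 \<odot> x"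
    using add_smult[OF assms, of 0 0] by simp
  then show ?thesis
    using assms by simp
qed

lemma smult_zero [simp]: "c \<odot> \<zero> = \<zero>"
  using smult_smult[of \<zero> c 0] by simp

lemma uminus_eq_smult: "x \<in> carrier A \<Longrightarrow> \<ominus> x = (-1) \<odot> x"
  using add_smult[of x "-1" 1] by (intro minus_equality) auto

lemma uminus_left_inverse: "x \<in> carrier A \<Longrightarrow> (-1) \<odot> x \<oplus> x = \<zero>"
  by (simp add: l_neg flip: uminus_eq_smult)

lemma minus_eq_smult: "\<lbrakk>x \<in> carrier A; y \<in> carrier A\<rbrakk> \<Longrightarrow> x \<ominus> y = x \<oplus> (-1) \<odot> y"
  by (simp add: minus_eq uminus_eq_smult)

lemma smult_diff:
  assumes "x \<in> carrier A" "y \<in> carrier A"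
  shows "c \<odot> (x \<ominus> y) = c \<odot> x \<ominus> c \<odot> y"
proof -
  have "c \<odot> ((-1) \<odot> y) = (-1) \<odot> (c \<odot> y)"
    using assms smult_smult[of y c "-1"] smult_smult[of y "-1" c] by simp
  then show ?thesis
    using assms by (simp add: minus_eq_smult smult_add)
qed

lemma adj_diff: "\<lbrakk>x \<in> carrier A; y \<in> carrier A\<rbrakk> \<Longrightarrow> adj A (x \<ominus> y) = adj A x \<ominus> adj A y"
  by (simp add: minus_eq_smult adj_add adj_smult)

lemma adj_zero [simp]: "adj A \<zero> = \<zero>"
  using adj_smult[of \<zero> 0] by simp

lemma adj_one [simp]: "adj A \<one> = \<one>"
proof -
  have "adj A \<one> = adj A \<one> \<otimes> adj A (adj A \<one>)"
    by simp
  also have "\<dots> = adj A (adj A \<one> \<otimes> \<one>)"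
    by (subst adj_mult) auto
  finally show ?thesis by simp
qed

lemma diff_self [simp]: "x \<in> carrier A \<Longrightarrow> x \<ominus> x = \<zero>"
  by (simp add: minus_eq r_neg)

lemma diff_eq_zero_iff: "\<lbrakk>x \<in> carrier A; y \<in> carrier A\<rbrakk> \<Longrightarrow> x \<ominus> y = \<zero> \<longleftrightarrow> x = y"
  by (metis diff_self minus_equality minus_eq minus_minus a_inv_closed)

lemma diff_split: "\<lbrakk>x \<in> carrier A; y \<in> carrier A; z \<in> carrier A\<rbrakk> \<Longrightarrow> x \<ominus> z = (x \<ominus> y) \<oplus> (y \<ominus> z)"
  by (simp add: minus_eq a_assoc r_neg2 r_neg1)

lemma diff_add_diff:
  "\<lbrakk>x \<in> carrier A; y \<in> carrier A; x' \<in> carrier A; y' \<in> carrier A\<rbrakk> \<Longrightarrow>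
    (x \<oplus> y) \<ominus> (x' \<oplus> y') = (x \<ominus> x') \<oplus> (y \<ominus> y')"
  by (simp add: minus_eq minus_add a_ac)

lemma mult_diff_mult:
  assumes "x \<in> carrier A" "y \<in> carrier A" "x' \<in> carrier A" "y' \<in> carrier A"
  shows "x \<otimes> y \<ominus> x' \<otimes> y' = x \<otimes> (y \<ominus> y') \<oplus> (x \<ominus> x') \<otimes> y'"
proof -
  have "x \<otimes> (y \<ominus> y') = x \<otimes> y \<ominus> x \<otimes> y'" "(x \<ominus> x') \<otimes> y' = x \<otimes> y' \<ominus> x' \<otimes> y'"
    using assms by (simp_all add: minus_eq r_distr l_distr r_minus l_minus)
  then show ?thesis
    using assms by (simp add: diff_split[of "x \<otimes> y" "x \<otimes> y'" "x' \<otimes> y'"])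
qed

end

text \<open>The seminorm is a parameter apart from the record, so that the same rules serve the norm
  of a C*-algebra, the universal seminorm and the supremum norm on the circle.\<close>

locale seminormed_star_algebra = star_algebra A for A :: "('a, 'm) star_alg_scheme" (structure) +
  fixes p :: "'a \<Rightarrow> real"
  assumes seminorm: "cstar_seminorm A p"
begin

lemma p_nonneg [simp]: "x \<in> carrier A \<Longrightarrow> 0 \<le> p x"
  and p_add: "\<lbrakk>x \<in> carrier A; y \<in> carrier A\<rbrakk> \<Longrightarrow> p (x \<oplus> y) \<le> p x + p y"
  and p_smult: "x \<in> carrier A \<Longrightarrow> p (c \<odot> x) = cmod c * p x"
  and p_mult: "\<lbrakk>x \<in> carrier A; y \<in> carrier A\<rbrakk> \<Longrightarrow> p (x \<otimes> y) \<le> p x * p y"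
  and p_adj_mult: "x \<in> carrier A \<Longrightarrow> p (adj A x \<otimes> x) = (p x)\<^sup>2"
  using seminorm unfolding cstar_seminorm_def by blast+

lemma p_zero [simp]: "p \<zero> = 0"
  using p_smult[of \<zero> 0] by simp

lemma p_diff_commute:
  assumes "x \<in> carrier A" "y \<in> carrier A"
  shows "p (x \<ominus> y) = p (y \<ominus> x)"
proof -
  have "x \<ominus> y = (-1) \<odot> (y \<ominus> x)"
    using assms by (simp add: smult_diff) (simp add: uminus_eq_smult[symmetric] minus_eq a_comm)
  then show ?thesis
    using assms by (simp add: p_smult)
qed

lemma p_triangle:
  "\<lbrakk>x \<in> carrier A; y \<in> carrier A; z \<in> carrier A\<rbrakk> \<Longrightarrow> p (x \<ominus> z) \<le> p (x \<ominus> y) + p (y \<ominus> z)"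
  by (metis diff_split p_add minus_closed)

lemma p_diff_le: "\<lbrakk>x \<in> carrier A; y \<in> carrier A\<rbrakk> \<Longrightarrow> p (x \<ominus> y) \<le> p x + p y"
  using p_add[of x "(-1) \<odot> y"] by (simp add: minus_eq_smult p_smult)

lemma p_abs_diff:
  assumes "x \<in> carrier A" "y \<in> carrier A"
  shows "\<bar>p x - p y\<bar> \<le> p (x \<ominus> y)"
proof -
  have 1: "p z \<le> p z' + p (z \<ominus> z')" if "z \<in> carrier A" "z' \<in> carrier A" for z z'
    proof -
    have "z' \<oplus> (z \<ominus> z') = z"
      using that by (simp add: minus_eq a_lcomm[of z' z] r_neg)
    then show ?thesis
      using p_add[of z' "z \<ominus> z'"] that by simp
  qed
  show ?thesis
    using 1[of x y] 1[of y x] assms p_diff_commute[of x y] by linarith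
qed

lemma p_diff_add:
  "\<lbrakk>x \<in> carrier A; y \<in> carrier A; x' \<in> carrier A; y' \<in> carrier A\<rbrakk> \<Longrightarrow>
    p ((x \<oplus> y) \<ominus> (x' \<oplus> y')) \<le> p (x \<ominus> x') + p (y \<ominus> y')"
  by (simp add: diff_add_diff p_add)

lemma p_diff_smult:
  "\<lbrakk>x \<in> carrier A; y \<in> carrier A\<rbrakk> \<Longrightarrow> p (c \<odot> x \<ominus> c \<odot> y) = cmod c * p (x \<ominus> y)"
  by (simp flip: smult_diff add: p_smult)

lemma p_diff_mult:
  assumes "x \<in> carrier A" "y \<in> carrier A" "x' \<in> carrier A" "y' \<in> carrier A"
  shows "p (x \<otimes> y \<ominus> x' \<otimes> y') \<le> p x * p (y \<ominus> y') + p (x \<ominus> x') * p y'"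
proof -
  have "p (x \<otimes> y \<ominus> x' \<otimes> y') \<le> p (x \<otimes> (y \<ominus> y')) + p ((x \<ominus> x') \<otimes> y')"
    using assms by (simp add: mult_diff_mult p_add)
  also have "\<dots> \<le> p x * p (y \<ominus> y') + p (x \<ominus> x') * p y'"
    using assms by (intro add_mono p_mult) auto
  finally show ?thesis .
qed

text \<open>The C*-identity and submultiplicativity bound the square of p(z) by
  p(\<open>adj A z\<close>) times p(z). Dividing by p(z), and doing the same for the adjoint, gives
  both inequalities.\<close>

lemma p_adj [simp]:
  assumes "x \<in> carrier A"
  shows "p (adj A x) = p x"
proof -
  have 1: "p z \<le> p (adj A z)" if "z \<in> carrier A" for z
  proof (cases "p z = 0")
    case False
    have "p z * p z \<le> p (adj A z) * p z"
      using p_adj_mult[OF that] p_mult[of "adj A z" z] that by (simp add: power2_eq_square)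
    then show ?thesis
      using False p_nonneg[OF that] by (simp add: mult_le_cancel_right)
  qed (use that in auto)
  show ?thesis
    using 1[OF assms] 1[of "adj A x"] assms by simp
qed

lemma p_diff_adj:
  "\<lbrakk>x \<in> carrier A; y \<in> carrier A\<rbrakk> \<Longrightarrow> p (adj A x \<ominus> adj A y) = p (x \<ominus> y)"
  by (simp flip: adj_diff)

text \<open>By the C*-identity p(1) is its own square. The value 0 does occur, for the zero
  seminorm, so only an inequality can hold.\<close>

lemma p_one_le: "p \<one> \<le> 1"
proof -
  have "p \<one> = p \<one> * p \<one>"
    using p_adj_mult[of \<one>] by (simp add: power2_eq_square)
  then show ?thesis
    by (metis order.refl mult_cancel_right1 zero_le_one)
qed

end

section \<open>Hausdorff completions\<close>

context seminormed_star_algebra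
begin

section \<open>Cauchy sequences for a seminorm\<close>

abbreviation "cauchy \<equiv> seminorm_cauchy A p"
abbreviation "\<C> \<equiv> completion A p"

lemma cauchy_closed: "cauchy x \<Longrightarrow> x n \<in> carrier A"
  by (simp add: seminorm_cauchy_def)

text \<open>The Lipschitz bound has two arguments in order to cover the binary operations; for unary
  ones the same sequence is used twice.\<close>

lemma cauchyI_dist:
  assumes "cauchy x" "cauchy y" "\<And>n. z n \<in> carrier A" "0 \<le> K"
    and "\<And>m n. p (z m \<ominus> z n) \<le> K * (p (x m \<ominus> x n) + p (y m \<ominus> y n))"
  shows "cauchy z"
  unfolding seminorm_cauchy_def
proof (intro conjI allI impI)
  fix e :: real assume "e > 0"
  \<comment> \<open>\<open>K + 1\<close> keeps the denominator positive when K = 0 and makes the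
    last comparison strict.\<close>
  define e' where "e' = e / (2 * (K + 1))"
  have e': "e' > 0"
    using \<open>e > 0\<close> \<open>0 \<le> K\<close> by (auto simp: e'_def)
  obtain N1 N2 where N: "\<And>m n. m \<ge> N1 \<Longrightarrow> n \<ge> N1 \<Longrightarrow> p (x m \<ominus> x n) < e'"
    "\<And>m n. m \<ge> N2 \<Longrightarrow> n \<ge> N2 \<Longrightarrow> p (y m \<ominus> y n) < e'"
    using assms(1,2) e' unfolding seminorm_cauchy_def by meson
  have "p (z m \<ominus> z n) < e" if "m \<ge> max N1 N2" "n \<ge> max N1 N2" for m n
  proof -
    have "p (z m \<ominus> z n) \<le> K * (e' + e')"
      using assms(5)[of m n] N(1)[of m n] N(2)[of m n] that \<open>0 \<le> K\<close>
      by (smt (verit) max.boundedE mult_left_mono)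
    also have "\<dots> < (K + 1) * (e' + e')"
      using e' by simp
    also have "\<dots> = e"
      using \<open>0 \<le> K\<close> by (simp add: e'_def divide_simps)
    finally show ?thesis .
  qed
  then show "\<exists>N. \<forall>m\<ge>N. \<forall>n\<ge>N. p (z m \<ominus> z n) < e"
    by blast
qed (use assms(3) in auto)

lemma cauchy_const: "a \<in> carrier A \<Longrightarrow> cauchy (\<lambda>n. a)"
  by (auto simp: seminorm_cauchy_def)

lemma cauchy_bounded:
  assumes "cauchy x"
  obtains K where "0 \<le> K" "\<And>n. p (x n) \<le> K"
proof -
  obtain N where N: "\<And>m n. m \<ge> N \<Longrightarrow> n \<ge> N \<Longrightarrow> p (x m \<ominus> x n) < 1"
    using assms unfolding seminorm_cauchy_def by (meson zero_less_one)
  define K where "K = Max ((\<lambda>n. p (x n)) ` {..N}) + 1"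
  have K: "p (x n) \<le> K - 1" if "n \<le> N" for n
    using that by (auto simp: K_def)
  have "p (x n) \<le> K" for n
  proof (cases "n \<le> N")
    case False
    then show ?thesis
      using p_abs_diff[of "x n" "x N"] N[of n N] K[of N] cauchy_closed[OF assms] by force
  qed (use K in force)
  moreover have "0 \<le> K"
    using calculation[of 0] p_nonneg[OF cauchy_closed[OF assms, of 0]] by linarith
  ultimately show ?thesis using that by blast
qed

lemma cauchy_add:
  assumes "cauchy x" "cauchy y"
  shows "cauchy (\<lambda>n. x n \<oplus> y n)"
  by (rule cauchyI_dist[OF assms, where K = 1])
    (use assms in \<open>auto simp: cauchy_closed p_diff_add\<close>)

text \<open>Multiplication is Lipschitz only on bounded sets, hence the bounds \<open>K1\<close> and
  \<open>K2\<close> on the two sequences.\<close>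

lemma cauchy_mult:
  assumes "cauchy x" "cauchy y"
  shows "cauchy (\<lambda>n. x n \<otimes> y n)"
proof -
  obtain K1 where K1: "0 \<le> K1" "\<And>n. p (x n) \<le> K1" using cauchy_bounded[OF assms(1)] by blast
  obtain K2 where K2: "0 \<le> K2" "\<And>n. p (y n) \<le> K2" using cauchy_bounded[OF assms(2)] by blast
  show ?thesis
  proof (rule cauchyI_dist[OF assms, where K = "K1 + K2"])
    fix m n
    have c: "x m \<in> carrier A" "x n \<in> carrier A" "y m \<in> carrier A" "y n \<in> carrier A"
      using assms cauchy_closed by auto
    have "p (x m \<otimes> y m \<ominus> x n \<otimes> y n) \<le> p (x m) * p (y m \<ominus> y n) + p (x m \<ominus> x n) * p (y n)"
      using c by (simp add: p_diff_mult)
    also have "\<dots> \<le> (K1 + K2) * p (y m \<ominus> y n) + p (x m \<ominus> x n) * (K1 + K2)"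
      using c K1 K2 by (intro add_mono mult_mono) (auto simp: add_increasing add_increasing2)
    finally show "p (x m \<otimes> y m \<ominus> x n \<otimes> y n) \<le> (K1 + K2) * (p (x m \<ominus> x n) + p (y m \<ominus> y n))"
      by (simp add: algebra_simps)
  qed (use assms K1 K2 in \<open>auto simp: cauchy_closed\<close>)
qed

lemma cauchy_smult:
  assumes "cauchy x"
  shows "cauchy (\<lambda>n. c \<odot> x n)"
  by (rule cauchyI_dist[OF assms assms, where K = "cmod c"])
    (use assms in \<open>auto simp: cauchy_closed p_diff_smult distrib_left\<close>)

lemma cauchy_adj:
  assumes "cauchy x"
  shows "cauchy (\<lambda>n. adj A (x n))"
  by (rule cauchyI_dist[OF assms assms, where K = 1])
    (use assms in \<open>auto simp: cauchy_closed p_diff_adj\<close>)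

section \<open>Equivalence classes of Cauchy sequences and the operations on them\<close>

lemma equiv_completion_rel: "equiv {x. cauchy x} (completion_rel A p)"
proof (rule equivI)
  show "sym (completion_rel A p)"
    by (auto simp: sym_def completion_rel_def p_diff_commute cauchy_closed)
  show "trans (completion_rel A p)"
  proof (rule transI)
    fix x y z assume "(x, y) \<in> completion_rel A p" "(y, z) \<in> completion_rel A p"
    then have *: "cauchy x" "cauchy y" "cauchy z"
      "(\<lambda>n. p (x n \<ominus> y n)) \<longlonglongrightarrow> 0" "(\<lambda>n. p (y n \<ominus> z n)) \<longlonglongrightarrow> 0"
      by (auto simp: completion_rel_def)
    have "(\<lambda>n. p (x n \<ominus> z n)) \<longlonglongrightarrow> 0"
      by (rule tendsto_sandwich[OF _ _ tendsto_const, where h = "\<lambda>n. p (x n \<ominus> y n) + p (y n \<ominus> z n)"])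
        (use * p_triangle tendsto_add_zero in \<open>auto simp: cauchy_closed\<close>)
    with * show "(x, z) \<in> completion_rel A p"
      by (auto simp: completion_rel_def)
  qed
qed (auto simp: refl_on_def completion_rel_def cauchy_closed)

abbreviation "cls \<equiv> completion_class A p"

lemma cls_eq_iff:
  assumes "cauchy x" "cauchy y"
  shows "cls x = cls y \<longleftrightarrow> (\<lambda>n. p (x n \<ominus> y n)) \<longlonglongrightarrow> 0"
  using eq_equiv_class_iff[OF equiv_completion_rel, of x y] assms
  by (simp add: completion_class_def completion_rel_def)

lemma cls_self: "cauchy x \<Longrightarrow> x \<in> cls x"
  using equiv_class_self[OF equiv_completion_rel] by (simp add: completion_class_def)

lemma cls_memD: "x' \<in> cls x \<Longrightarrow> cauchy x' \<and> cls x' = cls x"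
  using equiv_class_eq[OF equiv_completion_rel, of x x']
  by (auto simp: completion_class_def completion_rel_def)

lemma carrier_completion: "carrier \<C> = cls ` {x. cauchy x}"
  by (auto simp: completion_def quotient_def completion_class_def)

text \<open>The operations of \<open>completion\<close> are unions over all representatives; such a
  union collapses to one class once the result does not depend on the representative.\<close>

lemma UN_cls:
  assumes "cauchy x" "\<And>x'. cauchy x' \<Longrightarrow> cls x' = cls x \<Longrightarrow> F x' = F x"
  shows "(\<Union>x'\<in>cls x. F x') = F x"
  using assms cls_self cls_memD by blast

lemma UN_cls2:
  assumes "cauchy x" "cauchy y"
    and "\<And>x' y'. \<lbrakk>cauchy x'; cls x' = cls x; cauchy y'; cls y' = cls y\<rbrakk> \<Longrightarrow> F x' y' = F x y"
  shows "(\<Union>x'\<in>cls x. \<Union>y'\<in>cls y. F x' y') = F x y"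
  using assms cls_self cls_memD by blast

text \<open>The kind of Lipschitz estimate that preserves Cauchy sequences also gives independence
  of the representatives.\<close>

lemma cls_eqI_dist:
  assumes "cauchy x" "cauchy x'" "cauchy y" "cauchy y'"
    "cls x = cls x'" "cls y = cls y'" "cauchy z" "cauchy z'"
    and "\<And>n. p (z n \<ominus> z' n) \<le> K * (p (x n \<ominus> x' n) + p (y n \<ominus> y' n))"
  shows "cls z = cls z'"
proof -
  have "(\<lambda>n. K * (p (x n \<ominus> x' n) + p (y n \<ominus> y' n))) \<longlonglongrightarrow> 0"
    using assms(1-6) by (intro tendsto_mult_right_zero tendsto_add_zero) (auto simp: cls_eq_iff)
  then have "(\<lambda>n. p (z n \<ominus> z' n)) \<longlonglongrightarrow> 0"
    by (rule tendsto_sandwich[OF _ _ tendsto_const, rotated 2])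
      (use assms in \<open>auto simp: cauchy_closed\<close>)
  then show ?thesis
    using assms by (simp add: cls_eq_iff)
qed

lemma completion_add:
  assumes "cauchy x" "cauchy y"
  shows "cls x \<oplus>\<^bsub>\<C>\<^esub> cls y = cls (\<lambda>n. x n \<oplus> y n)"
proof -
  have "cls (\<lambda>n. x' n \<oplus> y' n) = cls (\<lambda>n. x n \<oplus> y n)"
    if "cauchy x'" "cls x' = cls x" "cauchy y'" "cls y' = cls y" for x' y'
    by (rule cls_eqI_dist[of x' x y' y _ _ 1])
      (use assms that in \<open>auto simp: cauchy_add cauchy_closed p_diff_add\<close>)
  then show ?thesis
    unfolding completion_def by (simp del: UN_simps) (rule UN_cls2[OF assms])
qed

lemma completion_mult:
  assumes "cauchy x" "cauchy y"
  shows "cls x \<otimes>\<^bsub>\<C>\<^esub> cls y = cls (\<lambda>n. x n \<otimes> y n)"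
proof -
  have "cls (\<lambda>n. x' n \<otimes> y' n) = cls (\<lambda>n. x n \<otimes> y n)"
    if *: "cauchy x'" "cls x' = cls x" "cauchy y'" "cls y' = cls y" for x' y'
  proof -
    obtain K1 where K1: "0 \<le> K1" "\<And>n. p (x' n) \<le> K1" using cauchy_bounded[OF *(1)] by blast
    obtain K2 where K2: "0 \<le> K2" "\<And>n. p (y n) \<le> K2" using cauchy_bounded[OF assms(2)] by blast
    show ?thesis
    proof (rule cls_eqI_dist[of x' x y' y _ _ "K1 + K2"])
      fix n
      have c: "x n \<in> carrier A" "x' n \<in> carrier A" "y n \<in> carrier A" "y' n \<in> carrier A"
        using assms * cauchy_closed by auto
      have "p (x' n \<otimes> y' n \<ominus> x n \<otimes> y n) \<le> p (x' n) * p (y' n \<ominus> y n) + p (x' n \<ominus> x n) * p (y n)"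
        using c by (simp add: p_diff_mult)
      also have "\<dots> \<le> (K1 + K2) * p (y' n \<ominus> y n) + p (x' n \<ominus> x n) * (K1 + K2)"
        using c K1 K2 by (intro add_mono mult_mono) (auto simp: add_increasing add_increasing2)
      finally show "p (x' n \<otimes> y' n \<ominus> x n \<otimes> y n) \<le> (K1 + K2) * (p (x' n \<ominus> x n) + p (y' n \<ominus> y n))"
        by (simp add: algebra_simps)
    qed (use assms * in \<open>auto simp: cauchy_mult\<close>)
  qed
  then show ?thesis
    unfolding completion_def by (simp del: UN_simps) (rule UN_cls2[OF assms])
qed

lemma completion_smult:
  assumes "cauchy x"
  shows "c \<odot>\<^bsub>\<C>\<^esub> cls x = cls (\<lambda>n. c \<odot> x n)"
proof -
  have "cls (\<lambda>n. c \<odot> x' n) = cls (\<lambda>n. c \<odot> x n)"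
    if "cauchy x'" "cls x' = cls x" for x'
    by (rule cls_eqI_dist[of x' x x x _ _ "cmod c"])
      (use assms that in \<open>auto simp: cauchy_smult cauchy_closed p_diff_smult\<close>)
  then show ?thesis
    unfolding completion_def by (simp del: UN_simps) (rule UN_cls[OF assms])
qed

lemma completion_adj:
  assumes "cauchy x"
  shows "adj \<C> (cls x) = cls (\<lambda>n. adj A (x n))"
proof -
  have "cls (\<lambda>n. adj A (x' n)) = cls (\<lambda>n. adj A (x n))"
    if "cauchy x'" "cls x' = cls x" for x'
    by (rule cls_eqI_dist[of x' x x x _ _ 1])
      (use assms that in \<open>auto simp: cauchy_adj cauchy_closed p_diff_adj\<close>)
  then show ?thesis
    unfolding completion_def by (simp del: UN_simps) (rule UN_cls[OF assms])
qed

lemma completion_one: "\<one>\<^bsub>\<C>\<^esub> = cls (\<lambda>n. \<one>)"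
  and completion_zero: "\<zero>\<^bsub>\<C>\<^esub> = cls (\<lambda>n. \<zero>)"
  by (simp_all add: completion_def)

text \<open>By the reverse triangle inequality the reals p(x n) form a Cauchy sequence, and
  equivalent sequences give the same limit. So the description that defines \<open>cnorm\<close> in
  \<open>completion\<close> denotes this limit.\<close>

lemma completion_cnorm:
  assumes "cauchy x"
  shows "(\<lambda>n. p (x n)) \<longlonglongrightarrow> cnorm \<C> (cls x)"
proof -
  have "Cauchy (\<lambda>n. p (x n))"
  proof (rule CauchyI)
    fix e :: real assume "e > 0"
    then obtain N where "\<And>m n. m \<ge> N \<Longrightarrow> n \<ge> N \<Longrightarrow> p (x m \<ominus> x n) < e"
      using assms unfolding seminorm_cauchy_def by meson
    then show "\<exists>M. \<forall>m\<ge>M. \<forall>n\<ge>M. norm (p (x m) - p (x n)) < e"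
      using p_abs_diff[OF cauchy_closed[OF assms] cauchy_closed[OF assms]] order.strict_trans1
      unfolding real_norm_def by blast
  qed
  then obtain l where l: "(\<lambda>n. p (x n)) \<longlonglongrightarrow> l"
    using Cauchy_convergent convergent_def by blast
  have "(\<lambda>n. p (x' n)) \<longlonglongrightarrow> l" if "x' \<in> cls x" for x'
  proof -
    have x': "cauchy x'" "(\<lambda>n. p (x n \<ominus> x' n)) \<longlonglongrightarrow> 0"
      using cls_memD[OF that] assms by (auto simp: cls_eq_iff[symmetric])
    have "(\<lambda>n. p (x' n) - p (x n)) \<longlonglongrightarrow> 0"
      by (rule Lim_null_comparison[OF _ x'(2)])
        (use p_abs_diff x' assms in \<open>auto simp: cauchy_closed p_diff_commute[of "x _"]\<close>)
    from tendsto_add[OF this l] show ?thesis by simp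
  qed
  then have "(THE l. \<forall>x'\<in>cls x. (\<lambda>n. p (x' n)) \<longlonglongrightarrow> l) = l"
    using cls_self[OF assms] LIMSEQ_unique by (intro the_equality) blast+
  with l show ?thesis
    by (simp add: completion_def)
qed

lemma completionE:
  assumes "X \<in> carrier \<C>"
  obtains x where "cauchy x" "X = cls x"
  using assms by (auto simp: carrier_completion)

lemma cls_closed: "cauchy x \<Longrightarrow> cls x \<in> carrier \<C>"
  by (auto simp: carrier_completion)

lemmas cauchy_intros = cauchy_add cauchy_mult cauchy_smult cauchy_adj cauchy_const

lemmas completion_ops = completion_add completion_mult completion_smult completion_adj
  completion_one completion_zero

text \<open>Every law holds termwise for representatives.\<close>

lemma star_algebra_completion: "star_algebra \<C>"
proof -
  interpret C: ring \<C>
  proof (rule ringI)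
    show "abelian_group \<C>"
    proof (rule abelian_groupI)
      fix X assume "X \<in> carrier \<C>"
      then obtain x where x: "cauchy x" "X = cls x" by (rule completionE)
      then show "\<exists>Y\<in>carrier \<C>. Y \<oplus>\<^bsub>\<C>\<^esub> X = \<zero>\<^bsub>\<C>\<^esub>"
        by (intro bexI[of _ "cls (\<lambda>n. (-1) \<odot> x n)"])
          (simp_all add: completion_ops cauchy_intros cls_closed uminus_left_inverse cauchy_closed)
    qed (auto elim!: completionE simp: completion_ops cauchy_intros cls_closed a_ac cauchy_closed)
    show "monoid \<C>"
      by (rule monoidI)
        (auto elim!: completionE simp: completion_ops cauchy_intros cls_closed m_assoc cauchy_closed)
  qed (auto elim!: completionE simp: completion_ops cauchy_intros cls_closed l_distr r_distr cauchy_closed)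
  show ?thesis
    by unfold_locales
      (auto elim!: completionE simp: completion_ops cauchy_intros cls_closed cauchy_closed
        smult_add add_smult smult_smult smult_mult_left smult_mult_right adj_add adj_smult adj_mult)
qed

lemma completion_diff:
  assumes "cauchy x" "cauchy y"
  shows "cls x \<ominus>\<^bsub>\<C>\<^esub> cls y = cls (\<lambda>n. x n \<ominus> y n)"
proof -
  interpret C: star_algebra \<C> by (rule star_algebra_completion)
  show ?thesis
    using assms by (simp add: C.minus_eq_smult minus_eq_smult cls_closed cauchy_closed completion_ops cauchy_intros)
qed

lemma cstar_seminorm_completion: "cstar_seminorm \<C> (cnorm \<C>)"
  unfolding cstar_seminorm_def
proof (intro conjI ballI allI)
  fix X assume "X \<in> carrier \<C>"
  then obtain x where x: "cauchy x" "X = cls x" by (rule completionE)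
  note X = completion_cnorm[OF x(1), folded x(2)]
  show "0 \<le> cnorm \<C> X"
    using LIMSEQ_le_const[OF X, of 0] x by (auto simp: cauchy_closed)
  show "cnorm \<C> (c \<odot>\<^bsub>\<C>\<^esub> X) = cmod c * cnorm \<C> X" for c
    using completion_cnorm[OF cauchy_smult[OF x(1)], of c] tendsto_mult_left[OF X, of "cmod c"] x
    by (auto simp: p_smult cauchy_closed completion_ops intro: LIMSEQ_unique)
  show "cnorm \<C> (adj \<C> X \<otimes>\<^bsub>\<C>\<^esub> X) = (cnorm \<C> X)\<^sup>2"
    using completion_cnorm[OF cauchy_mult[OF cauchy_adj x(1)], OF x(1)] tendsto_power[OF X, of 2] x
    by (auto simp: p_adj_mult cauchy_closed completion_ops cauchy_intros intro: LIMSEQ_unique)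
  fix Y assume "Y \<in> carrier \<C>"
  then obtain y where y: "cauchy y" "Y = cls y" by (rule completionE)
  note Y = completion_cnorm[OF y(1), folded y(2)]
  show "cnorm \<C> (X \<oplus>\<^bsub>\<C>\<^esub> Y) \<le> cnorm \<C> X + cnorm \<C> Y"
    using LIMSEQ_le[OF completion_cnorm[OF cauchy_add[OF x(1) y(1)]] tendsto_add[OF X Y]] x y
    by (auto simp: completion_ops cauchy_closed p_add)
  show "cnorm \<C> (X \<otimes>\<^bsub>\<C>\<^esub> Y) \<le> cnorm \<C> X * cnorm \<C> Y"
    using LIMSEQ_le[OF completion_cnorm[OF cauchy_mult[OF x(1) y(1)]] tendsto_mult[OF X Y]] x y
    by (auto simp: completion_ops cauchy_closed p_mult)
qed

lemma cnorm_const: "a \<in> carrier A \<Longrightarrow> cnorm \<C> (cls (\<lambda>n. a)) = p a"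
  using completion_cnorm[OF cauchy_const] LIMSEQ_unique tendsto_const by blast

lemma completion_dense:
  assumes "X \<in> carrier \<C>" "e > 0"
  obtains a where "a \<in> carrier A" "cnorm \<C> (X \<ominus>\<^bsub>\<C>\<^esub> cls (\<lambda>n. a)) < e"
proof -
  obtain x where x: "cauchy x" "X = cls x" using assms by (auto elim: completionE)
  \<comment> \<open>Half of \<open>e\<close>, because passing to the limit preserves only
    \<le>.\<close>
  obtain N where N: "\<And>m n. m \<ge> N \<Longrightarrow> n \<ge> N \<Longrightarrow> p (x m \<ominus> x n) < e / 2"
    using x(1) \<open>e > 0\<close> unfolding seminorm_cauchy_def by (meson half_gt_zero)
  have a: "x N \<in> carrier A" using x cauchy_closed by blast
  have "cauchy (\<lambda>n. x n \<ominus> x N)"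
    using cauchy_add[OF x(1) cauchy_const[of "\<ominus> x N"]] a by (simp add: minus_eq)
  from LIMSEQ_le_const2[OF completion_cnorm[OF this], OF exI[of _ N], of "e / 2"]
  have "cnorm \<C> (X \<ominus>\<^bsub>\<C>\<^esub> cls (\<lambda>n. x N)) \<le> e / 2"
    using x a N by (auto simp: completion_diff cauchy_const less_imp_le)
  with that[OF a] \<open>e > 0\<close> show ?thesis by simp
qed

lemma cstar_algebra_completion: "cstar_algebra \<C>"
proof -
  interpret C: seminormed_star_algebra \<C> "cnorm \<C>"
    using star_algebra_completion cstar_seminorm_completion
    by (simp add: seminormed_star_algebra_def seminormed_star_algebra_axioms_def)
  show ?thesis
  proof
    show "cstar_seminorm \<C> (cnorm \<C>)" by (rule cstar_seminorm_completion)
  next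
    fix X assume X: "X \<in> carrier \<C>" "cnorm \<C> X = 0"
    then obtain x where x: "cauchy x" "X = cls x" by (auto elim: completionE)
    then show "X = \<zero>\<^bsub>\<C>\<^esub>"
      using completion_cnorm[OF x(1)] X
      by (simp add: completion_zero cls_eq_iff cauchy_const minus_eq cauchy_closed)
  next
    fix X assume X: "seminorm_cauchy \<C> (cnorm \<C>) X"
    \<comment> \<open>Each \<open>X n\<close> is replaced by a constant sequence at distance below
      1/(n+1). The approximants \<open>a n\<close> form a Cauchy sequence in A, and its class is the
      limit.\<close>
    have "\<forall>n. \<exists>a. a \<in> carrier A \<and> cnorm \<C> (X n \<ominus>\<^bsub>\<C>\<^esub> cls (\<lambda>_. a)) < 1 / real (Suc n)"
      using completion_dense C.cauchy_closed[OF X] by (metis of_nat_0_less_iff zero_less_Suc zero_less_divide_1_iff)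
    then obtain a where a: "\<And>n. a n \<in> carrier A"
      "\<And>n. cnorm \<C> (X n \<ominus>\<^bsub>\<C>\<^esub> cls (\<lambda>_. a n)) < 1 / real (Suc n)"
      by metis
    let ?\<iota> = "\<lambda>n. cls (\<lambda>_. a n)"
    have \<iota>: "?\<iota> n \<in> carrier \<C>" for n using a by (simp add: cls_closed cauchy_const)
    have Xc: "X n \<in> carrier \<C>" for n using C.cauchy_closed[OF X] .
    have lim0: "(\<lambda>n. cnorm \<C> (X n \<ominus>\<^bsub>\<C>\<^esub> ?\<iota> n)) \<longlonglongrightarrow> 0"
      by (rule tendsto_sandwich[OF _ _ tendsto_const LIMSEQ_inverse_real_of_nat])
        (use a \<iota> Xc in \<open>auto simp: inverse_eq_divide less_imp_le\<close>)
    have a_cauchy: "cauchy a"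
      unfolding seminorm_cauchy_def
    proof (intro conjI allI impI)
      fix e :: real assume "e > 0"
      then have e3: "e / 3 > 0" by simp
      obtain N1 where N1: "\<And>m n. m \<ge> N1 \<Longrightarrow> n \<ge> N1 \<Longrightarrow> cnorm \<C> (X m \<ominus>\<^bsub>\<C>\<^esub> X n) < e / 3"
        using X e3 unfolding seminorm_cauchy_def by meson
      obtain N2 where N2: "\<And>n. n \<ge> N2 \<Longrightarrow> cnorm \<C> (X n \<ominus>\<^bsub>\<C>\<^esub> ?\<iota> n) < e / 3"
        using order_tendstoD(2)[OF lim0 e3] by (auto simp: eventually_sequentially)
      have "p (a m \<ominus> a n) < e" if "m \<ge> max N1 N2" "n \<ge> max N1 N2" for m n
      proof -
        have "p (a m \<ominus> a n) = cnorm \<C> (?\<iota> m \<ominus>\<^bsub>\<C>\<^esub> ?\<iota> n)"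
          using a by (simp add: completion_diff cauchy_const cnorm_const)
        also have "\<dots> \<le> cnorm \<C> (?\<iota> m \<ominus>\<^bsub>\<C>\<^esub> X m) + cnorm \<C> (X m \<ominus>\<^bsub>\<C>\<^esub> ?\<iota> n)"
          using C.p_triangle \<iota> Xc by blast
        also have "\<dots> \<le> cnorm \<C> (?\<iota> m \<ominus>\<^bsub>\<C>\<^esub> X m) + (cnorm \<C> (X m \<ominus>\<^bsub>\<C>\<^esub> X n) + cnorm \<C> (X n \<ominus>\<^bsub>\<C>\<^esub> ?\<iota> n))"
          using C.p_triangle \<iota> Xc by (intro add_left_mono) blast
        also have "\<dots> < e / 3 + (e / 3 + e / 3)"
          using N1[of m n] N2[of m] N2[of n] that C.p_diff_commute[OF \<iota> Xc, of m m] by (intro add_strict_mono) auto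
        finally show ?thesis by simp
      qed
      then show "\<exists>N. \<forall>m\<ge>N. \<forall>n\<ge>N. p (a m \<ominus> a n) < e" by blast
    qed (use a in auto)
    have lim1: "(\<lambda>n. cnorm \<C> (?\<iota> n \<ominus>\<^bsub>\<C>\<^esub> cls a)) \<longlonglongrightarrow> 0"
    proof (rule LIMSEQ_I)
      fix e :: real assume "0 < e"
      then have "e / 2 > 0" by simp
      then obtain N where N: "\<And>m n. m \<ge> N \<Longrightarrow> n \<ge> N \<Longrightarrow> p (a m \<ominus> a n) < e / 2"
        using a_cauchy unfolding seminorm_cauchy_def by meson
      have "cnorm \<C> (?\<iota> n \<ominus>\<^bsub>\<C>\<^esub> cls a) \<le> e / 2" if "n \<ge> N" for n
      proof -
        have "cauchy (\<lambda>k. a n \<ominus> a k)"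
          using cauchy_add[OF cauchy_const[of "a n"] cauchy_smult[OF a_cauchy, of "-1"]] a
          by (simp add: minus_eq_smult)
        from LIMSEQ_le_const2[OF completion_cnorm[OF this], OF exI[of _ N], of "e / 2"] show ?thesis
          using a N[OF that] by (auto simp: completion_diff cauchy_const a_cauchy less_imp_le)
      qed
      then show "\<exists>no. \<forall>n\<ge>no. norm (cnorm \<C> (?\<iota> n \<ominus>\<^bsub>\<C>\<^esub> cls a) - 0) < e"
        using \<open>0 < e\<close> \<iota> cls_closed[OF a_cauchy] by (intro exI[of _ N]) force
    qed
    have "(\<lambda>n. cnorm \<C> (X n \<ominus>\<^bsub>\<C>\<^esub> cls a)) \<longlonglongrightarrow> 0"
      by (rule tendsto_sandwich[OF _ _ tendsto_const tendsto_add_zero[OF lim0 lim1]])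
        (use C.p_triangle \<iota> Xc cls_closed[OF a_cauchy] in auto)
    then show "\<exists>l\<in>carrier \<C>. (\<lambda>n. cnorm \<C> (X n \<ominus>\<^bsub>\<C>\<^esub> l)) \<longlonglongrightarrow> 0"
      using cls_closed[OF a_cauchy] by blast
  qed
qed

lemma completion_embedding: "(\<lambda>a. cls (\<lambda>n. a)) \<in> star_hom A \<C>"
  by (auto simp: star_hom_def ring_hom_def completion_ops cauchy_intros cls_closed)

end

section \<open>Limits and *-homomorphisms\<close>

lemma star_homI:
  assumes "\<And>x. x \<in> carrier A \<Longrightarrow> h x \<in> carrier B"
    and "\<And>x y. \<lbrakk>x \<in> carrier A; y \<in> carrier A\<rbrakk> \<Longrightarrow> h (x \<oplus>\<^bsub>A\<^esub> y) = h x \<oplus>\<^bsub>B\<^esub> h y"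
    and "\<And>x y. \<lbrakk>x \<in> carrier A; y \<in> carrier A\<rbrakk> \<Longrightarrow> h (x \<otimes>\<^bsub>A\<^esub> y) = h x \<otimes>\<^bsub>B\<^esub> h y"
    and "h \<one>\<^bsub>A\<^esub> = \<one>\<^bsub>B\<^esub>"
    and "\<And>c x. x \<in> carrier A \<Longrightarrow> h (c \<odot>\<^bsub>A\<^esub> x) = c \<odot>\<^bsub>B\<^esub> h x"
    and "\<And>x. x \<in> carrier A \<Longrightarrow> h (adj A x) = adj B (h x)"
  shows "h \<in> star_hom A B"
  using assms by (auto simp: star_hom_def ring_hom_def)

lemma
  assumes "h \<in> star_hom A B"
  shows star_hom_closed: "x \<in> carrier A \<Longrightarrow> h x \<in> carrier B"
    and star_hom_add: "\<lbrakk>x \<in> carrier A; y \<in> carrier A\<rbrakk> \<Longrightarrow> h (x \<oplus>\<^bsub>A\<^esub> y) = h x \<oplus>\<^bsub>B\<^esub> h y"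
    and star_hom_mult: "\<lbrakk>x \<in> carrier A; y \<in> carrier A\<rbrakk> \<Longrightarrow> h (x \<otimes>\<^bsub>A\<^esub> y) = h x \<otimes>\<^bsub>B\<^esub> h y"
    and star_hom_one: "h \<one>\<^bsub>A\<^esub> = \<one>\<^bsub>B\<^esub>"
    and star_hom_smult: "x \<in> carrier A \<Longrightarrow> h (c \<odot>\<^bsub>A\<^esub> x) = c \<odot>\<^bsub>B\<^esub> h x"
    and star_hom_adj: "x \<in> carrier A \<Longrightarrow> h (adj A x) = adj B (h x)"
  using assms by (auto simp: star_hom_def ring_hom_def)

lemmas star_hom_ops = star_hom_closed star_hom_add star_hom_mult star_hom_one star_hom_smult star_hom_adj

lemma star_hom_zero:
  assumes "h \<in> star_hom A B" "star_algebra A" "star_algebra B"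
  shows "h \<zero>\<^bsub>A\<^esub> = \<zero>\<^bsub>B\<^esub>"
proof -
  interpret A: star_algebra A by fact
  interpret B: star_algebra B by fact
  show ?thesis
    using star_hom_smult[OF assms(1), of "\<zero>\<^bsub>A\<^esub>" 0] star_hom_closed[OF assms(1), of "\<zero>\<^bsub>A\<^esub>"] by simp
qed

lemma star_hom_diff:
  assumes "h \<in> star_hom A B" "star_algebra A" "star_algebra B" "x \<in> carrier A" "y \<in> carrier A"
  shows "h (x \<ominus>\<^bsub>A\<^esub> y) = h x \<ominus>\<^bsub>B\<^esub> h y"
proof -
  interpret A: star_algebra A by fact
  interpret B: star_algebra B by fact
  show ?thesis
    using assms by (simp add: A.minus_eq_smult B.minus_eq_smult star_hom_ops[OF assms(1)])
qed

lemma star_hom_comp: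
  assumes "h \<in> star_hom A B" "k \<in> star_hom B C"
  shows "(\<lambda>x. k (h x)) \<in> star_hom A C"
  by (rule star_homI) (simp_all add: star_hom_ops[OF assms(1)] star_hom_ops[OF assms(2)])

lemma star_hom_id: "(\<lambda>x. x) \<in> star_hom A A"
  by (rule star_homI) auto

lemma cstar_seminorm_pullback:
  assumes "h \<in> star_hom A B" "cstar_seminorm B q"
    and closed: "\<And>x. x \<in> carrier A \<Longrightarrow> adj A x \<in> carrier A"
  shows "cstar_seminorm A (\<lambda>x. q (h x))"
proof -
  note h = star_hom_ops[OF assms(1)]
  have "q (h (adj A x \<otimes>\<^bsub>A\<^esub> x)) = q (adj B (h x) \<otimes>\<^bsub>B\<^esub> h x)" if "x \<in> carrier A" for x
    using star_hom_mult[OF assms(1), of "adj A x" x] that closed[OF that] by (simp add: h)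
  then show ?thesis
    using assms(2) by (simp add: cstar_seminorm_def h)
qed

context seminormed_star_algebra
begin

text \<open>Carrier membership is part of the notion, since nothing is known about p outside the
  carrier.\<close>

definition tends :: "(nat \<Rightarrow> 'a) \<Rightarrow> 'a \<Rightarrow> bool" where
  "tends X l \<longleftrightarrow> (\<forall>n. X n \<in> carrier A) \<and> l \<in> carrier A \<and> (\<lambda>n. p (X n \<ominus> l)) \<longlonglongrightarrow> 0"

lemma tends_closed: "tends X l \<Longrightarrow> X n \<in> carrier A" "tends X l \<Longrightarrow> l \<in> carrier A"
  by (auto simp: tends_def)

lemma tendsI:
  assumes "\<And>n. X n \<in> carrier A" "l \<in> carrier A" "\<And>n. p (X n \<ominus> l) \<le> d n" "d \<longlonglongrightarrow> 0"
  shows "tends X l"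
  unfolding tends_def
  by (intro conjI allI tendsto_sandwich[OF _ _ tendsto_const assms(4)]) (use assms in auto)

lemma tends_const: "a \<in> carrier A \<Longrightarrow> tends (\<lambda>n. a) a"
  by (rule tendsI[where d = "\<lambda>n. 0"]) auto

lemma tends_norm:
  assumes "tends X l"
  shows "(\<lambda>n. p (X n)) \<longlonglongrightarrow> p l"
proof -
  have "(\<lambda>n. p (X n) - p l) \<longlonglongrightarrow> 0"
    by (rule Lim_null_comparison[where g = "\<lambda>n. p (X n \<ominus> l)"])
      (use assms p_abs_diff in \<open>auto simp: tends_def\<close>)
  then show ?thesis
    by (simp add: LIM_zero_iff)
qed

lemma tends_add:
  assumes "tends X l" "tends Y m"
  shows "tends (\<lambda>n. X n \<oplus> Y n) (l \<oplus> m)"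
  by (rule tendsI[where d = "\<lambda>n. p (X n \<ominus> l) + p (Y n \<ominus> m)"])
    (use assms in \<open>auto simp: tends_def p_diff_add tendsto_add_zero\<close>)

lemma tends_smult:
  assumes "tends X l"
  shows "tends (\<lambda>n. c \<odot> X n) (c \<odot> l)"
  by (rule tendsI[where d = "\<lambda>n. cmod c * p (X n \<ominus> l)"])
    (use assms in \<open>auto simp: tends_def p_diff_smult intro: tendsto_mult_right_zero\<close>)

lemma tends_adj:
  assumes "tends X l"
  shows "tends (\<lambda>n. adj A (X n)) (adj A l)"
  by (rule tendsI[where d = "\<lambda>n. p (X n \<ominus> l)"])
    (use assms in \<open>auto simp: tends_def p_diff_adj\<close>)

lemma tends_mult:
  assumes "tends X l" "tends Y m"
  shows "tends (\<lambda>n. X n \<otimes> Y n) (l \<otimes> m)"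
proof (rule tendsI)
  show "p (X n \<otimes> Y n \<ominus> l \<otimes> m) \<le> p (X n) * p (Y n \<ominus> m) + p (X n \<ominus> l) * p m" for n
    using assms by (auto simp: tends_def p_diff_mult)
  have "(\<lambda>n. p (X n) * p (Y n \<ominus> m) + p (X n \<ominus> l) * p m) \<longlonglongrightarrow> p l * 0 + 0 * p m"
    using assms tends_norm[OF assms(1)] by (intro tendsto_intros) (auto simp: tends_def)
  then show "(\<lambda>n. p (X n) * p (Y n \<ominus> m) + p (X n \<ominus> l) * p m) \<longlonglongrightarrow> 0"
    by simp
qed (use assms in \<open>auto simp: tends_def\<close>)

lemma tends_diff:
  assumes "tends X l" "tends Y m"
  shows "tends (\<lambda>n. X n \<ominus> Y n) (l \<ominus> m)"
  using tends_add[OF assms(1) tends_smult[OF assms(2), of "-1"]] assms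
  by (simp add: minus_eq_smult tends_closed)

lemma tends_cauchy:
  assumes "tends X l"
  shows "seminorm_cauchy A p X"
  unfolding seminorm_cauchy_def
proof (intro conjI allI impI)
  fix e :: real assume "e > 0"
  then have "e / 2 > 0" by simp
  then obtain N where N: "\<And>n. n \<ge> N \<Longrightarrow> p (X n \<ominus> l) < e / 2"
    using assms order_tendstoD(2)[of "\<lambda>n. p (X n \<ominus> l)" 0 sequentially "e / 2"]
    by (auto simp: tends_def eventually_sequentially)
  have "p (X m \<ominus> X n) < e" if "m \<ge> N" "n \<ge> N" for m n
    using p_triangle[of "X m" l "X n"] N[of m] N[of n] that p_diff_commute[of l "X n"] tends_closed[OF assms]
    by simp
  then show "\<exists>N. \<forall>m\<ge>N. \<forall>n\<ge>N. p (X m \<ominus> X n) < e"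
    by blast
qed (use tends_closed[OF assms] in auto)

end

sublocale cstar_algebra \<subseteq> seminormed_star_algebra A "cnorm A"
  by unfold_locales (rule cnorm_seminorm)

context cstar_algebra
begin

lemma tends_unique:
  assumes "tends X l" "tends X m"
  shows "l = m"
proof -
  have "cnorm A (l \<ominus> m) = 0"
    using LIMSEQ_unique[OF tends_norm[OF tends_diff[OF assms]], of 0] assms
    using tends_norm[OF tends_diff[OF assms]] by (simp add: tends_closed[OF assms(1)] LIMSEQ_const_iff)
  then show ?thesis
    using cnorm_eq_0[of "l \<ominus> m"] diff_eq_zero_iff[of l m] tends_closed(2)[OF assms(1)] tends_closed(2)[OF assms(2)] by simp
qed

lemma cauchy_tends:
  assumes "seminorm_cauchy A (cnorm A) X"
  obtains l where "tends X l"
  using cnorm_complete[OF assms] cauchy_closed[OF assms] unfolding tends_def by blast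

end

lemma seminormed_star_algebraI:
  "star_algebra A \<Longrightarrow> cstar_seminorm A p \<Longrightarrow> seminormed_star_algebra A p"
  by (simp add: seminormed_star_algebra_def seminormed_star_algebra_axioms_def)

definition dense_in :: "('a, 'm) star_alg_scheme \<Rightarrow> ('a \<Rightarrow> real) \<Rightarrow> 'a set \<Rightarrow> bool" where
  "dense_in C q S \<longleftrightarrow> S \<subseteq> carrier C \<and> (\<forall>c\<in>carrier C. \<forall>e>0. \<exists>s\<in>S. q (c \<ominus>\<^bsub>C\<^esub> s) < e)"

lemma (in seminormed_star_algebra) dense_inD:
  assumes "dense_in A p S" "c \<in> carrier A"
  obtains X where "\<And>n::nat. X n \<in> S" "tends X c"
proof -
  have "\<forall>n. \<exists>s\<in>S. p (c \<ominus> s) < 1 / real (Suc n)"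
    using assms by (simp add: dense_in_def)
  then obtain X where X: "\<And>n. X n \<in> S" "\<And>n. p (c \<ominus> X n) < 1 / real (Suc n)" by metis
  then have c: "X n \<in> carrier A" for n
    using assms by (auto simp: dense_in_def)
  have "tends X c"
    by (rule tendsI[OF _ _ _ LIMSEQ_inverse_real_of_nat])
      (use X c assms in \<open>auto simp: inverse_eq_divide less_imp_le p_diff_commute[of _ c]\<close>)
  with X show ?thesis using that by blast
qed

lemma tends_hom:
  assumes "seminormed_star_algebra C q" "seminormed_star_algebra B r" "h \<in> star_hom C B"
    and "\<And>x. x \<in> carrier C \<Longrightarrow> r (h x) \<le> q x"
    and "seminormed_star_algebra.tends C q X l"
  shows "seminormed_star_algebra.tends B r (\<lambda>n. h (X n)) (h l)"
proof -
  interpret C: seminormed_star_algebra C q by fact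
  interpret B: seminormed_star_algebra B r by fact
  note X = C.tends_closed[OF assms(5)]
  show ?thesis
  proof (rule B.tendsI[where d = "\<lambda>n. q (X n \<ominus>\<^bsub>C\<^esub> l)"])
    show "r (h (X n) \<ominus>\<^bsub>B\<^esub> h l) \<le> q (X n \<ominus>\<^bsub>C\<^esub> l)" for n
      using assms(4)[of "X n \<ominus>\<^bsub>C\<^esub> l"] X
      by (simp add: star_hom_diff[OF assms(3) C.star_algebra_axioms B.star_algebra_axioms])
  qed (use X assms(5) star_hom_closed[OF assms(3)] in \<open>auto simp: C.tends_def\<close>)
qed

text \<open>Contractivity is a hypothesis because \<open>C\<close> carries only a seminorm; besides
  C*-algebras, the functions on the circle are such a \<open>C\<close>, and there contractivity has
  a proof of its own.\<close>

lemma star_hom_eq_on_dense: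
  assumes "seminormed_star_algebra C q" "cstar_algebra B" "h \<in> star_hom C B" "k \<in> star_hom C B"
    and "\<And>x. x \<in> carrier C \<Longrightarrow> cnorm B (h x) \<le> q x" "\<And>x. x \<in> carrier C \<Longrightarrow> cnorm B (k x) \<le> q x"
    and "dense_in C q S" "\<And>s. s \<in> S \<Longrightarrow> h s = k s" "c \<in> carrier C"
  shows "h c = k c"
proof -
  interpret C: seminormed_star_algebra C q by fact
  interpret B: cstar_algebra B by fact
  obtain X where X: "\<And>n. X n \<in> S" "C.tends X c"
    using C.dense_inD[OF assms(7,9)] by blast
  have "B.tends (\<lambda>n. h (X n)) (h c)" "B.tends (\<lambda>n. k (X n)) (k c)"
    using tends_hom[OF assms(1) B.seminormed_star_algebra_axioms assms(3) assms(5) X(2)]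
      tends_hom[OF assms(1) B.seminormed_star_algebra_axioms assms(4) assms(6) X(2)] by auto
  then show ?thesis
    using assms(8) X(1) by (auto intro: B.tends_unique)
qed

text \<open>Applied with \<open>j\<close> the canonical map into an enveloping algebra, and with
  \<open>j\<close> the map from Laurent polynomials to functions on the circle.\<close>

lemma star_hom_extension:
  assumes "star_algebra D" "seminormed_star_algebra C q" "cstar_algebra B"
    and j: "j \<in> star_hom D C" and h: "h \<in> star_hom D B"
    and dense: "dense_in C q (j ` carrier D)"
    and le: "\<And>a. a \<in> carrier D \<Longrightarrow> cnorm B (h a) \<le> q (j a)"
  shows "\<exists>H\<in>star_hom C B. \<forall>a\<in>carrier D. H (j a) = h a"
proof -
  interpret D: star_algebra D by fact
  interpret C: seminormed_star_algebra C q by fact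
  interpret B: cstar_algebra B by fact
  note jD = star_hom_ops[OF j] star_hom_diff[OF j D.star_algebra_axioms C.star_algebra_axioms]
  note hD = star_hom_ops[OF h] star_hom_diff[OF h D.star_algebra_axioms B.star_algebra_axioms]
  \<comment> \<open>The graph of the extension is the closure of the graph of \<open>j a \<mapsto> h a\<close>.\<close>
  define G where "G c b \<longleftrightarrow> (\<exists>a. (\<forall>n. a n \<in> carrier D) \<and> C.tends (\<lambda>n. j (a n)) c \<and> B.tends (\<lambda>n. h (a n)) b)" for c b
  have total: "\<exists>b. G c b" if c: "c \<in> carrier C" for c
  proof -
    obtain X where X: "\<And>n. X n \<in> j ` carrier D" "C.tends X c"
      using C.dense_inD[OF dense c] by blast
    have "\<forall>n. \<exists>a. a \<in> carrier D \<and> X n = j a"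
      using X(1) by auto
    then obtain a where a: "\<And>n. a n \<in> carrier D" "\<And>n. X n = j (a n)"
      by metis
    have ja: "C.tends (\<lambda>n. j (a n)) c"
      using X(2) unfolding a(2)[symmetric] .
    have "seminorm_cauchy B (cnorm B) (\<lambda>n. h (a n))"
      unfolding seminorm_cauchy_def
    proof (intro conjI allI impI)
      fix e :: real assume "e > 0"
      then obtain N where N: "\<And>m n. m \<ge> N \<Longrightarrow> n \<ge> N \<Longrightarrow> q (j (a m) \<ominus>\<^bsub>C\<^esub> j (a n)) < e"
        using C.tends_cauchy[OF ja] unfolding seminorm_cauchy_def by meson
      have "cnorm B (h (a m) \<ominus>\<^bsub>B\<^esub> h (a n)) < e" if "m \<ge> N" "n \<ge> N" for m n
        using le[of "a m \<ominus>\<^bsub>D\<^esub> a n"] N[OF that] a by (simp add: hD jD)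
      then show "\<exists>N. \<forall>m\<ge>N. \<forall>n\<ge>N. cnorm B (h (a m) \<ominus>\<^bsub>B\<^esub> h (a n)) < e" by blast
    qed (use a hD in auto)
    then obtain b where "B.tends (\<lambda>n. h (a n)) b"
      by (rule B.cauchy_tends)
    then show ?thesis
      using a ja unfolding G_def by blast
  qed
  \<comment> \<open>The domination \<open>le\<close> makes the graph single-valued: if two sequences
    have the same limit in C, the difference of their images under h tends to 0.\<close>
  have unique: "b = b'" if G: "G c b" "G c b'" for c b b'
  proof -
    obtain a where a: "\<And>n. a n \<in> carrier D" "C.tends (\<lambda>n. j (a n)) c" "B.tends (\<lambda>n. h (a n)) b"
      using G unfolding G_def by blast
    obtain a' where a': "\<And>n. a' n \<in> carrier D" "C.tends (\<lambda>n. j (a' n)) c" "B.tends (\<lambda>n. h (a' n)) b'"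
      using G unfolding G_def by blast
    have "(\<lambda>n. q (j (a n) \<ominus>\<^bsub>C\<^esub> j (a' n))) \<longlonglongrightarrow> 0"
      using C.tends_norm[OF C.tends_diff[OF a(2) a'(2)]] C.tends_closed[OF a(2)] by simp
    moreover have "cnorm B (h (a n) \<ominus>\<^bsub>B\<^esub> h (a' n)) \<le> q (j (a n) \<ominus>\<^bsub>C\<^esub> j (a' n))" for n
      using le[of "a n \<ominus>\<^bsub>D\<^esub> a' n"] a a' by (simp add: hD jD)
    ultimately have "B.tends (\<lambda>n. h (a n) \<ominus>\<^bsub>B\<^esub> h (a' n)) \<zero>\<^bsub>B\<^esub>"
      using a a' hD by (intro B.tendsI[where d = "\<lambda>n. q (j (a n) \<ominus>\<^bsub>C\<^esub> j (a' n))"]) (auto simp: B.minus_eq)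
    from B.tends_unique[OF this B.tends_diff[OF a(3) a'(3)]] show ?thesis
      using B.diff_eq_zero_iff[of b b'] B.tends_closed(2)[OF a(3)] B.tends_closed(2)[OF a'(3)] by simp
  qed
  define H where "H c = (THE b. G c b)" for c
  have H: "H c = b" if "G c b" for c b
    unfolding H_def by (rule the_equality, rule that, rule unique[OF _ that])
  have GH: "G c (H c)" if c: "c \<in> carrier C" for c
  proof -
    obtain b where b: "G c b"
      using total[OF c] by auto
    with H[OF b] show ?thesis by simp
  qed
  have G_closed: "b \<in> carrier B" if "G c b" for c b
    using that unfolding G_def by (auto dest: B.tends_closed(2))
  have G_j: "G (j a) (h a)" if "a \<in> carrier D" for a
    unfolding G_def using that hD jD C.tends_const B.tends_const by (intro exI[of _ "\<lambda>n. a"]) auto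
  have G_add: "G (c \<oplus>\<^bsub>C\<^esub> c') (b \<oplus>\<^bsub>B\<^esub> b')" and G_mult: "G (c \<otimes>\<^bsub>C\<^esub> c') (b \<otimes>\<^bsub>B\<^esub> b')"
    and G_smult: "G (s \<odot>\<^bsub>C\<^esub> c) (s \<odot>\<^bsub>B\<^esub> b)" and G_adj: "G (adj C c) (adj B b)"
    if G: "G c b" "G c' b'" for c b c' b' s
  proof -
    obtain a where a: "\<And>n. a n \<in> carrier D" "C.tends (\<lambda>n. j (a n)) c" "B.tends (\<lambda>n. h (a n)) b"
      using G unfolding G_def by blast
    obtain a' where a': "\<And>n. a' n \<in> carrier D" "C.tends (\<lambda>n. j (a' n)) c'" "B.tends (\<lambda>n. h (a' n)) b'"
      using G unfolding G_def by blast
    show "G (c \<oplus>\<^bsub>C\<^esub> c') (b \<oplus>\<^bsub>B\<^esub> b')"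
      unfolding G_def using C.tends_add[OF a(2) a'(2)] B.tends_add[OF a(3) a'(3)] a a'
      by (intro exI[of _ "\<lambda>n. a n \<oplus>\<^bsub>D\<^esub> a' n"]) (simp add: hD jD)
    show "G (c \<otimes>\<^bsub>C\<^esub> c') (b \<otimes>\<^bsub>B\<^esub> b')"
      unfolding G_def using C.tends_mult[OF a(2) a'(2)] B.tends_mult[OF a(3) a'(3)] a a'
      by (intro exI[of _ "\<lambda>n. a n \<otimes>\<^bsub>D\<^esub> a' n"]) (simp add: hD jD)
    show "G (s \<odot>\<^bsub>C\<^esub> c) (s \<odot>\<^bsub>B\<^esub> b)"
      unfolding G_def using C.tends_smult[OF a(2)] B.tends_smult[OF a(3)] a
      by (intro exI[of _ "\<lambda>n. s \<odot>\<^bsub>D\<^esub> a n"]) (simp add: hD jD)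
    show "G (adj C c) (adj B b)"
      unfolding G_def using C.tends_adj[OF a(2)] B.tends_adj[OF a(3)] a
      by (intro exI[of _ "\<lambda>n. adj D (a n)"]) (simp add: hD jD)
  qed
  have "H \<in> star_hom C B"
  proof (rule star_homI)
    show "H \<one>\<^bsub>C\<^esub> = \<one>\<^bsub>B\<^esub>"
      using H[OF G_j[of "\<one>\<^bsub>D\<^esub>"]] by (simp add: hD jD)
  next
    fix x y c assume xy: "x \<in> carrier C" "y \<in> carrier C"
    show "H (x \<oplus>\<^bsub>C\<^esub> y) = H x \<oplus>\<^bsub>B\<^esub> H y" "H (x \<otimes>\<^bsub>C\<^esub> y) = H x \<otimes>\<^bsub>B\<^esub> H y"
      by (intro H G_add G_mult GH xy)+
  next
    fix x c assume x: "x \<in> carrier C"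
    show "H (c \<odot>\<^bsub>C\<^esub> x) = c \<odot>\<^bsub>B\<^esub> H x" "H (adj C x) = adj B (H x)"
      by (rule H, rule G_smult[OF GH[OF x] GH[OF x]], rule H, rule G_adj[OF GH[OF x] GH[OF x]])
    show "H x \<in> carrier B"
      using G_closed[OF GH[OF x]] .
  qed
  then show ?thesis
    using H[OF G_j] by (intro bexI[of _ H]) auto
qed

section \<open>Automatic continuity\<close>

text \<open>For u = x + \<i> s, \<open>comm\<close> cancels the cross terms of
  \<open>adj A u \<otimes> u\<close> and \<open>sum\<close> makes it 1, so p(u) \<le> 1 by the
  C*-identity. Finally 2 x is the sum of u and its adjoint.\<close>

lemma (in seminormed_star_algebra) p_le_1_if_unitary_part:
  assumes c: "x \<in> carrier A" "s \<in> carrier A" and sa: "adj A x = x" "adj A s = s"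
    and comm: "x \<otimes> s = s \<otimes> x" and sum: "x \<otimes> x \<oplus> s \<otimes> s = \<one>"
  shows "p x \<le> 1"
proof -
  define u where "u = x \<oplus> \<i> \<odot> s"
  have u: "u \<in> carrier A" and au: "adj A u = x \<oplus> (- \<i>) \<odot> s"
    using c sa by (simp_all add: u_def adj_add adj_smult)
  have "adj A u \<otimes> u = (x \<otimes> x \<oplus> \<i> \<odot> (x \<otimes> s)) \<oplus> ((- \<i>) \<odot> (x \<otimes> s) \<oplus> s \<otimes> s)"
    using c smult_smult[of "s \<otimes> s" \<i> "- \<i>"] unfolding au
    by (simp add: u_def l_distr r_distr smult_mult_left smult_mult_right smult_add comm a_ac)
  also have "\<dots> = (x \<otimes> x \<oplus> s \<otimes> s) \<oplus> (\<i> \<odot> (x \<otimes> s) \<oplus> (- \<i>) \<odot> (x \<otimes> s))"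
    using c by (simp add: a_ac)
  also have "\<dots> = \<one>"
    using c sum add_smult[of "x \<otimes> s" \<i> "- \<i>"] by simp
  finally have "(p u)\<^sup>2 \<le> 1"
    using p_adj_mult[OF u] p_one_le by simp
  then have pu: "p u \<le> 1"
    by (rule power2_le_imp_le[of _ 1, simplified])
  have "u \<oplus> adj A u = (x \<oplus> x) \<oplus> (\<i> \<odot> s \<oplus> (- \<i>) \<odot> s)"
    using c unfolding au by (simp add: u_def a_ac)
  also have "\<dots> = 2 \<odot> x"
    using c add_smult[of s \<i> "- \<i>"] add_smult[of x 1 1] by simp
  finally have "2 * p x \<le> p u + p (adj A u)"
    using p_smult[of x 2] p_add[of u "adj A u"] c u by simp
  then show ?thesis
    using pu u by simp
qed

text \<open>The square root is a hypothesis because it is obtained in two ways: by iteration in a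
  complete algebra and by a pointwise formula for functions on the circle. The C*-identity reduces
  the claim to self-adjoint elements, and scaling reduces it to those of norm below 1.\<close>

lemma (in seminormed_star_algebra) seminorm_le_if_sqrt:
  assumes q: "cstar_seminorm A q"
    and sqrt: "\<And>x. \<lbrakk>x \<in> carrier A; adj A x = x; p x < 1\<rbrakk> \<Longrightarrow>
      \<exists>s\<in>carrier A. adj A s = s \<and> x \<otimes> s = s \<otimes> x \<and> x \<otimes> x \<oplus> s \<otimes> s = \<one>"
    and x: "x \<in> carrier A"
  shows "q x \<le> p x"
proof -
  interpret Q: seminormed_star_algebra A q
    by (intro seminormed_star_algebraI star_algebra_axioms q)
  have sa: "q y \<le> p y" if y: "y \<in> carrier A" "adj A y = y" for y
  proof (rule field_le_epsilon)
    fix e :: real assume e: "e > 0"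
    \<comment> \<open>The summand \<open>e\<close> makes the norm of y / t strictly less than 1 and
      covers the case p(y) = 0.\<close>
    define t where "t = p y + e"
    have t: "t > 0" "p y < t" using e p_nonneg[OF y(1)] by (auto simp: t_def)
    define z where "z = complex_of_real (1 / t) \<odot> y"
    have "z \<in> carrier A" "adj A z = z" "p z < 1"
      using y t by (simp_all add: z_def adj_smult p_smult norm_divide)
    then have "q z \<le> 1"
      using sqrt[of z] Q.p_le_1_if_unitary_part by blast
    then show "q y \<le> p y + e"
      using t y unfolding t_def[symmetric] by (simp add: z_def Q.p_smult norm_divide)
  qed
  have "(q x)\<^sup>2 \<le> (p x)\<^sup>2"
    using sa[of "adj A x \<otimes> x"] x by (simp add: p_adj_mult Q.p_adj_mult adj_mult)
  then show ?thesis
    using power2_le_imp_le[of "q x" "p x"] x by simp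
qed

context cstar_algebra
begin

lemma sqrt_one_minus_exists:
  assumes a: "a \<in> carrier A" "adj A a = a" "cnorm A a < 1"
    and x: "x \<in> carrier A" "x \<otimes> a = a \<otimes> x"
  shows "\<exists>s\<in>carrier A. adj A s = s \<and> x \<otimes> s = s \<otimes> x \<and> a \<oplus> s \<otimes> s = \<one>"
proof -
  \<comment> \<open>Writing \<open>s = 1 - y\<close>, the equation \<open>s\<^sup>2 = 1 - a\<close> becomes the fixed point equation \<open>y = (a + y\<^sup>2) / 2\<close>, a
    contraction on the ball of radius \<open>\<parallel>a\<parallel> < 1\<close>.\<close>
  define r where "r = cnorm A a"
  have r: "0 \<le> r" "r < 1" using a by (auto simp: r_def)
  define F where "F y = (1/2) \<odot> (a \<oplus> y \<otimes> y)" for y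
  define Y where "Y n = (F ^^ n) \<zero>" for n
  have Y_Suc: "Y (Suc n) = F (Y n)" and Y_0: "Y 0 = \<zero>" for n
    by (simp_all add: Y_def)
  have F_closed: "F y \<in> carrier A" if "y \<in> carrier A" for y
    using that a by (simp add: F_def)
  have Yc: "Y n \<in> carrier A" for n
    by (induction n) (auto simp: Y_Suc Y_0 F_closed)
  have Ysa: "adj A (Y n) = Y n" for n
    by (induction n) (use a Yc in \<open>auto simp: Y_Suc Y_0 F_def adj_smult adj_add adj_mult\<close>)
  \<comment> \<open>All iterates are built from a, so they commute with x, and so does their limit.
    In the application a is x \<otimes> x, and the root has to commute with x itself.\<close>
  have Yx: "x \<otimes> Y n = Y n \<otimes> x" for n
  proof (induction n)
    case (Suc n)
    have "x \<otimes> (Y n \<otimes> Y n) = (Y n \<otimes> Y n) \<otimes> x"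
      by (metis Suc Yc m_assoc x(1))
    then show ?case
      using a x Yc by (simp add: Y_Suc F_def smult_mult_left smult_mult_right r_distr l_distr)
  qed (use x in \<open>simp add: Y_0\<close>)
  have Yr: "cnorm A (Y n) \<le> r" for n
  proof (induction n)
    case (Suc n)
    have "cnorm A (Y (Suc n)) \<le> (1/2) * (cnorm A a + cnorm A (Y n \<otimes> Y n))"
      using a Yc by (simp add: Y_Suc F_def p_smult p_add)
    also have "\<dots> \<le> (1/2) * (r + r * r)"
      using p_mult[OF Yc Yc, of n n] mult_mono[OF Suc Suc] Yc r by (simp add: r_def)
    also have "\<dots> \<le> r"
      using r mult_left_mono[of r 1 r] by simp
    finally show ?case .
  qed (use r in \<open>simp add: Y_0\<close>)
  \<comment> \<open>The factor 1/2 in \<open>F\<close> offsets the two terms of the product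
    difference, each at most r times the distance; hence the constant r.\<close>
  have contr: "cnorm A (F y \<ominus> F z) \<le> r * cnorm A (y \<ominus> z)"
    if yz: "y \<in> carrier A" "z \<in> carrier A" "cnorm A y \<le> r" "cnorm A z \<le> r" for y z
  proof -
    have "cnorm A (F y \<ominus> F z) = (1/2) * cnorm A ((a \<oplus> y \<otimes> y) \<ominus> (a \<oplus> z \<otimes> z))"
      using yz a by (simp add: F_def p_diff_smult)
    also have "\<dots> \<le> (1/2) * cnorm A (y \<otimes> y \<ominus> z \<otimes> z)"
      using p_diff_add[of a "y \<otimes> y" a "z \<otimes> z"] yz a by simp
    also have "\<dots> \<le> (1/2) * (cnorm A y * cnorm A (y \<ominus> z) + cnorm A (y \<ominus> z) * cnorm A z)"
      using p_diff_mult[of y y z z] yz by simp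
    also have "\<dots> \<le> (1/2) * (r * cnorm A (y \<ominus> z) + cnorm A (y \<ominus> z) * r)"
      using yz by (intro mult_left_mono add_mono mult_right_mono) auto
    finally show ?thesis by (simp add: algebra_simps)
  qed
  have step: "cnorm A (Y (Suc n) \<ominus> Y n) \<le> r ^ n" for n
  proof (induction n)
    case 0
    then show ?case
      using p_diff_le[OF Yc Yc, of 1 0] Yr[of 1] r by (simp add: Y_0)
  next
    case (Suc n)
    have "cnorm A (Y (Suc (Suc n)) \<ominus> Y (Suc n)) \<le> r * cnorm A (Y (Suc n) \<ominus> Y n)"
      using contr[OF Yc Yc Yr Yr, of "Suc n" n] by (simp add: Y_Suc)
    also have "\<dots> \<le> r * r ^ n"
      using Suc r by (intro mult_left_mono) auto
    finally show ?case by simp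
  qed
  have far: "cnorm A (Y (n + k) \<ominus> Y n) \<le> r ^ n / (1 - r)" for n k
  proof -
    have "cnorm A (Y (n + k) \<ominus> Y n) \<le> (\<Sum>i<k. r ^ (n + i))"
    proof (induction k)
      case (Suc k)
      then show ?case
        using p_triangle[of "Y (Suc (n + k))" "Y (n + k)" "Y n"] step[of "n + k"] Yc by simp
    qed (use Yc in simp)
    also have "\<dots> = r ^ n * (\<Sum>i<k. r ^ i)"
      by (simp add: power_add sum_distrib_left)
    also have "\<dots> \<le> r ^ n * (1 / (1 - r))"
      using r by (intro mult_left_mono) (simp_all add: sum_gp_strict divide_right_mono)
    finally show ?thesis by simp
  qed
  have "seminorm_cauchy A (cnorm A) Y"
    unfolding seminorm_cauchy_def
  proof (intro conjI allI impI)
    fix e :: real assume e: "e > 0"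
    have "(\<lambda>n. r ^ n / (1 - r)) \<longlonglongrightarrow> 0 / (1 - r)"
      using r by (intro tendsto_divide tendsto_const LIMSEQ_power_zero) auto
    then have "eventually (\<lambda>n. r ^ n / (1 - r) < e / 2) sequentially"
      using e by (intro order_tendstoD) auto
    then obtain N where N: "r ^ N / (1 - r) < e / 2"
      by (auto simp: eventually_sequentially)
    have "cnorm A (Y m \<ominus> Y n) < e" if "m \<ge> N" "n \<ge> N" for m n
      using far[of N "m - N"] far[of N "n - N"] that N p_triangle[OF Yc[of m] Yc[of N] Yc[of n]]
        p_diff_commute[OF Yc[of N] Yc[of n]] unfolding le_add_diff_inverse[OF that(1)] le_add_diff_inverse[OF that(2)]
      by linarith
    then show "\<exists>N. \<forall>m\<ge>N. \<forall>n\<ge>N. cnorm A (Y m \<ominus> Y n) < e" by blast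
  qed (rule Yc)
  then obtain y where y: "tends Y y"
    by (rule cauchy_tends)
  note yc = tends_closed(2)[OF y]
  have "tends (\<lambda>n. F (Y n)) (F y)"
    unfolding F_def by (intro tends_smult tends_add tends_mult tends_const a y)
  \<comment> \<open>\<open>F (Y n)\<close> is the sequence shifted by one, with the same
    limit.\<close>
  moreover have "tends (\<lambda>n. F (Y n)) y"
    using y LIMSEQ_Suc by (fastforce simp: tends_def Y_Suc[symmetric])
  ultimately have "F y = y"
    using tends_unique by blast
  then have y_eq: "a \<oplus> y \<otimes> y = y \<oplus> y"
    using add_smult[OF yc, of 1 1] smult_smult[of "a \<oplus> y \<otimes> y" 2 "1/2"] a yc by (simp add: F_def)
  have ysa: "adj A y = y"
    using tends_unique[OF tends_adj[OF y]] y by (simp add: Ysa)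
  have yx: "x \<otimes> y = y \<otimes> x"
    using tends_unique[OF tends_mult[OF tends_const[OF x(1)] y]] tends_mult[OF y tends_const[OF x(1)]]
    by (simp add: Yx)
  \<comment> \<open>After expanding the square of 1 - y, the fixed point equation in the form a +
    y^2 = 2 y cancels everything but 1.\<close>
  have m: "(\<one> \<ominus> y) \<otimes> (\<one> \<ominus> y) = \<one> \<ominus> y \<ominus> y \<oplus> y \<otimes> y"
    using yc by (simp add: minus_eq l_distr r_distr l_minus r_minus minus_add a_ac)
  have "a \<oplus> (\<one> \<ominus> y) \<otimes> (\<one> \<ominus> y) = (a \<oplus> y \<otimes> y) \<oplus> (\<one> \<ominus> y \<ominus> y)"
    unfolding m using yc a by (simp add: a_ac)
  also have "\<dots> = \<one> \<oplus> (y \<ominus> y) \<oplus> (y \<ominus> y)"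
    unfolding y_eq using yc by (simp only: minus_eq) (simp add: a_ac)
  also have "\<dots> = \<one>"
    using yc by simp
  finally show ?thesis
    using yc ysa x yx
    by (intro bexI[of _ "\<one> \<ominus> y"]) (simp_all add: adj_diff, simp add: minus_eq l_distr r_distr l_minus r_minus)
qed

text \<open>The root is that of 1 - x \<otimes> x. Since x commutes with x \<otimes> x, it commutes
  with the root, which makes x + \<i> s unitary.\<close>

lemma seminorm_le_cnorm:
  assumes "cstar_seminorm A q" "x \<in> carrier A"
  shows "q x \<le> cnorm A x"
proof (rule seminorm_le_if_sqrt[OF assms(1) _ assms(2)])
  fix x assume x: "x \<in> carrier A" "adj A x = x" "cnorm A x < 1"
  have "cnorm A (x \<otimes> x) \<le> cnorm A x * 1"
    using p_mult[of x x] mult_left_mono[of "cnorm A x" 1 "cnorm A x"] x by simp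
  then show "\<exists>s\<in>carrier A. adj A s = s \<and> x \<otimes> s = s \<otimes> x \<and> x \<otimes> x \<oplus> s \<otimes> s = \<one>"
    using x by (intro sqrt_one_minus_exists) (auto simp: adj_mult m_assoc)
qed

end

text \<open>The norm of \<open>B\<close> pulled back along h is a C*-seminorm on \<open>A\<close>,
  hence dominated by the norm of \<open>A\<close>.\<close>

lemma star_hom_contractive:
  assumes "cstar_algebra A" "cstar_algebra B" "h \<in> star_hom A B" "x \<in> carrier A"
  shows "cnorm B (h x) \<le> cnorm A x"
proof -
  interpret A: cstar_algebra A by fact
  interpret B: cstar_algebra B by fact
  show ?thesis
    using A.seminorm_le_cnorm[OF cstar_seminorm_pullback[OF assms(3) B.cnorm_seminorm] assms(4)] by simp
qed

section \<open>Enveloping C*-algebras\<close>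

text \<open>The bound is what gives \<open>universal_seminorm\<close> a meaning: \<open>Sup\<close>
  of a set of reals that is not bounded above carries no information.\<close>

locale bounded_relations = star_algebra P for P :: "('a, 'm) star_alg_scheme" (structure) +
  fixes R :: "'a set"
  assumes R_closed: "R \<subseteq> carrier P"
    and bounded: "x \<in> carrier P \<Longrightarrow> \<exists>K. \<forall>p. cstar_seminorm P p \<longrightarrow> (\<forall>r\<in>R. p r = 0) \<longrightarrow> p x \<le> K"
begin

abbreviation "admissible p \<equiv> cstar_seminorm P p \<and> (\<forall>r\<in>R. p r = 0)"
abbreviation "U \<equiv> universal_seminorm P R"

text \<open>The zero seminorm shows that the supremum is over a nonempty set, as
  \<open>cSup_least\<close> requires.\<close>

lemma admissible_zero: "admissible (\<lambda>x. 0)"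
  by (simp add: cstar_seminorm_def)

lemma le_universal:
  assumes "admissible p" "x \<in> carrier P"
  shows "p x \<le> U x"
  unfolding universal_seminorm_def
proof (rule cSup_upper)
  obtain K where "\<forall>p. cstar_seminorm P p \<longrightarrow> (\<forall>r\<in>R. p r = 0) \<longrightarrow> p x \<le> K"
    using bounded[OF assms(2)] by blast
  then show "bdd_above {p x | p. admissible p}"
    by (intro bdd_aboveI[of _ K]) auto
qed (use assms in auto)

lemma universal_le:
  assumes "\<And>p. admissible p \<Longrightarrow> p x \<le> K"
  shows "U x \<le> K"
  unfolding universal_seminorm_def
  by (rule cSup_least) (use admissible_zero assms in auto)

lemma universal_nonneg: "x \<in> carrier P \<Longrightarrow> 0 \<le> U x"
  using le_universal[OF admissible_zero] by simp

lemma seminorm_universal: "cstar_seminorm P U"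
proof -
  have S: "seminormed_star_algebra P p" if "admissible p" for p
    using that star_algebra_axioms by (simp add: seminormed_star_algebraI)
  \<comment> \<open>Homogeneity follows from this inequality for c together with the one for
    1/c.\<close>
  have smult_le: "U (c \<odot> x) \<le> cmod c * U x" if "x \<in> carrier P" for c x
  proof (rule universal_le)
    fix p assume p: "admissible p"
    show "p (c \<odot> x) \<le> cmod c * U x"
      using le_universal[OF p that] seminormed_star_algebra.p_smult[OF S[OF p] that, of c]
      by (simp add: mult_left_mono)
  qed
  show ?thesis
    unfolding cstar_seminorm_def
  proof (intro conjI ballI allI)
    fix x assume x: "x \<in> carrier P"
    show "0 \<le> U x" using x by (rule universal_nonneg)
    show "U (c \<odot> x) = cmod c * U x" for c
    proof (cases "c = 0")
      case True
      then show ?thesis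
        using smult_le[OF x, of c] universal_nonneg[of "c \<odot> x"] x by simp
    next
      case False
      have "cmod c * U x \<le> U (c \<odot> x)"
        using smult_le[of "c \<odot> x" "1 / c"] x False smult_smult[of x "1 / c" c]
        by (simp add: norm_divide field_simps)
      then show ?thesis
        using smult_le[OF x, of c] by simp
    qed
    show "U (adj P x \<otimes> x) = (U x)\<^sup>2"
    proof (rule antisym)
      show "U (adj P x \<otimes> x) \<le> (U x)\<^sup>2"
      proof (rule universal_le)
        fix p assume p: "admissible p"
        interpret seminormed_star_algebra P p by (rule S[OF p])
        show "p (adj P x \<otimes> x) \<le> (U x)\<^sup>2"
          using le_universal[OF p x] x by (simp add: p_adj_mult power_mono)
      qed
      \<comment> \<open>Each p(x) is the root of the value of p at
        \<open>adj P x \<otimes> x\<close>, so the root of the supremum bounds all of them at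
        once.\<close>
      have "U x \<le> sqrt (U (adj P x \<otimes> x))"
      proof (rule universal_le)
        fix p assume p: "admissible p"
        interpret seminormed_star_algebra P p by (rule S[OF p])
        show "p x \<le> sqrt (U (adj P x \<otimes> x))"
          using le_universal[OF p, of "adj P x \<otimes> x"] x by (simp add: p_adj_mult real_le_rsqrt)
      qed
      then show "(U x)\<^sup>2 \<le> U (adj P x \<otimes> x)"
        using universal_nonneg[OF x] universal_nonneg[of "adj P x \<otimes> x"] x
        by (metis adj_closed m_closed power_mono real_sqrt_pow2)
    qed
    fix y assume y: "y \<in> carrier P"
    show "U (x \<oplus> y) \<le> U x + U y"
    proof (rule universal_le)
      fix p assume p: "admissible p"
      show "p (x \<oplus> y) \<le> U x + U y"
        using seminormed_star_algebra.p_add[OF S[OF p] x y] le_universal[OF p x] le_universal[OF p y] by simp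
    qed
    show "U (x \<otimes> y) \<le> U x * U y"
    proof (rule universal_le)
      fix p assume p: "admissible p"
      interpret seminormed_star_algebra P p by (rule S[OF p])
      have "p x * p y \<le> U x * U y"
        using le_universal[OF p x] le_universal[OF p y] x y universal_nonneg by (intro mult_mono) auto
      then show "p (x \<otimes> y) \<le> U x * U y"
        using p_mult[OF x y] by simp
    qed
  qed
qed

sublocale universal: seminormed_star_algebra P U
  by unfold_locales (rule seminorm_universal)

abbreviation "E \<equiv> enveloping_cstar P R"
abbreviation "\<iota> \<equiv> enveloping_map P R"

lemma cstar_algebra_enveloping: "cstar_algebra E"
  unfolding enveloping_cstar_def by (rule universal.cstar_algebra_completion)

lemma enveloping_map_star_hom: "\<iota> \<in> star_hom P E"
  using universal.completion_embedding by (simp add: enveloping_cstar_def enveloping_map_def[abs_def])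

lemma cnorm_enveloping_map: "x \<in> carrier P \<Longrightarrow> cnorm E (\<iota> x) = U x"
  unfolding enveloping_cstar_def enveloping_map_def by (rule universal.cnorm_const)

lemma enveloping_map_dense: "dense_in E (cnorm E) (\<iota> ` carrier P)"
  unfolding dense_in_def
proof (intro conjI ballI allI impI)
  show "\<iota> ` carrier P \<subseteq> carrier E"
    using star_hom_closed[OF enveloping_map_star_hom] by blast
  fix c and e :: real assume "c \<in> carrier E" "e > 0"
  then obtain a where "a \<in> carrier P" "cnorm E (c \<ominus>\<^bsub>E\<^esub> \<iota> a) < e"
    using universal.completion_dense[of c e] unfolding enveloping_cstar_def enveloping_map_def by blast
  then show "\<exists>s\<in>\<iota> ` carrier P. cnorm E (c \<ominus>\<^bsub>E\<^esub> s) < e" by blast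
qed

lemma enveloping_map_relation:
  assumes "r \<in> R"
  shows "\<iota> r = \<zero>\<^bsub>E\<^esub>"
proof -
  interpret E: cstar_algebra E by (rule cstar_algebra_enveloping)
  have r: "r \<in> carrier P" using assms R_closed by blast
  have "U r \<le> 0"
    using assms by (intro universal_le) simp
  then have "cnorm E (\<iota> r) = 0"
    using universal_nonneg[OF r] by (simp add: cnorm_enveloping_map r)
  then show ?thesis
    using E.cnorm_eq_0 star_hom_closed[OF enveloping_map_star_hom r] by blast
qed

text \<open>The norm of \<open>B\<close> pulled back along h vanishes on \<open>R\<close>, so it
  takes part in the supremum. Hence h is dominated by the norm of the enveloping algebra and
  extends.\<close>

lemma enveloping_universal:
  assumes "cstar_algebra B" "h \<in> star_hom P B" "\<And>r. r \<in> R \<Longrightarrow> h r = \<zero>\<^bsub>B\<^esub>"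
  shows "\<exists>H\<in>star_hom E B. \<forall>a\<in>carrier P. H (\<iota> a) = h a"
proof (rule star_hom_extension[OF star_algebra_axioms _ assms(1) enveloping_map_star_hom assms(2) enveloping_map_dense])
  interpret E: cstar_algebra E by (rule cstar_algebra_enveloping)
  interpret B: cstar_algebra B by fact
  show "seminormed_star_algebra E (cnorm E)" by (rule E.seminormed_star_algebra_axioms)
  fix a assume "a \<in> carrier P"
  moreover have "admissible (\<lambda>x. cnorm B (h x))"
    using cstar_seminorm_pullback[OF assms(2) B.cnorm_seminorm] assms(3) by simp
  ultimately show "cnorm B (h a) \<le> cnorm E (\<iota> a)"
    using le_universal[of "\<lambda>x. cnorm B (h x)" a] by (simp add: cnorm_enveloping_map)
qed

text \<open>Homomorphisms between C*-algebras are contractive, so agreement on the dense image of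
  \<open>P\<close> is enough.\<close>

lemma enveloping_hom_eqI:
  assumes "cstar_algebra B" "h \<in> star_hom E B" "k \<in> star_hom E B"
    and "\<And>a. a \<in> carrier P \<Longrightarrow> h (\<iota> a) = k (\<iota> a)" "x \<in> carrier E"
  shows "h x = k x"
proof (rule star_hom_eq_on_dense[OF _ assms(1-3) _ _ enveloping_map_dense _ assms(5)])
  interpret E: cstar_algebra E by (rule cstar_algebra_enveloping)
  show "seminormed_star_algebra E (cnorm E)" by (rule E.seminormed_star_algebra_axioms)
qed (use assms star_hom_contractive[OF cstar_algebra_enveloping assms(1)] in auto)

end

section \<open>Finitely supported functions\<close>

text \<open>The default value \<open>z\<close> and the range \<open>C\<close> are parameters because
  the rule serves both complex functions on words and functions from the integers into a carrier.
  The premise \<open>b i = z\<close> makes the update the addition of a monomial.\<close>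

lemma finsupp_induct:
  assumes "finite {i. a i \<noteq> z}" "\<And>i. a i \<in> C" "z \<in> C"
    and "Q (\<lambda>i. z)"
    and "\<And>b i x. \<lbrakk>finite {i. b i \<noteq> z}; \<And>i. b i \<in> C; x \<in> C; b i = z; Q b\<rbrakk> \<Longrightarrow> Q (b(i := x))"
  shows "Q a"
  using assms(1,2)
proof (induction "{i. a i \<noteq> z}" arbitrary: a rule: finite_induct)
  case empty
  then have "a = (\<lambda>i. z)" by auto
  with assms(4) show ?case by simp
next
  case (insert j F)
  define b where "b = a(j := z)"
  have F: "F = {i. b i \<noteq> z}"
    using insert(2,4) by (auto simp: b_def)
  have b: "b i \<in> C" for i
    using insert.prems \<open>z \<in> C\<close> by (simp add: b_def)
  have "Q b"
    using insert(3)[OF F b] .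
  then have "Q (b(j := a j))"
    using insert(1) F b insert.prems by (intro assms(5)) (auto simp: b_def)
  then show ?case by (simp add: b_def)
qed

section \<open>The free *-algebra\<close>

definition word_conv :: "('a list \<Rightarrow> complex) \<Rightarrow> ('a list \<Rightarrow> complex) \<Rightarrow> 'a list \<Rightarrow> complex" where
  "word_conv a b w = (\<Sum>k\<le>length w. a (take k w) * b (drop k w))"

lemma word_conv_Nil [simp]: "word_conv a b [] = a [] * b []"
  by (simp add: word_conv_def)

text \<open>Splitting off the empty prefix turns the convolution into a recursion over the word with
  a shifted left factor. This makes associativity and the unit laws provable by induction on
  words.\<close>

lemma word_conv_Cons [simp]: "word_conv a b (x # w) = a [] * b (x # w) + word_conv (\<lambda>v. a (x # v)) b w"
  unfolding word_conv_def by (simp add: sum.atMost_Suc_shift del: sum.atMost_Suc)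

lemma word_conv_add_left: "word_conv (\<lambda>w. a w + a' w) b w = word_conv a b w + word_conv a' b w"
  and word_conv_add_right: "word_conv a (\<lambda>w. b w + b' w) w = word_conv a b w + word_conv a b' w"
  and word_conv_scale_left: "word_conv (\<lambda>w. c * a w) b w = c * word_conv a b w"
  and word_conv_scale_right: "word_conv a (\<lambda>w. c * b w) w = c * word_conv a b w"
  by (simp_all add: word_conv_def algebra_simps sum.distrib sum_distrib_left)

text \<open>The induction generalises over \<open>a\<close>, because the recursion replaces the left
  factor by its shift.\<close>

lemma word_conv_assoc: "word_conv (word_conv a b) c w = word_conv a (word_conv b c) w"
proof (induction w arbitrary: a)
  case (Cons x w)
  then show ?case
    by (simp add: word_conv_add_left word_conv_scale_left algebra_simps)
qed simp

lemma word_conv_zero_left [simp]: "word_conv (\<lambda>v. 0) b w = 0"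
  by (simp add: word_conv_def)

definition word_mono :: "'a list \<Rightarrow> 'a list \<Rightarrow> complex" where
  "word_mono w = (\<lambda>v. if v = w then 1 else 0)"

lemma word_conv_one_left: "word_conv (word_mono []) b w = b w"
  by (cases w) (simp_all add: word_mono_def)

lemma word_conv_one_right: "word_conv b (word_mono []) w = b w"
  by (induction w arbitrary: b) (simp_all add: word_mono_def)

lemma word_conv_mono_Cons: "word_conv (word_mono [x]) (word_mono w) v = word_mono (x # w) v"
proof (cases v)
  case (Cons y u)
  have "word_conv (\<lambda>v. word_mono [x] (y # v)) (word_mono w) u = (if y = x then word_mono w u else 0)"
    using word_conv_one_left[of "word_mono w" u] by (simp add: word_mono_def)
  with Cons show ?thesis by (simp add: word_mono_def)
qed (simp add: word_mono_def)

lemma word_conv_support: "{w. word_conv a b w \<noteq> 0} \<subseteq> (\<lambda>(x, y). x @ y) ` ({w. a w \<noteq> 0} \<times> {w. b w \<noteq> 0})"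
proof
  fix w assume "w \<in> {w. word_conv a b w \<noteq> 0}"
  then obtain k where "a (take k w) * b (drop k w) \<noteq> 0"
    unfolding word_conv_def by (auto elim: sum.not_neutral_contains_not_neutral)
  then show "w \<in> (\<lambda>(x, y). x @ y) ` ({w. a w \<noteq> 0} \<times> {w. b w \<noteq> 0})"
    by (intro image_eqI[of _ _ "(take k w, drop k w)"]) auto
qed

lemma word_adj_word_adj [simp]: "word_adj (word_adj w) = w"
  by (induction w) (auto simp: word_adj_def rev_map)

lemma length_word_adj [simp]: "length (word_adj w) = length w"
  by (simp add: word_adj_def)

text \<open>\<open>word_adj\<close> reverses words, so a split after k letters corresponds to a
  split after \<open>length w - k\<close> letters with the two parts exchanged.\<close>

lemma word_conv_adj:
  "cnj (word_conv a b (word_adj w)) = word_conv (\<lambda>w. cnj (b (word_adj w))) (\<lambda>w. cnj (a (word_adj w))) w"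
proof -
  have t: "take k (word_adj w) = word_adj (drop (length w - k) w)"
    and d: "drop k (word_adj w) = word_adj (take (length w - k) w)" for k
    by (simp_all add: word_adj_def take_rev drop_rev take_map drop_map)
  show ?thesis
    unfolding word_conv_def
    by (simp add: t d) (rule sum.reindex_bij_witness[of _ "\<lambda>k. length w - k" "\<lambda>k. length w - k"]; simp)
qed

abbreviation "FA \<equiv> free_star_algebra"

lemma free_simps:
  "carrier FA = {a. finite {w. a w \<noteq> 0}}" "a \<otimes>\<^bsub>FA\<^esub> b = word_conv a b" "\<one>\<^bsub>FA\<^esub> = word_mono []"
  "\<zero>\<^bsub>FA\<^esub> = (\<lambda>w. 0)" "a \<oplus>\<^bsub>FA\<^esub> b = (\<lambda>w. a w + b w)" "c \<odot>\<^bsub>FA\<^esub> a = (\<lambda>w. c * a w)"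
  "adj FA a = (\<lambda>w. cnj (a (word_adj w)))"
  by (auto simp: free_star_algebra_def word_conv_def word_mono_def)

lemma free_generator_eq: "free_generator g = word_mono [(g, False)]"
  by (simp add: free_generator_def word_mono_def)

lemma star_algebra_free: "star_algebra (FA :: 'g word_fun star_alg)"
proof -
  have fin: "finite {w. f w \<noteq> 0}" if "finite {w. a w \<noteq> 0}" "finite {w. b w \<noteq> 0}" "\<And>w. a w = 0 \<Longrightarrow> b w = 0 \<Longrightarrow> f w = 0"
    for a b f :: "'x \<Rightarrow> complex"
    using that by (auto intro!: finite_subset[OF _ finite_UnI[OF that(1,2)]])
  interpret ring "FA :: 'g word_fun star_alg"
  proof (rule ringI)
    show "abelian_group (FA :: 'g word_fun star_alg)"
    proof (rule abelian_groupI)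
      fix x :: "'g word_fun" assume "x \<in> carrier FA"
      then show "\<exists>y\<in>carrier FA. y \<oplus>\<^bsub>FA\<^esub> x = \<zero>\<^bsub>FA\<^esub>"
        by (intro bexI[of _ "\<lambda>w. - x w"]) (auto simp: free_simps)
    qed (auto simp: free_simps algebra_simps intro: fin)
    show "monoid (FA :: 'g word_fun star_alg)"
    proof (rule monoidI)
      fix x y :: "'g word_fun" assume "x \<in> carrier FA" "y \<in> carrier FA"
      then show "x \<otimes>\<^bsub>FA\<^esub> y \<in> carrier FA"
        using finite_subset[OF word_conv_support] by (auto simp: free_simps)
    qed (auto simp: free_simps word_conv_assoc word_conv_one_left word_conv_one_right fun_eq_iff, simp add: word_mono_def)
  qed (auto simp: free_simps word_conv_add_left word_conv_add_right)
  show ?thesis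
  proof
    fix x :: "'g word_fun" assume x: "x \<in> carrier FA"
    have "{w. adj FA x w \<noteq> 0} \<subseteq> word_adj ` {w. x w \<noteq> 0}"
      by (auto simp: free_simps intro!: image_eqI[of _ word_adj "word_adj _"])
    with x show "adj FA x \<in> carrier FA"
      using finite_subset by (fastforce simp: free_simps)
  qed (auto simp: free_simps algebra_simps word_conv_scale_left word_conv_scale_right word_conv_adj fun_eq_iff
      intro: finite_subset[rotated])
qed

interpretation FA: star_algebra FA by (rule star_algebra_free)

lemma word_mono_closed: "word_mono w \<in> carrier FA"
  by (simp add: free_simps word_mono_def)

lemma word_mono_Cons: "word_mono (x # w) = word_mono [x] \<otimes>\<^bsub>FA\<^esub> word_mono w"
  by (auto simp: free_simps word_conv_mono_Cons)

lemma word_mono_append: "word_mono (v @ w) = word_mono v \<otimes>\<^bsub>FA\<^esub> word_mono w"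
proof (induction v)
  case Nil
  then show ?case using FA.l_one[OF word_mono_closed, of w] by (simp add: free_simps(3))
next
  case (Cons x v)
  then show ?case
    by (simp add: word_mono_Cons[of x "v @ w"] word_mono_Cons[of x v] FA.m_assoc word_mono_closed)
qed

lemma word_mono_adj: "adj FA (word_mono w) = word_mono (word_adj w)"
  by (auto simp: free_simps word_mono_def fun_eq_iff)

lemma free_induct [consumes 1, case_names zero add]:
  assumes "a \<in> carrier FA" "Q \<zero>\<^bsub>FA\<^esub>"
    and "\<And>b c w. \<lbrakk>b \<in> carrier FA; Q b\<rbrakk> \<Longrightarrow> Q (b \<oplus>\<^bsub>FA\<^esub> c \<odot>\<^bsub>FA\<^esub> word_mono w)"
  shows "Q a"
proof -
  have "finite {w. a w \<noteq> 0}" using assms(1) by (simp add: free_simps)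
  then show ?thesis
  proof (rule finsupp_induct[where C = UNIV])
    fix b i x assume update: "finite {w. b w \<noteq> 0}" "b i = 0" "Q b"
    then have "b(i := x) = b \<oplus>\<^bsub>FA\<^esub> x \<odot>\<^bsub>FA\<^esub> word_mono i"
      by (auto simp: free_simps word_mono_def)
    with update assms(3)[of b x i] show "Q (b(i := x))"
      by (simp add: free_simps(1))
  qed (use assms in \<open>auto simp: free_simps\<close>)
qed

section \<open>Evaluation of the free *-algebra at chosen elements\<close>

context star_algebra
begin

fun word_value :: "('g \<Rightarrow> 'a) \<Rightarrow> ('g \<times> bool) list \<Rightarrow> 'a" where
  "word_value X [] = \<one>"
| "word_value X ((g, s) # w) = (if s then adj A (X g) else X g) \<otimes> word_value X w"

definition free_eval :: "('g \<Rightarrow> 'a) \<Rightarrow> 'g word_fun \<Rightarrow> 'a" where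
  "free_eval X a = finsum A (\<lambda>w. a w \<odot> word_value X w) {w. a w \<noteq> 0}"

context
  fixes X :: "'g \<Rightarrow> 'a"
  assumes X: "\<And>g. X g \<in> carrier A"
begin

lemma word_value_closed [simp]: "word_value X w \<in> carrier A"
proof (induction w)
  case (Cons x w)
  then show ?case using X by (cases x) auto
qed simp

lemma word_value_append: "word_value X (v @ w) = word_value X v \<otimes> word_value X w"
proof (induction v)
  case (Cons x v)
  then show ?case using X by (cases x) (auto simp: m_assoc)
qed simp

lemma word_value_adj: "word_value X (word_adj w) = adj A (word_value X w)"
proof (induction w)
  case (Cons gs w)
  obtain g s where gs: "gs = (g, s)" by fastforce
  have "word_adj (gs # w) = word_adj w @ [(g, \<not> s)]"
    by (simp add: word_adj_def gs)
  then show ?case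
    using X by (simp add: word_value_append Cons gs adj_mult)
qed (simp add: word_adj_def)

lemma free_eval_superset:
  assumes "finite F" "{w. a w \<noteq> 0} \<subseteq> F"
  shows "free_eval X a = finsum A (\<lambda>w. a w \<odot> word_value X w) F"
  unfolding free_eval_def
  by (rule add.finprod_mono_neutral_cong_left) (use assms in auto)

lemma free_eval_closed: "free_eval X a \<in> carrier A"
  unfolding free_eval_def by (rule finsum_closed) auto

lemma free_eval_add:
  assumes "a \<in> carrier FA" "b \<in> carrier FA"
  shows "free_eval X (a \<oplus>\<^bsub>FA\<^esub> b) = free_eval X a \<oplus> free_eval X b"
proof -
  let ?F = "{w. a w \<noteq> 0} \<union> {w. b w \<noteq> 0}"
  have F: "finite ?F" using assms by (simp add: free_simps)
  show ?thesis
    by (subst (1 2 3) free_eval_superset[OF F])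
      (auto simp: free_simps add_smult intro!: finsum_addf)
qed

lemma free_eval_mono: "free_eval X (c \<odot>\<^bsub>FA\<^esub> word_mono w) = c \<odot> word_value X w"
  by (subst free_eval_superset[of "{w}"]) (auto simp: free_simps word_mono_def)

lemma free_eval_zero: "free_eval X \<zero>\<^bsub>FA\<^esub> = \<zero>"
  by (simp add: free_eval_def free_simps)

lemma free_eval_one_mono: "free_eval X (word_mono w) = word_value X w"
  using free_eval_mono[of 1 w] by (simp add: word_mono_closed)

lemma free_eval_smult:
  assumes "a \<in> carrier FA"
  shows "free_eval X (c \<odot>\<^bsub>FA\<^esub> a) = c \<odot> free_eval X a"
  using assms
proof (induction rule: free_induct)
  case (add b d w)
  then show ?case
    by (simp add: FA.smult_add word_mono_closed free_eval_add free_eval_mono free_eval_closed smult_add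
        flip: smult_smult FA.smult_smult)
qed (simp add: free_eval_zero)

lemma free_eval_mult_mono:
  assumes "a \<in> carrier FA"
  shows "free_eval X (word_mono v \<otimes>\<^bsub>FA\<^esub> a) = word_value X v \<otimes> free_eval X a"
  using assms
proof (induction rule: free_induct)
  case (add b d w)
  then show ?case
    by (simp add: FA.r_distr word_mono_closed FA.smult_mult_right free_eval_add free_eval_mono free_eval_closed
        r_distr smult_mult_right word_value_append flip: word_mono_append)
qed (simp add: free_eval_zero word_mono_closed)

lemma free_eval_mult:
  assumes "a \<in> carrier FA" "b \<in> carrier FA"
  shows "free_eval X (a \<otimes>\<^bsub>FA\<^esub> b) = free_eval X a \<otimes> free_eval X b"
  using assms(1)
proof (induction rule: free_induct)
  case (add a d w)
  then show ?case
    using assms(2)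
    by (simp add: FA.l_distr word_mono_closed FA.smult_mult_left free_eval_add free_eval_mono free_eval_closed
        l_distr smult_mult_left free_eval_smult free_eval_mult_mono)
qed (use assms(2) in \<open>simp add: free_eval_zero free_eval_closed\<close>)

lemma free_eval_adj:
  assumes "a \<in> carrier FA"
  shows "free_eval X (adj FA a) = adj A (free_eval X a)"
  using assms
proof (induction rule: free_induct)
  case (add a d w)
  then show ?case
    by (simp add: FA.adj_add FA.adj_smult word_mono_closed word_mono_adj free_eval_add free_eval_mono
        free_eval_closed word_value_adj adj_add adj_smult)
qed (simp add: free_eval_zero)

lemma free_eval_star_hom: "free_eval X \<in> star_hom FA A"
  by (rule star_homI)
    (auto simp: free_eval_closed free_eval_add free_eval_mult free_eval_smult free_eval_adj
      free_simps(3) free_eval_one_mono)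

lemma free_eval_generator: "free_eval X (free_generator g) = X g"
  using X by (simp add: free_generator_eq free_eval_one_mono)

end

lemma free_hom_eqI:
  assumes h: "h \<in> star_hom FA A" and k: "k \<in> star_hom FA A"
    and eq: "\<And>g. h (free_generator g) = k (free_generator g)" and a: "a \<in> carrier FA"
  shows "h a = k a"
proof -
  have mono: "h (word_mono w) = k (word_mono w)" for w
  proof (induction w)
    case Nil
    then show ?case using star_hom_one[OF h] star_hom_one[OF k] by (simp add: free_simps(3))
  next
    case (Cons x w)
    obtain g s where x: "x = (g, s)" by fastforce
    have "h (word_mono [x]) = k (word_mono [x])"
    proof (cases s)
      case True
      have "word_mono [x] = adj FA (free_generator g)"
        by (simp add: free_generator_eq word_mono_adj word_adj_def x True)
      then show ?thesis
        using eq by (simp add: free_generator_eq word_mono_closed star_hom_adj[OF h] star_hom_adj[OF k])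
    qed (use eq[of g] x in \<open>simp add: free_generator_eq\<close>)
    then show ?case
      by (simp add: word_mono_Cons[of x w] word_mono_closed star_hom_mult[OF h] star_hom_mult[OF k] Cons)
  qed
  show ?thesis
    using a
  proof (induction rule: free_induct)
    case zero
    then show ?case
      using star_hom_zero[OF h FA.star_algebra_axioms star_algebra_axioms]
        star_hom_zero[OF k FA.star_algebra_axioms star_algebra_axioms] by simp
  next
    case (add b c w)
    then show ?case
      by (simp add: star_hom_ops[OF h] star_hom_ops[OF k] word_mono_closed mono)
  qed
qed

end

section \<open>The universal property of rotation algebras\<close>

definition unitary_in :: "('a, 'm) star_alg_scheme \<Rightarrow> 'a \<Rightarrow> bool" where
  "unitary_in A u \<longleftrightarrow> u \<in> carrier A \<and> adj A u \<otimes>\<^bsub>A\<^esub> u = \<one>\<^bsub>A\<^esub> \<and> u \<otimes>\<^bsub>A\<^esub> adj A u = \<one>\<^bsub>A\<^esub>"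

lemma unitary_inD:
  assumes "unitary_in A u"
  shows "u \<in> carrier A" "adj A u \<otimes>\<^bsub>A\<^esub> u = \<one>\<^bsub>A\<^esub>" "u \<otimes>\<^bsub>A\<^esub> adj A u = \<one>\<^bsub>A\<^esub>"
  using assms by (auto simp: unitary_in_def)

abbreviation turn :: "real \<Rightarrow> complex" where
  "turn t \<equiv> exp (2 * pi * \<i> * t)"

lemma free_generator_closed: "free_generator g \<in> carrier FA"
  by (simp add: free_generator_eq word_mono_closed)

text \<open>Where the unitarity relations vanish, the C*-identity gives at most 1 on each generator,
  hence on each word. The value at x is then at most the sum of the moduli of its coefficients,
  whatever the seminorm.\<close>

lemma bounded_relations_free:
  assumes "R \<subseteq> carrier FA" "\<And>g. unitary_relations FA (free_generator g) \<subseteq> R"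
  shows "bounded_relations FA R"
proof
  fix x :: "'a word_fun" assume "x \<in> carrier FA"
  have mono: "p (word_mono w) \<le> 1" if p: "cstar_seminorm FA p" "\<forall>r\<in>R. p r = 0" for p and w :: "('a \<times> bool) list"
  proof (induction w)
    interpret seminormed_star_algebra FA p
      by (intro seminormed_star_algebraI star_algebra_free p)
    case Nil
    then show ?case using p_one_le by (simp add: free_simps(3))
  next
    interpret seminormed_star_algebra FA p
      by (intro seminormed_star_algebraI star_algebra_free p)
    case (Cons x w)
    obtain g s where x: "x = (g, s)" by fastforce
    let ?g = "free_generator g"
    have "p (adj FA ?g \<otimes>\<^bsub>FA\<^esub> ?g \<ominus>\<^bsub>FA\<^esub> \<one>\<^bsub>FA\<^esub>) = 0"
      using p(2) assms(2)[of g] by (auto simp: unitary_relations_def)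
    then have "p (adj FA ?g \<otimes>\<^bsub>FA\<^esub> ?g) \<le> 1"
      using p_abs_diff[of "adj FA ?g \<otimes>\<^bsub>FA\<^esub> ?g" "\<one>\<^bsub>FA\<^esub>"] p_one_le by (simp add: free_generator_closed)
    then have "p ?g \<le> 1"
      using power2_le_imp_le[of "p ?g" 1] by (simp add: p_adj_mult free_generator_closed)
    moreover have "p (word_mono [x]) = p ?g"
      using p_adj[of ?g] by (cases s) (auto simp: x free_generator_eq word_mono_adj word_adj_def word_mono_closed)
    ultimately show ?case
      using p_mult[of "word_mono [x]" "word_mono w"] Cons mult_le_one[of "p (word_mono [x])" "p (word_mono w)"]
      by (simp add: word_mono_closed word_mono_Cons[of x w])
  qed
  show "\<exists>K. \<forall>p. cstar_seminorm FA p \<longrightarrow> (\<forall>r\<in>R. p r = 0) \<longrightarrow> p x \<le> K"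
    using \<open>x \<in> carrier FA\<close>
  proof (induction rule: free_induct)
    case zero
    have "p \<zero>\<^bsub>FA\<^esub> \<le> 0" if "cstar_seminorm FA p" for p :: "'a word_fun \<Rightarrow> real"
    proof -
      interpret seminormed_star_algebra FA p
        by (intro seminormed_star_algebraI star_algebra_free that)
      show ?thesis by simp
    qed
    then show ?case by blast
  next
    case (add b c w)
    then obtain K where K: "\<forall>p. cstar_seminorm FA p \<longrightarrow> (\<forall>r\<in>R. p r = 0) \<longrightarrow> p b \<le> K" by blast
    have "p (b \<oplus>\<^bsub>FA\<^esub> c \<odot>\<^bsub>FA\<^esub> word_mono w) \<le> K + cmod c" if p: "cstar_seminorm FA p" "\<forall>r\<in>R. p r = 0" for p
    proof -
      interpret seminormed_star_algebra FA p
        by (intro seminormed_star_algebraI star_algebra_free p)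
      have "p (b \<oplus>\<^bsub>FA\<^esub> c \<odot>\<^bsub>FA\<^esub> word_mono w) \<le> p b + cmod c * p (word_mono w)"
        using p_add[of b "c \<odot>\<^bsub>FA\<^esub> word_mono w"] add by (simp add: word_mono_closed p_smult)
      also have "\<dots> \<le> K + cmod c * 1"
        using K p mono[OF p] by (intro add_mono mult_left_mono) auto
      finally show ?thesis by simp
    qed
    then show ?case by blast
  qed
qed (rule assms(1))

interpretation rotation: bounded_relations FA "rotation_relations \<theta>" for \<theta>
proof (rule bounded_relations_free)
  show "rotation_relations \<theta> \<subseteq> carrier FA"
    by (auto simp: rotation_relations_def unitary_relations_def Let_def free_generator_closed)
  show "unitary_relations FA (free_generator g) \<subseteq> rotation_relations \<theta>" for g
    by (cases g) (auto simp: rotation_relations_def Let_def)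
qed

lemma cstar_algebra_rotation: "cstar_algebra (rotation_algebra \<theta>)"
  unfolding rotation_algebra_def by (rule rotation.cstar_algebra_enveloping)

lemma rotation_algebra_relations:
  shows rot_u_unitary: "unitary_in (rotation_algebra \<theta>) (rot_u \<theta>)"
    and rot_v_unitary: "unitary_in (rotation_algebra \<theta>) (rot_v \<theta>)"
    and rot_vu: "rot_v \<theta> \<otimes>\<^bsub>rotation_algebra \<theta>\<^esub> rot_u \<theta> =
      turn \<theta> \<odot>\<^bsub>rotation_algebra \<theta>\<^esub> (rot_u \<theta> \<otimes>\<^bsub>rotation_algebra \<theta>\<^esub> rot_v \<theta>)"
proof -
  let ?A = "rotation_algebra \<theta>"
  interpret A: cstar_algebra ?A by (rule cstar_algebra_rotation)
  let ?\<iota> = "enveloping_map FA (rotation_relations \<theta>)"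
  have \<iota>: "?\<iota> \<in> star_hom FA ?A"
    using rotation.enveloping_map_star_hom by (simp add: rotation_algebra_def)
  note i = star_hom_ops[OF \<iota>]
  have eq: "?\<iota> x = ?\<iota> y" if "x \<ominus>\<^bsub>FA\<^esub> y \<in> rotation_relations \<theta>" "x \<in> carrier FA" "y \<in> carrier FA" for x y
    using rotation.enveloping_map_relation[OF that(1)] that(2,3) A.diff_eq_zero_iff[of "?\<iota> x" "?\<iota> y"]
    by (simp add: star_hom_diff[OF \<iota> star_algebra_free A.star_algebra_axioms] i flip: rotation_algebra_def)
  have un: "unitary_in ?A (?\<iota> (free_generator g))" for g
  proof -
    have "unitary_relations FA (free_generator g) \<subseteq> rotation_relations \<theta>"
      by (cases g) (auto simp: rotation_relations_def Let_def)
    then show ?thesis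
      using eq[of "adj FA (free_generator g) \<otimes>\<^bsub>FA\<^esub> free_generator g" "\<one>\<^bsub>FA\<^esub>"]
        eq[of "free_generator g \<otimes>\<^bsub>FA\<^esub> adj FA (free_generator g)" "\<one>\<^bsub>FA\<^esub>"]
      by (auto simp: unitary_in_def unitary_relations_def i free_generator_closed)
  qed
  have vu: "free_generator Gen_v \<otimes>\<^bsub>FA\<^esub> free_generator Gen_u \<ominus>\<^bsub>FA\<^esub>
      turn \<theta> \<odot>\<^bsub>FA\<^esub> (free_generator Gen_u \<otimes>\<^bsub>FA\<^esub> free_generator Gen_v) \<in> rotation_relations \<theta>"
    by (simp add: rotation_relations_def Let_def)
  show "unitary_in ?A (rot_u \<theta>)" "unitary_in ?A (rot_v \<theta>)"
    using un unfolding rot_u_def rot_v_def by auto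
  show "rot_v \<theta> \<otimes>\<^bsub>?A\<^esub> rot_u \<theta> = turn \<theta> \<odot>\<^bsub>?A\<^esub> (rot_u \<theta> \<otimes>\<^bsub>?A\<^esub> rot_v \<theta>)"
    using eq[OF vu] by (simp add: rot_u_def rot_v_def i free_generator_closed)
qed

lemma rotation_algebra_universal:
  assumes "cstar_algebra B" "unitary_in B U" "unitary_in B V" "V \<otimes>\<^bsub>B\<^esub> U = turn \<theta> \<odot>\<^bsub>B\<^esub> (U \<otimes>\<^bsub>B\<^esub> V)"
  obtains h where "h \<in> star_hom (rotation_algebra \<theta>) B" "h (rot_u \<theta>) = U" "h (rot_v \<theta>) = V"
proof -
  interpret B: cstar_algebra B by fact
  define X where "X g = (case g of Gen_u \<Rightarrow> U | Gen_v \<Rightarrow> V)" for g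
  have X: "X g \<in> carrier B" "unitary_in B (X g)" for g
    using unitary_inD(1)[OF assms(2)] unitary_inD(1)[OF assms(3)] assms(2,3) by (simp_all add: X_def split: rot_gen.split)
  note hom = B.free_eval_star_hom[of X, OF X(1)]
  note h = star_hom_ops[OF hom] star_hom_diff[OF hom star_algebra_free B.star_algebra_axioms]
    B.free_eval_generator[of X, OF X(1)] free_generator_closed
  have "B.free_eval X r = \<zero>\<^bsub>B\<^esub>" if "r \<in> rotation_relations \<theta>" for r
    using that unitary_inD[OF assms(2)] unitary_inD[OF assms(3)] assms(4)
    by (auto simp: rotation_relations_def Let_def unitary_relations_def h) (simp_all add: X_def)
  from rotation.enveloping_universal[OF assms(1) hom this]
  obtain H where "H \<in> star_hom (rotation_algebra \<theta>) B"
    "\<forall>a\<in>carrier FA. H (enveloping_map FA (rotation_relations \<theta>) a) = B.free_eval X a"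
    unfolding rotation_algebra_def by blast
  with that[of H] show ?thesis
    by (simp add: rot_u_def rot_v_def h X_def)
qed

lemma rotation_hom_eqI:
  assumes "cstar_algebra B" "h \<in> star_hom (rotation_algebra \<theta>) B" "k \<in> star_hom (rotation_algebra \<theta>) B"
    and "h (rot_u \<theta>) = k (rot_u \<theta>)" "h (rot_v \<theta>) = k (rot_v \<theta>)" "x \<in> carrier (rotation_algebra \<theta>)"
  shows "h x = k x"
proof -
  interpret B: cstar_algebra B by fact
  let ?\<iota> = "enveloping_map FA (rotation_relations \<theta>)"
  have \<iota>: "?\<iota> \<in> star_hom FA (rotation_algebra \<theta>)"
    using rotation.enveloping_map_star_hom by (simp add: rotation_algebra_def)
  have "h (?\<iota> a) = k (?\<iota> a)" if "a \<in> carrier FA" for a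
  proof (rule B.free_hom_eqI[OF star_hom_comp[OF \<iota> assms(2)] star_hom_comp[OF \<iota> assms(3)] _ that])
    fix g show "h (?\<iota> (free_generator g)) = k (?\<iota> (free_generator g))"
      using assms(4,5) by (cases g) (auto simp: rot_u_def rot_v_def)
  qed
  then show ?thesis
    using rotation.enveloping_hom_eqI[OF assms(1), of h \<theta> k x] assms unfolding rotation_algebra_def by blast
qed

section \<open>Powers of unitaries\<close>

text \<open>Through this identification unitaries inherit the laws of integer powers from the group
  of units.\<close>

lemma (in monoid) int_pow_units_of:
  assumes "x \<in> Units G"
  shows "x [^]\<^bsub>units_of G\<^esub> (n::int) = x [^] n"
proof -
  interpret U: group "units_of G" by (rule units_group)
  have nat: "x [^]\<^bsub>units_of G\<^esub> (k::nat) = x [^] k" for k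
    by (simp add: nat_pow_def units_of_def)
  have "x [^] (k::nat) \<in> Units G" for k
    using U.nat_pow_closed[of x k] assms by (simp add: nat units_of_carrier)
  then have "inv\<^bsub>units_of G\<^esub> (x [^] (k::nat)) = inv (x [^] k)" for k
    by (rule units_of_inv)
  then show ?thesis
    unfolding int_pow_def2 nat by (simp only:)
qed

context star_algebra
begin

lemma unitary_Units: "unitary_in A u \<Longrightarrow> u \<in> Units A"
  by (auto simp: unitary_in_def Units_def)

lemma unitary_inv: "unitary_in A u \<Longrightarrow> inv u = adj A u"
  using inv_unique'[of u "adj A u"] by (auto simp: unitary_in_def)

lemma unitary_one: "unitary_in A \<one>"
  by (simp add: unitary_in_def)

lemma unitary_adj: "unitary_in A u \<Longrightarrow> unitary_in A (adj A u)"
  by (simp add: unitary_in_def)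

lemma unitary_cancel:
  assumes "unitary_in A u" "x \<in> carrier A"
  shows "adj A u \<otimes> (u \<otimes> x) = x" "u \<otimes> (adj A u \<otimes> x) = x"
    "x \<otimes> u \<otimes> adj A u = x" "x \<otimes> adj A u \<otimes> u = x"
  using assms unitary_inD[OF assms(1)]
  by (simp_all add: m_assoc) (simp_all flip: m_assoc)

lemma unitary_mult:
  assumes "unitary_in A u" "unitary_in A v"
  shows "unitary_in A (u \<otimes> v)"
  using assms unitary_cancel[OF assms(1), of v] unitary_cancel[OF assms(2), of "adj A u"] unitary_inD[OF assms(1)] unitary_inD[OF assms(2)]
  by (simp add: unitary_in_def adj_mult m_assoc)

lemma unitary_smult:
  assumes "unitary_in A u" "cmod c = 1"
  shows "unitary_in A (c \<odot> u)"
proof -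
  have "c * cnj c = 1"
    using assms(2) by (simp add: complex_norm_square[symmetric])
  then show ?thesis
    using assms by (simp add: unitary_in_def adj_smult smult_mult_left smult_mult_right mult.commute flip: smult_smult)
qed

lemma unitary_nat_pow: "unitary_in A u \<Longrightarrow> unitary_in A (u [^] (n::nat))"
  by (induction n) (auto simp: unitary_one unitary_mult)

lemma unitary_int_pow:
  assumes "unitary_in A u"
  shows "unitary_in A (u [^] (n::int))"
  using assms by (simp del: pow_nat add: int_pow_def2 unitary_nat_pow unitary_adj unitary_inv)

lemma unitary_int_pow_closed [simp]: "unitary_in A u \<Longrightarrow> u [^] (n::int) \<in> carrier A"
  by (rule unitary_inD(1)[OF unitary_int_pow])

lemma unitary_int_pow_add:
  assumes "unitary_in A u"
  shows "u [^] (m + n :: int) = u [^] m \<otimes> u [^] n"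
proof -
  interpret U: group "units_of A" by (rule units_group)
  show ?thesis
    using U.int_pow_mult[of u m n] unitary_Units[OF assms]
    by (simp add: int_pow_units_of units_of_carrier units_of_mult)
qed

lemma unitary_int_pow_neg:
  assumes "unitary_in A u"
  shows "u [^] (- n :: int) = adj A (u [^] n)"
proof -
  interpret U: group "units_of A" by (rule units_group)
  show ?thesis
    using U.int_pow_neg[of u n] unitary_Units[OF assms] unitary_int_pow[OF assms, of n]
    by (simp add: int_pow_units_of units_of_carrier units_of_inv unitary_inv unitary_Units)
qed

lemma unitary_int_pow_1 [simp]: "unitary_in A u \<Longrightarrow> u [^] (1::int) = u"
  by (simp del: pow_nat add: int_pow_def2 unitary_inD(1))

end

lemma star_hom_unitary:
  assumes "h \<in> star_hom A B" "star_algebra A" "unitary_in A u"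
  shows "unitary_in B (h u)"
proof -
  interpret A: star_algebra A by fact
  note h = star_hom_ops[OF assms(1)] and u = unitary_inD[OF assms(3)]
  have "adj A u \<in> carrier A" using u by simp
  then show ?thesis
    using u star_hom_mult[OF assms(1), of "adj A u" u] star_hom_mult[OF assms(1), of u "adj A u"]
    by (simp add: unitary_in_def h)
qed

lemma star_hom_int_pow:
  assumes "h \<in> star_hom A B" "star_algebra A" "star_algebra B" "unitary_in A u"
  shows "h (u [^]\<^bsub>A\<^esub> (n::int)) = h u [^]\<^bsub>B\<^esub> n"
proof -
  interpret A: star_algebra A by fact
  interpret B: star_algebra B by fact
  note h = star_hom_ops[OF assms(1)] and u = unitary_inD[OF assms(4)]
  have nat: "h (u [^]\<^bsub>A\<^esub> (k::nat)) = h u [^]\<^bsub>B\<^esub> k" for k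
    by (induction k) (use u in \<open>simp_all add: h\<close>)
  have un: "unitary_in A (u [^]\<^bsub>A\<^esub> (k::nat))" "unitary_in B (h u [^]\<^bsub>B\<^esub> (k::nat))" for k
    using A.unitary_nat_pow[OF assms(4)] B.unitary_nat_pow[OF star_hom_unitary[OF assms(1,2,4)]] by auto
  show ?thesis
    using un by (simp del: pow_nat add: int_pow_def2 A.unitary_inv B.unitary_inv h nat unitary_inD(1))
qed

lemma (in seminormed_star_algebra) p_unitary_le: "unitary_in A u \<Longrightarrow> p u \<le> 1"
  using p_adj_mult[of u] p_one_le power2_le_imp_le[of "p u" 1] by (simp add: unitary_in_def)

section \<open>Crossed products by the integers\<close>

lemma (in star_algebra) smult_finsum:
  assumes "finite F" "\<And>i. i \<in> F \<Longrightarrow> f i \<in> carrier A"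
  shows "c \<odot> finsum A f F = finsum A (\<lambda>i. c \<odot> f i) F"
  using assms
proof (induction rule: finite_induct)
  case (insert i F)
  have "f \<in> F \<rightarrow> carrier A" "(\<lambda>i. c \<odot> f i) \<in> F \<rightarrow> carrier A" using insert by auto
  with insert show ?case by (simp add: smult_add)
qed simp

text \<open>Only the *-algebra laws are assumed of A, so that Laurent polynomials arise as the
  instance with A = \<open>complex_cstar\<close> and trivial action. The norm of A enters later, in
  \<open>cstar_Z_action\<close>.\<close>

locale Z_action = star_algebra A for A :: "('a, 'm) cstar_alg_scheme" (structure) +
  fixes \<alpha> :: "'a \<Rightarrow> 'a"
  assumes \<alpha>: "\<alpha> \<in> star_iso A A"
begin

abbreviation "\<phi> \<equiv> int_iterate (carrier A) \<alpha>"
abbreviation "\<beta> \<equiv> inv_into (carrier A) \<alpha>"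
abbreviation "CP \<equiv> crossed_polys A \<alpha>"

lemma alpha_hom: "\<alpha> \<in> star_hom A A"
  using \<alpha> by (simp add: star_iso_def)

lemma alpha_beta: "x \<in> carrier A \<Longrightarrow> \<alpha> (\<beta> x) = x" "x \<in> carrier A \<Longrightarrow> \<beta> x \<in> carrier A"
  "x \<in> carrier A \<Longrightarrow> \<beta> (\<alpha> x) = x"
proof -
  have b: "bij_betw \<alpha> (carrier A) (carrier A)" using \<alpha> by (simp add: star_iso_def)
  then show "x \<in> carrier A \<Longrightarrow> \<alpha> (\<beta> x) = x" "x \<in> carrier A \<Longrightarrow> \<beta> x \<in> carrier A"
    by (auto simp: bij_betw_def f_inv_into_f inv_into_into)
  show "x \<in> carrier A \<Longrightarrow> \<beta> (\<alpha> x) = x"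
    using b by (auto simp: bij_betw_def)
qed

lemma beta_hom: "\<beta> \<in> star_hom A A"
proof (rule star_homI)
  fix x y c assume xy: "x \<in> carrier A" "y \<in> carrier A"
  note h = star_hom_ops[OF alpha_hom] alpha_beta
  show "\<beta> (x \<oplus> y) = \<beta> x \<oplus> \<beta> y" "\<beta> (x \<otimes> y) = \<beta> x \<otimes> \<beta> y"
    using alpha_beta(3)[of "\<beta> x \<oplus> \<beta> y"] alpha_beta(3)[of "\<beta> x \<otimes> \<beta> y"] xy by (simp_all add: h)
next
  fix x c assume x: "x \<in> carrier A"
  note h = star_hom_ops[OF alpha_hom] alpha_beta
  show "\<beta> (c \<odot> x) = c \<odot> \<beta> x" "\<beta> (adj A x) = adj A (\<beta> x)" "\<beta> x \<in> carrier A"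
    using alpha_beta(3)[of "c \<odot> \<beta> x"] alpha_beta(3)[of "adj A (\<beta> x)"] x by (simp_all add: h)
next
  show "\<beta> \<one> = \<one>"
    using alpha_beta(3)[of \<one>] star_hom_one[OF alpha_hom] by simp
qed

lemma phi_hom: "\<phi> m \<in> star_hom A A"
proof -
  have "(f ^^ n) \<in> star_hom A A" if "f \<in> star_hom A A" for f and n :: nat
  proof (induction n)
    case 0
    then show ?case using star_hom_id[of A] by (simp add: id_def)
  next
    case (Suc n)
    then show ?case using star_hom_comp[OF Suc that] by (simp add: o_def)
  qed
  then show ?thesis
    using alpha_hom beta_hom by (simp add: int_iterate_def)
qed

lemmas phi_ops = star_hom_ops[OF phi_hom]

lemma phi_closed [simp]: "x \<in> carrier A \<Longrightarrow> \<phi> m x \<in> carrier A"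
  by (rule phi_ops)

lemma phi_zero [simp]: "\<phi> m \<zero> = \<zero>"
  using star_hom_zero[OF phi_hom] star_algebra_axioms by blast

lemma phi_0 [simp]: "\<phi> 0 x = x"
  by (simp add: int_iterate_def)

lemma phi_1: "\<phi> 1 x = \<alpha> x"
  by (simp add: int_iterate_def)

lemma phi_plus_1:
  assumes "x \<in> carrier A"
  shows "\<phi> (m + 1) x = \<alpha> (\<phi> m x)"
proof (cases "0 \<le> m")
  case True
  then show ?thesis by (simp add: int_iterate_def nat_add_distrib)
next
  case False
  \<comment> \<open>For negative m the iterate consists of k + 1 copies of \<beta>, of which one
    \<alpha> cancels one. For k = 0 the index m + 1 reaches 0 and leaves the negative branch of
    \<open>int_iterate\<close>.\<close>
  define k where "k = nat (- m - 1)"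
  have m: "m = - int (Suc k)" using False by (simp add: k_def)
  have "\<phi> (m + 1) x = (\<beta> ^^ k) x"
    by (cases k) (simp_all add: m int_iterate_def nat_add_distrib)
  moreover have "\<phi> m x = \<beta> ((\<beta> ^^ k) x)"
    by (simp add: m int_iterate_def nat_add_distrib)
  moreover have "(\<beta> ^^ k) x \<in> carrier A"
    using assms by (induction k) (auto simp: alpha_beta)
  ultimately show ?thesis
    by (simp add: alpha_beta)
qed

lemma phi_minus_1:
  assumes "x \<in> carrier A"
  shows "\<phi> (m - 1) x = \<beta> (\<phi> m x)"
  using phi_plus_1[OF assms, of "m - 1"] alpha_beta(3)[of "\<phi> (m - 1) x"] assms by simp

lemma phi_add:
  assumes "x \<in> carrier A"
  shows "\<phi> (m + n) x = \<phi> m (\<phi> n x)"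
proof (induction m rule: int_induct[where k = 0])
  case (step1 i)
  then show ?case
    using phi_plus_1[OF assms, of "i + n"] phi_plus_1[of "\<phi> n x" i] assms by (simp add: ac_simps)
next
  case (step2 i)
  then show ?case
    using phi_minus_1[OF assms, of "i + n"] phi_minus_1[of "\<phi> n x" i] assms by (simp add: algebra_simps)
qed simp

lemma phi_neg: "x \<in> carrier A \<Longrightarrow> \<phi> m (\<phi> (- m) x) = x" "x \<in> carrier A \<Longrightarrow> \<phi> (- m) (\<phi> m x) = x"
  using phi_add[of x m "- m"] phi_add[of x "- m" m] by simp_all

section \<open>The *-algebra of finitely supported functions on the integers\<close>

lemma cp_carrier: "a \<in> carrier CP \<longleftrightarrow> (\<forall>n. a n \<in> carrier A) \<and> finite {n. a n \<noteq> \<zero>}"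
  by (simp add: crossed_polys_def)

lemma cp_closed: "a \<in> carrier CP \<Longrightarrow> a n \<in> carrier A"
  and cp_finite: "a \<in> carrier CP \<Longrightarrow> finite {n. a n \<noteq> \<zero>}"
  by (simp_all add: cp_carrier)

lemma cp_simps:
  "(a \<oplus>\<^bsub>CP\<^esub> b) n = a n \<oplus> b n" "(c \<odot>\<^bsub>CP\<^esub> a) n = c \<odot> a n" "\<zero>\<^bsub>CP\<^esub> n = \<zero>"
  "adj CP a n = \<phi> n (adj A (a (- n)))" "\<one>\<^bsub>CP\<^esub> n = (if n = 0 then \<one> else \<zero>)"
  by (simp_all add: crossed_polys_def)

lemma cp_mult_eq:
  assumes "a \<in> carrier CP" "b \<in> carrier CP" "finite F" "{m. a m \<noteq> \<zero>} \<subseteq> F"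
  shows "(a \<otimes>\<^bsub>CP\<^esub> b) n = finsum A (\<lambda>m. a m \<otimes> \<phi> m (b (n - m))) F"
proof -
  have "finsum A (\<lambda>m. a m \<otimes> \<phi> m (b (n - m))) {m. a m \<noteq> \<zero>} = finsum A (\<lambda>m. a m \<otimes> \<phi> m (b (n - m))) F"
    by (rule add.finprod_mono_neutral_cong_left) (use assms in \<open>auto simp: cp_closed\<close>)
  then show ?thesis
    by (simp add: crossed_polys_def)
qed

lemma cp_carrierI_union:
  "\<lbrakk>a \<in> carrier CP; b \<in> carrier CP; \<And>n. c n \<in> carrier A; \<And>n. a n = \<zero> \<Longrightarrow> b n = \<zero> \<Longrightarrow> c n = \<zero>\<rbrakk> \<Longrightarrow> c \<in> carrier CP"
  unfolding cp_carrier by (auto intro: finite_subset[of _ "{n. a n \<noteq> \<zero>} \<union> {n. b n \<noteq> \<zero>}"])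

lemma cp_add_closed: "\<lbrakk>a \<in> carrier CP; b \<in> carrier CP\<rbrakk> \<Longrightarrow> a \<oplus>\<^bsub>CP\<^esub> b \<in> carrier CP"
  and cp_smult_closed: "a \<in> carrier CP \<Longrightarrow> c \<odot>\<^bsub>CP\<^esub> a \<in> carrier CP"
  by (rule cp_carrierI_union[of a b], auto simp: cp_simps cp_closed)
    (rule cp_carrierI_union[of a a], auto simp: cp_simps cp_closed)

lemma cp_zero_closed: "\<zero>\<^bsub>CP\<^esub> \<in> carrier CP"
  by (simp add: cp_carrier cp_simps)

lemma abelian_group_cp: "abelian_group CP"
proof (rule abelian_groupI)
  fix x assume x: "x \<in> carrier CP"
  then show "\<exists>y\<in>carrier CP. y \<oplus>\<^bsub>CP\<^esub> x = \<zero>\<^bsub>CP\<^esub>"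
    by (intro bexI[of _ "(-1) \<odot>\<^bsub>CP\<^esub> x"]) (auto simp: fun_eq_iff cp_simps cp_closed uminus_left_inverse cp_smult_closed)
qed (auto simp: fun_eq_iff cp_simps cp_closed cp_add_closed cp_zero_closed a_ac)

lemma cp_mult_closed:
  assumes a: "a \<in> carrier CP" and b: "b \<in> carrier CP"
  shows "a \<otimes>\<^bsub>CP\<^esub> b \<in> carrier CP"
proof -
  have "(a \<otimes>\<^bsub>CP\<^esub> b) n \<in> carrier A" for n
    unfolding cp_mult_eq[OF a b cp_finite[OF a] order.refl] by (rule finsum_closed) (use a b in \<open>auto simp: cp_closed\<close>)
  moreover have "{n. (a \<otimes>\<^bsub>CP\<^esub> b) n \<noteq> \<zero>} \<subseteq> (\<lambda>(m, k). m + k) ` ({n. a n \<noteq> \<zero>} \<times> {n. b n \<noteq> \<zero>})"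
  proof
    fix n assume n: "n \<in> {n. (a \<otimes>\<^bsub>CP\<^esub> b) n \<noteq> \<zero>}"
    have "\<exists>m. a m \<noteq> \<zero> \<and> a m \<otimes> \<phi> m (b (n - m)) \<noteq> \<zero>"
    proof (rule ccontr)
      assume *: "\<nexists>m. a m \<noteq> \<zero> \<and> a m \<otimes> \<phi> m (b (n - m)) \<noteq> \<zero>"
      have "(a \<otimes>\<^bsub>CP\<^esub> b) n = \<zero>"
        unfolding cp_mult_eq[OF a b cp_finite[OF a] order.refl] by (rule add.finprod_one_eqI) (use * in blast)
      with n show False by simp
    qed
    then obtain m where "a m \<noteq> \<zero>" "a m \<otimes> \<phi> m (b (n - m)) \<noteq> \<zero>"
      by blast
    moreover from this have "b (n - m) \<noteq> \<zero>"
      using a cp_closed by auto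
    ultimately show "n \<in> (\<lambda>(m, k). m + k) ` ({n. a n \<noteq> \<zero>} \<times> {n. b n \<noteq> \<zero>})"
      by (intro image_eqI[of _ _ "(m, n - m)"]) auto
  qed
  ultimately show ?thesis
    using a b finite_subset unfolding cp_carrier by blast
qed

lemma cp_l_distr:
  assumes "a \<in> carrier CP" "b \<in> carrier CP" "c \<in> carrier CP"
  shows "(a \<oplus>\<^bsub>CP\<^esub> b) \<otimes>\<^bsub>CP\<^esub> c = a \<otimes>\<^bsub>CP\<^esub> c \<oplus>\<^bsub>CP\<^esub> b \<otimes>\<^bsub>CP\<^esub> c"
proof
  fix n
  let ?F = "{n. a n \<noteq> \<zero>} \<union> {n. b n \<noteq> \<zero>}"
  have F: "finite ?F" using assms by (simp add: cp_finite)
  have "finsum A (\<lambda>m. (a \<oplus>\<^bsub>CP\<^esub> b) m \<otimes> \<phi> m (c (n - m))) ?F =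
    finsum A (\<lambda>m. a m \<otimes> \<phi> m (c (n - m)) \<oplus> b m \<otimes> \<phi> m (c (n - m))) ?F"
    by (rule finsum_cong') (use assms in \<open>auto simp: cp_simps l_distr cp_closed\<close>)
  also have "\<dots> = finsum A (\<lambda>m. a m \<otimes> \<phi> m (c (n - m))) ?F \<oplus> finsum A (\<lambda>m. b m \<otimes> \<phi> m (c (n - m))) ?F"
    by (rule finsum_addf) (use assms in \<open>auto simp: cp_closed\<close>)
  finally show "((a \<oplus>\<^bsub>CP\<^esub> b) \<otimes>\<^bsub>CP\<^esub> c) n = (a \<otimes>\<^bsub>CP\<^esub> c \<oplus>\<^bsub>CP\<^esub> b \<otimes>\<^bsub>CP\<^esub> c) n"
    using assms F by (subst cp_simps(1), subst (1 2 3) cp_mult_eq[where F = ?F]) (auto simp: cp_add_closed cp_simps)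
qed

lemma cp_r_distr:
  assumes "a \<in> carrier CP" "b \<in> carrier CP" "c \<in> carrier CP"
  shows "a \<otimes>\<^bsub>CP\<^esub> (b \<oplus>\<^bsub>CP\<^esub> c) = a \<otimes>\<^bsub>CP\<^esub> b \<oplus>\<^bsub>CP\<^esub> a \<otimes>\<^bsub>CP\<^esub> c"
proof
  fix n
  let ?F = "{n. a n \<noteq> \<zero>}"
  have F: "finite ?F" using assms by (simp add: cp_finite)
  have "finsum A (\<lambda>m. a m \<otimes> \<phi> m ((b \<oplus>\<^bsub>CP\<^esub> c) (n - m))) ?F =
    finsum A (\<lambda>m. a m \<otimes> \<phi> m (b (n - m)) \<oplus> a m \<otimes> \<phi> m (c (n - m))) ?F"
    by (rule finsum_cong') (use assms in \<open>auto simp: cp_simps r_distr cp_closed phi_ops\<close>)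
  also have "\<dots> = finsum A (\<lambda>m. a m \<otimes> \<phi> m (b (n - m))) ?F \<oplus> finsum A (\<lambda>m. a m \<otimes> \<phi> m (c (n - m))) ?F"
    by (rule finsum_addf) (use assms in \<open>auto simp: cp_closed\<close>)
  finally show "(a \<otimes>\<^bsub>CP\<^esub> (b \<oplus>\<^bsub>CP\<^esub> c)) n = (a \<otimes>\<^bsub>CP\<^esub> b \<oplus>\<^bsub>CP\<^esub> a \<otimes>\<^bsub>CP\<^esub> c) n"
    using assms F by (subst cp_simps(1), subst (1 2 3) cp_mult_eq[where F = ?F]) (auto simp: cp_add_closed)
qed

lemma cp_smult_mult_left:
  assumes "a \<in> carrier CP" "b \<in> carrier CP"
  shows "(c \<odot>\<^bsub>CP\<^esub> a) \<otimes>\<^bsub>CP\<^esub> b = c \<odot>\<^bsub>CP\<^esub> (a \<otimes>\<^bsub>CP\<^esub> b)"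
proof
  fix n
  let ?F = "{n. a n \<noteq> \<zero>}"
  have F: "finite ?F" using assms by (simp add: cp_finite)
  have "finsum A (\<lambda>m. (c \<odot>\<^bsub>CP\<^esub> a) m \<otimes> \<phi> m (b (n - m))) ?F = c \<odot> finsum A (\<lambda>m. a m \<otimes> \<phi> m (b (n - m))) ?F"
    by (subst smult_finsum[OF F]) (use assms in \<open>auto simp: cp_simps cp_closed smult_mult_left intro!: finsum_cong'\<close>)
  then show "((c \<odot>\<^bsub>CP\<^esub> a) \<otimes>\<^bsub>CP\<^esub> b) n = (c \<odot>\<^bsub>CP\<^esub> (a \<otimes>\<^bsub>CP\<^esub> b)) n"
    using assms F by (subst cp_simps(2), subst (1 2) cp_mult_eq[where F = ?F]) (auto simp: cp_smult_closed cp_simps)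
qed

lemma cp_smult_mult_right:
  assumes "a \<in> carrier CP" "b \<in> carrier CP"
  shows "a \<otimes>\<^bsub>CP\<^esub> (c \<odot>\<^bsub>CP\<^esub> b) = c \<odot>\<^bsub>CP\<^esub> (a \<otimes>\<^bsub>CP\<^esub> b)"
proof
  fix n
  let ?F = "{n. a n \<noteq> \<zero>}"
  have F: "finite ?F" using assms by (simp add: cp_finite)
  have "finsum A (\<lambda>m. a m \<otimes> \<phi> m ((c \<odot>\<^bsub>CP\<^esub> b) (n - m))) ?F = c \<odot> finsum A (\<lambda>m. a m \<otimes> \<phi> m (b (n - m))) ?F"
    by (subst smult_finsum[OF F]) (use assms in \<open>auto simp: cp_simps cp_closed smult_mult_right phi_ops intro!: finsum_cong'\<close>)
  then show "(a \<otimes>\<^bsub>CP\<^esub> (c \<odot>\<^bsub>CP\<^esub> b)) n = (c \<odot>\<^bsub>CP\<^esub> (a \<otimes>\<^bsub>CP\<^esub> b)) n"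
    using assms F by (subst cp_simps(2), subst (1 2) cp_mult_eq[where F = ?F]) (auto simp: cp_smult_closed)
qed

text \<open>The element x w^n, where w is the canonical unitary.\<close>

definition mono :: "int \<Rightarrow> 'a \<Rightarrow> int \<Rightarrow> 'a" where
  "mono n x = (\<lambda>k. if k = n then x else \<zero>)"

lemma mono_closed [simp]: "x \<in> carrier A \<Longrightarrow> mono n x \<in> carrier CP"
  by (auto simp: cp_carrier mono_def)

lemma mono_mult:
  assumes "x \<in> carrier A" "y \<in> carrier A"
  shows "mono m x \<otimes>\<^bsub>CP\<^esub> mono n y = mono (m + n) (x \<otimes> \<phi> m y)"
proof
  fix k
  have "(mono m x \<otimes>\<^bsub>CP\<^esub> mono n y) k = finsum A (\<lambda>i. mono m x i \<otimes> \<phi> i (mono n y (k - i))) {m}"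
    using assms by (intro cp_mult_eq mono_closed) (auto simp: mono_def)
  also have "\<dots> = mono (m + n) (x \<otimes> \<phi> m y) k"
    using assms by (auto simp: mono_def)
  finally show "(mono m x \<otimes>\<^bsub>CP\<^esub> mono n y) k = mono (m + n) (x \<otimes> \<phi> m y) k" .
qed

lemma mono_add: "\<lbrakk>x \<in> carrier A; y \<in> carrier A\<rbrakk> \<Longrightarrow> mono n (x \<oplus> y) = mono n x \<oplus>\<^bsub>CP\<^esub> mono n y"
  by (auto simp: mono_def cp_simps fun_eq_iff)

lemma mono_smult: "x \<in> carrier A \<Longrightarrow> mono n (c \<odot> x) = c \<odot>\<^bsub>CP\<^esub> mono n x"
  by (auto simp: mono_def cp_simps fun_eq_iff)

lemma mono_adj: "x \<in> carrier A \<Longrightarrow> adj CP (mono n x) = mono (- n) (\<phi> (- n) (adj A x))"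
  by (auto simp: mono_def cp_simps fun_eq_iff)

lemma cp_one: "\<one>\<^bsub>CP\<^esub> = mono 0 \<one>"
  by (auto simp: mono_def cp_simps)

lemma cp_induct [consumes 1, case_names zero add]:
  assumes "a \<in> carrier CP" "Q \<zero>\<^bsub>CP\<^esub>"
    and "\<And>b n x. \<lbrakk>b \<in> carrier CP; x \<in> carrier A; Q b\<rbrakk> \<Longrightarrow> Q (b \<oplus>\<^bsub>CP\<^esub> mono n x)"
  shows "Q a"
proof (rule finsupp_induct[where C = "carrier A" and z = \<zero> and a = a and Q = Q])
  fix b n x assume b: "finite {i. b i \<noteq> \<zero>}" "\<And>i. b i \<in> carrier A" "x \<in> carrier A" "b n = \<zero>" "Q b"
  then have "b(n := x) = b \<oplus>\<^bsub>CP\<^esub> mono n x"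
    by (auto simp: cp_simps mono_def fun_eq_iff)
  with b assms(3)[of b x n] show "Q (b(n := x))"
    by (simp add: cp_carrier)
next
  have "\<zero>\<^bsub>CP\<^esub> = (\<lambda>i. \<zero>)" by (auto simp: cp_simps)
  with assms(2) show "Q (\<lambda>i. \<zero>)" by simp
qed (use assms(1) in \<open>auto simp: cp_carrier\<close>)

text \<open>Derived from homogeneity with the scalar 0, since the ring laws become available only
  after associativity, whose proof uses this.\<close>

lemma cp_mult_zero:
  assumes "a \<in> carrier CP"
  shows "a \<otimes>\<^bsub>CP\<^esub> \<zero>\<^bsub>CP\<^esub> = \<zero>\<^bsub>CP\<^esub>" "\<zero>\<^bsub>CP\<^esub> \<otimes>\<^bsub>CP\<^esub> a = \<zero>\<^bsub>CP\<^esub>"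
proof -
  have z: "0 \<odot>\<^bsub>CP\<^esub> b = \<zero>\<^bsub>CP\<^esub>" if "b \<in> carrier CP" for b
    using that by (auto simp: cp_simps cp_closed)
  show "a \<otimes>\<^bsub>CP\<^esub> \<zero>\<^bsub>CP\<^esub> = \<zero>\<^bsub>CP\<^esub>"
    using cp_smult_mult_right[OF assms cp_zero_closed, of 0] z[OF cp_zero_closed]
      z[OF cp_mult_closed[OF assms cp_zero_closed]] by simp
  show "\<zero>\<^bsub>CP\<^esub> \<otimes>\<^bsub>CP\<^esub> a = \<zero>\<^bsub>CP\<^esub>"
    using cp_smult_mult_left[OF cp_zero_closed assms, of 0] z[OF cp_zero_closed]
      z[OF cp_mult_closed[OF cp_zero_closed assms]] by simp
qed

text \<open>Both sides are additive in each factor, so monomials suffice; for them it is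
  \<open>phi_add\<close> together with multiplicativity of \<phi>. The factors are expanded one at a
  time, from the right to the left.\<close>

lemma cp_assoc:
  assumes "a \<in> carrier CP" "b \<in> carrier CP" "c \<in> carrier CP"
  shows "(a \<otimes>\<^bsub>CP\<^esub> b) \<otimes>\<^bsub>CP\<^esub> c = a \<otimes>\<^bsub>CP\<^esub> (b \<otimes>\<^bsub>CP\<^esub> c)"
proof -
  have 1: "(mono m x \<otimes>\<^bsub>CP\<^esub> mono n y) \<otimes>\<^bsub>CP\<^esub> c = mono m x \<otimes>\<^bsub>CP\<^esub> (mono n y \<otimes>\<^bsub>CP\<^esub> c)"
    if c: "c \<in> carrier CP" and x: "x \<in> carrier A" "y \<in> carrier A" for m n x y c
    using c
  proof (induction rule: cp_induct)
    case zero
    then show ?case using x by (simp add: cp_mult_zero mono_mult)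
  next
    case (add c k z)
    have "(mono m x \<otimes>\<^bsub>CP\<^esub> mono n y) \<otimes>\<^bsub>CP\<^esub> mono k z = mono m x \<otimes>\<^bsub>CP\<^esub> (mono n y \<otimes>\<^bsub>CP\<^esub> mono k z)"
      using x add by (simp add: mono_mult m_assoc phi_ops phi_add add.assoc)
    with add x show ?case
      by (simp add: cp_r_distr cp_mult_closed)
  qed
  have 2: "(mono m x \<otimes>\<^bsub>CP\<^esub> b) \<otimes>\<^bsub>CP\<^esub> c = mono m x \<otimes>\<^bsub>CP\<^esub> (b \<otimes>\<^bsub>CP\<^esub> c)" if x: "x \<in> carrier A" for m x
    using assms(2)
  proof (induction rule: cp_induct)
    case zero
    then show ?case using x assms by (simp add: cp_mult_zero)
  next
    case (add b n y)
    then show ?case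
      using x assms 1[OF assms(3), of x y m n] by (simp add: cp_r_distr cp_l_distr cp_mult_closed)
  qed
  show ?thesis
    using assms(1)
  proof (induction rule: cp_induct)
    case zero
    then show ?case using assms by (simp add: cp_mult_zero cp_mult_closed)
  next
    case (add b n y)
    then show ?case
      using assms 2[of y n] by (simp add: cp_l_distr cp_mult_closed)
  qed
qed

lemma cp_l_one: "a \<in> carrier CP \<Longrightarrow> \<one>\<^bsub>CP\<^esub> \<otimes>\<^bsub>CP\<^esub> a = a"
proof (induction rule: cp_induct)
  case (add b n x)
  then show ?case by (simp add: cp_one cp_r_distr mono_mult)
qed (simp add: cp_mult_zero cp_one)

lemma cp_r_one: "a \<in> carrier CP \<Longrightarrow> a \<otimes>\<^bsub>CP\<^esub> \<one>\<^bsub>CP\<^esub> = a"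
proof (induction rule: cp_induct)
  case (add b n x)
  then show ?case by (simp add: cp_one cp_l_distr mono_mult phi_ops)
qed (simp add: cp_mult_zero cp_one)

lemma cp_adj_closed:
  assumes "a \<in> carrier CP"
  shows "adj CP a \<in> carrier CP"
proof -
  have "{n. adj CP a n \<noteq> \<zero>} \<subseteq> uminus ` {n. a n \<noteq> \<zero>}"
    by (auto simp: cp_simps intro!: image_eqI[of _ uminus "- _"])
  then show ?thesis
    using assms finite_subset[OF _ finite_imageI] unfolding cp_carrier by (auto simp: cp_simps)
qed

lemma cp_adj_add: "\<lbrakk>a \<in> carrier CP; b \<in> carrier CP\<rbrakk> \<Longrightarrow> adj CP (a \<oplus>\<^bsub>CP\<^esub> b) = adj CP a \<oplus>\<^bsub>CP\<^esub> adj CP b"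
  by (auto simp: fun_eq_iff cp_simps adj_add cp_closed phi_ops)

text \<open>Reduced to monomials as for associativity. For them the \<phi> m of the product is
  undone by the \<phi> (- m) of the adjoint.\<close>

lemma cp_adj_mult:
  assumes "a \<in> carrier CP" "b \<in> carrier CP"
  shows "adj CP (a \<otimes>\<^bsub>CP\<^esub> b) = adj CP b \<otimes>\<^bsub>CP\<^esub> adj CP a"
proof -
  have adj_zero: "adj CP \<zero>\<^bsub>CP\<^esub> = \<zero>\<^bsub>CP\<^esub>" by (auto simp: cp_simps fun_eq_iff)
  have 1: "adj CP (mono m x \<otimes>\<^bsub>CP\<^esub> b) = adj CP b \<otimes>\<^bsub>CP\<^esub> adj CP (mono m x)" if x: "x \<in> carrier A" for m x
    using assms(2)
  proof (induction rule: cp_induct)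
    case zero
    then show ?case using x by (simp add: cp_mult_zero adj_zero cp_adj_closed)
  next
    case (add b n y)
    have "adj CP (mono m x \<otimes>\<^bsub>CP\<^esub> mono n y) = mono (- n - m) (\<phi> (- n) (\<phi> (- m) (adj A (x \<otimes> \<phi> m y))))"
      using x add by (simp add: mono_mult mono_adj flip: phi_add) (simp add: minus_diff_commute[of m n])
    also have "adj A (x \<otimes> \<phi> m y) = \<phi> m (adj A y) \<otimes> adj A x"
      using x add by (simp add: adj_mult phi_ops)
    also have "\<phi> (- n) (\<phi> (- m) \<dots>) = \<phi> (- n) (adj A y) \<otimes> \<phi> (- n) (\<phi> (- m) (adj A x))"
      using x add by (simp add: phi_ops phi_neg)
    also have "mono (- n - m) \<dots> = adj CP (mono n y) \<otimes>\<^bsub>CP\<^esub> adj CP (mono m x)"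
      using x add by (simp add: mono_adj mono_mult)
    finally show ?case
      using x add by (simp add: cp_r_distr cp_l_distr cp_adj_add cp_mult_closed cp_adj_closed)
  qed
  show ?thesis
    using assms(1)
  proof (induction rule: cp_induct)
    case zero
    then show ?case using assms by (simp add: cp_mult_zero adj_zero cp_adj_closed)
  next
    case (add a n x)
    then show ?case
      using assms 1[of x n] by (simp add: cp_r_distr cp_l_distr cp_adj_add cp_mult_closed cp_adj_closed)
  qed
qed

lemma star_algebra_cp: "star_algebra CP"
proof -
  interpret ring CP
  proof (rule ringI[OF abelian_group_cp])
    show "monoid CP"
      by (rule monoidI) (auto simp: cp_mult_closed cp_assoc cp_l_one cp_r_one, simp add: cp_one)
  qed (auto simp: cp_l_distr cp_r_distr)
  show ?thesis
    by unfold_locales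
      (auto simp: cp_smult_closed cp_smult_mult_left cp_smult_mult_right cp_adj_closed cp_adj_add cp_adj_mult,
        auto simp: fun_eq_iff cp_simps cp_closed smult_add add_smult smult_smult adj_smult phi_ops phi_neg)
qed

end

sublocale Z_action \<subseteq> CP: star_algebra "crossed_polys A \<alpha>"
  by (rule star_algebra_cp)

context Z_action
begin

abbreviation "w \<equiv> mono 1 \<one>"

lemma w_unitary: "unitary_in CP w"
  by (simp add: unitary_in_def mono_adj mono_mult cp_one phi_ops)

lemma w_int_pow: "w [^]\<^bsub>CP\<^esub> n = mono n \<one>"
proof (induction n rule: int_induct[where k = 0])
  case base
  then show ?case by (simp add: cp_one)
next
  case (step1 i)
  then show ?case
    using w_unitary by (simp add: CP.unitary_int_pow_add mono_mult phi_ops)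
next
  case (step2 i)
  have "w [^]\<^bsub>CP\<^esub> (i - 1) = w [^]\<^bsub>CP\<^esub> i \<otimes>\<^bsub>CP\<^esub> w [^]\<^bsub>CP\<^esub> (- 1 :: int)"
    using CP.unitary_int_pow_add[OF w_unitary, of i "- 1"] by simp
  also have "w [^]\<^bsub>CP\<^esub> (- 1 :: int) = adj CP w"
    using CP.unitary_int_pow_neg[OF w_unitary, of 1] w_unitary by simp
  finally show ?case
    using step2 by (simp add: mono_mult mono_adj phi_ops)
qed

lemma mono_eq: "x \<in> carrier A \<Longrightarrow> mono n x = mono 0 x \<otimes>\<^bsub>CP\<^esub> w [^]\<^bsub>CP\<^esub> n"
  by (simp add: w_int_pow mono_mult)

lemma mono_0_hom: "mono 0 \<in> star_hom A CP"
  by (rule star_homI) (simp_all add: mono_add mono_mult mono_smult mono_adj cp_one)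

lemma w_mono: "x \<in> carrier A \<Longrightarrow> w \<otimes>\<^bsub>CP\<^esub> mono 0 x = mono 0 (\<alpha> x) \<otimes>\<^bsub>CP\<^esub> w"
  using star_hom_closed[OF alpha_hom] by (simp add: mono_mult phi_1)

section \<open>The homomorphism given by a covariant pair\<close>

context
  fixes B :: "('b, 'n) star_alg_scheme" and \<pi> :: "'a \<Rightarrow> 'b" and W :: 'b
  assumes B: "star_algebra B" and \<pi>: "\<pi> \<in> star_hom A B" and W: "unitary_in B W"
    and cov: "\<And>x. x \<in> carrier A \<Longrightarrow> W \<otimes>\<^bsub>B\<^esub> \<pi> x = \<pi> (\<alpha> x) \<otimes>\<^bsub>B\<^esub> W"
begin

interpretation B: star_algebra B by (rule B)

lemmas pi_ops = star_hom_ops[OF \<pi>]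

lemma pi_zero: "\<pi> \<zero> = \<zero>\<^bsub>B\<^esub>"
  using star_hom_zero[OF \<pi> star_algebra_axioms B] .

lemma W_pow_closed [simp]: "W [^]\<^bsub>B\<^esub> (n::int) \<in> carrier B"
  using W by simp

lemma cov_int_pow:
  assumes "x \<in> carrier A"
  shows "W [^]\<^bsub>B\<^esub> (n::int) \<otimes>\<^bsub>B\<^esub> \<pi> x = \<pi> (\<phi> n x) \<otimes>\<^bsub>B\<^esub> W [^]\<^bsub>B\<^esub> n"
proof (induction n rule: int_induct[where k = 0])
  case base
  then show ?case using assms by (simp add: pi_ops)
next
  case (step1 i)
  note Wc = unitary_inD(1)[OF W]
  have "W [^]\<^bsub>B\<^esub> (1 + i) \<otimes>\<^bsub>B\<^esub> \<pi> x = W \<otimes>\<^bsub>B\<^esub> (W [^]\<^bsub>B\<^esub> i \<otimes>\<^bsub>B\<^esub> \<pi> x)"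
    using assms W Wc by (simp add: B.unitary_int_pow_add B.m_assoc pi_ops)
  also have "\<dots> = W \<otimes>\<^bsub>B\<^esub> \<pi> (\<phi> i x) \<otimes>\<^bsub>B\<^esub> W [^]\<^bsub>B\<^esub> i"
    unfolding step1(2) using assms Wc by (simp add: B.m_assoc pi_ops)
  also have "\<dots> = \<pi> (\<phi> (i + 1) x) \<otimes>\<^bsub>B\<^esub> (W \<otimes>\<^bsub>B\<^esub> W [^]\<^bsub>B\<^esub> i)"
    using assms Wc star_hom_closed[OF alpha_hom] by (simp add: cov phi_plus_1 B.m_assoc pi_ops)
  also have "W \<otimes>\<^bsub>B\<^esub> W [^]\<^bsub>B\<^esub> i = W [^]\<^bsub>B\<^esub> (1 + i)"
    using W by (simp add: B.unitary_int_pow_add)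
  finally show ?case by (simp add: add.commute)
next
  case (step2 i)
  note Wc = unitary_inD(1)[OF W]
  \<comment> \<open>Multiplying the covariance relation at \<beta> y by the adjoint of W on both
    sides gives the relation for the inverse action, which the downward induction step
    needs.\<close>
  have W': "adj B W \<otimes>\<^bsub>B\<^esub> \<pi> y = \<pi> (\<beta> y) \<otimes>\<^bsub>B\<^esub> adj B W" if y: "y \<in> carrier A" for y
  proof -
    have "W \<otimes>\<^bsub>B\<^esub> \<pi> (\<beta> y) = \<pi> y \<otimes>\<^bsub>B\<^esub> W"
      using cov[of "\<beta> y"] y by (simp add: alpha_beta)
    then have "adj B W \<otimes>\<^bsub>B\<^esub> (W \<otimes>\<^bsub>B\<^esub> \<pi> (\<beta> y)) \<otimes>\<^bsub>B\<^esub> adj B W = adj B W \<otimes>\<^bsub>B\<^esub> (\<pi> y \<otimes>\<^bsub>B\<^esub> W \<otimes>\<^bsub>B\<^esub> adj B W)"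
      using Wc y by (simp add: B.m_assoc pi_ops)
    then show ?thesis
      using y by (simp add: B.unitary_cancel[OF W] pi_ops alpha_beta)
  qed
  have m1: "W [^]\<^bsub>B\<^esub> (i - 1) = adj B W \<otimes>\<^bsub>B\<^esub> W [^]\<^bsub>B\<^esub> i"
    using B.unitary_int_pow_add[OF W, of "- 1" i] B.unitary_int_pow_neg[OF W, of 1] W by simp
  have "W [^]\<^bsub>B\<^esub> (i - 1) \<otimes>\<^bsub>B\<^esub> \<pi> x = adj B W \<otimes>\<^bsub>B\<^esub> (W [^]\<^bsub>B\<^esub> i \<otimes>\<^bsub>B\<^esub> \<pi> x)"
    using assms Wc by (simp add: m1 B.m_assoc pi_ops)
  also have "\<dots> = (adj B W \<otimes>\<^bsub>B\<^esub> \<pi> (\<phi> i x)) \<otimes>\<^bsub>B\<^esub> W [^]\<^bsub>B\<^esub> i"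
    unfolding step2(2) using assms Wc by (simp add: B.m_assoc pi_ops)
  also have "\<dots> = \<pi> (\<phi> (i - 1) x) \<otimes>\<^bsub>B\<^esub> W [^]\<^bsub>B\<^esub> (i - 1)"
    using assms Wc by (simp add: W' phi_minus_1 m1 B.m_assoc pi_ops alpha_beta)
  finally show ?case .
qed

definition cp_eval :: "(int \<Rightarrow> 'a) \<Rightarrow> 'b" where
  "cp_eval a = finsum B (\<lambda>n. \<pi> (a n) \<otimes>\<^bsub>B\<^esub> W [^]\<^bsub>B\<^esub> n) {n. a n \<noteq> \<zero>}"

lemma cp_eval_superset:
  assumes "a \<in> carrier CP" "finite F" "{n. a n \<noteq> \<zero>} \<subseteq> F"
  shows "cp_eval a = finsum B (\<lambda>n. \<pi> (a n) \<otimes>\<^bsub>B\<^esub> W [^]\<^bsub>B\<^esub> n) F"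
  unfolding cp_eval_def
  by (rule B.add.finprod_mono_neutral_cong_left) (use assms in \<open>auto simp: pi_zero pi_ops cp_closed\<close>)

lemma cp_eval_closed: "a \<in> carrier CP \<Longrightarrow> cp_eval a \<in> carrier B"
  unfolding cp_eval_def by (rule B.finsum_closed) (auto simp: pi_ops cp_closed)

lemma cp_eval_add:
  assumes "a \<in> carrier CP" "b \<in> carrier CP"
  shows "cp_eval (a \<oplus>\<^bsub>CP\<^esub> b) = cp_eval a \<oplus>\<^bsub>B\<^esub> cp_eval b"
proof -
  let ?F = "{n. a n \<noteq> \<zero>} \<union> {n. b n \<noteq> \<zero>}"
  have F: "finite ?F" using assms by (simp add: cp_finite)
  have "finsum B (\<lambda>n. \<pi> ((a \<oplus>\<^bsub>CP\<^esub> b) n) \<otimes>\<^bsub>B\<^esub> W [^]\<^bsub>B\<^esub> n) ?F =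
    finsum B (\<lambda>n. \<pi> (a n) \<otimes>\<^bsub>B\<^esub> W [^]\<^bsub>B\<^esub> n \<oplus>\<^bsub>B\<^esub> \<pi> (b n) \<otimes>\<^bsub>B\<^esub> W [^]\<^bsub>B\<^esub> n) ?F"
    by (rule B.finsum_cong') (use assms in \<open>auto simp: cp_simps pi_ops cp_closed B.l_distr\<close>)
  also have "\<dots> = finsum B (\<lambda>n. \<pi> (a n) \<otimes>\<^bsub>B\<^esub> W [^]\<^bsub>B\<^esub> n) ?F \<oplus>\<^bsub>B\<^esub> finsum B (\<lambda>n. \<pi> (b n) \<otimes>\<^bsub>B\<^esub> W [^]\<^bsub>B\<^esub> n) ?F"
    by (rule B.finsum_addf) (use assms in \<open>auto simp: pi_ops cp_closed\<close>)
  finally show ?thesis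
    using assms F by (subst (1 2 3) cp_eval_superset[where F = ?F]) (auto simp: cp_simps)
qed

lemma cp_eval_mono:
  assumes "x \<in> carrier A"
  shows "cp_eval (mono n x) = \<pi> x \<otimes>\<^bsub>B\<^esub> W [^]\<^bsub>B\<^esub> n"
  using assms by (subst cp_eval_superset[of _ "{n}"]) (auto simp: mono_def cp_carrier pi_ops)

lemma cp_eval_zero: "cp_eval \<zero>\<^bsub>CP\<^esub> = \<zero>\<^bsub>B\<^esub>"
  by (simp add: cp_eval_def cp_simps)

lemma cp_eval_smult:
  assumes "a \<in> carrier CP"
  shows "cp_eval (c \<odot>\<^bsub>CP\<^esub> a) = c \<odot>\<^bsub>B\<^esub> cp_eval a"
  using assms
proof (induction rule: cp_induct)
  case (add b n x)
  then show ?case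
    by (simp add: CP.smult_add cp_eval_add cp_eval_mono cp_eval_closed B.smult_add pi_ops B.smult_mult_left
        flip: mono_smult)
qed (simp add: cp_eval_zero)

text \<open>Moving W^m past \<pi> y turns \<pi> y into \<pi> (\<phi> m y), which is exactly the
  twist in the product of two monomials.\<close>

lemma cp_eval_mult_mono:
  assumes "x \<in> carrier A" "b \<in> carrier CP"
  shows "cp_eval (mono m x \<otimes>\<^bsub>CP\<^esub> b) = cp_eval (mono m x) \<otimes>\<^bsub>B\<^esub> cp_eval b"
  using assms(2)
proof (induction rule: cp_induct)
  case (add b n y)
  have "cp_eval (mono m x \<otimes>\<^bsub>CP\<^esub> mono n y) = \<pi> x \<otimes>\<^bsub>B\<^esub> (\<pi> (\<phi> m y) \<otimes>\<^bsub>B\<^esub> W [^]\<^bsub>B\<^esub> m) \<otimes>\<^bsub>B\<^esub> W [^]\<^bsub>B\<^esub> n"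
    using assms add W by (simp add: mono_mult cp_eval_mono pi_ops B.m_assoc B.unitary_int_pow_add)
  also have "\<dots> = cp_eval (mono m x) \<otimes>\<^bsub>B\<^esub> cp_eval (mono n y)"
    using assms add by (simp add: cp_eval_mono pi_ops B.m_assoc flip: cov_int_pow)
  finally show ?case
    using assms add by (simp add: CP.r_distr B.r_distr cp_eval_add cp_eval_closed)
qed (use assms(1) in \<open>simp add: cp_eval_zero cp_eval_closed\<close>)

lemma cp_eval_mult:
  assumes "a \<in> carrier CP" "b \<in> carrier CP"
  shows "cp_eval (a \<otimes>\<^bsub>CP\<^esub> b) = cp_eval a \<otimes>\<^bsub>B\<^esub> cp_eval b"
  using assms(1)
proof (induction rule: cp_induct)
  case (add a n x)
  then show ?case
    using assms(2) by (simp add: CP.l_distr B.l_distr cp_eval_add cp_eval_closed cp_eval_mult_mono)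
qed (use assms(2) in \<open>simp add: cp_eval_zero cp_eval_closed\<close>)

lemma cp_eval_adj:
  assumes "a \<in> carrier CP"
  shows "cp_eval (adj CP a) = adj B (cp_eval a)"
  using assms
proof (induction rule: cp_induct)
  case (add a n x)
  have "cp_eval (adj CP (mono n x)) = W [^]\<^bsub>B\<^esub> (- n) \<otimes>\<^bsub>B\<^esub> \<pi> (adj A x)"
    using add by (simp add: mono_adj cp_eval_mono cov_int_pow)
  also have "\<dots> = adj B (cp_eval (mono n x))"
    using add W by (simp add: cp_eval_mono B.adj_mult pi_ops B.unitary_int_pow_neg)
  finally show ?case
    using add by (simp add: CP.adj_add B.adj_add cp_eval_add cp_eval_closed)
qed (simp add: cp_eval_zero)

lemma cp_eval_star_hom: "cp_eval \<in> star_hom CP B"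
  by (rule star_homI)
    (simp_all add: cp_eval_closed cp_eval_add cp_eval_mult cp_eval_smult cp_eval_adj cp_one cp_eval_mono pi_ops)

lemma cp_hom_exists: "\<exists>h\<in>star_hom CP B. \<forall>n. \<forall>x\<in>carrier A. h (mono n x) = \<pi> x \<otimes>\<^bsub>B\<^esub> W [^]\<^bsub>B\<^esub> n"
  using cp_eval_star_hom cp_eval_mono by blast

end

lemma cp_hom_eqI:
  assumes "star_algebra B" and h: "h \<in> star_hom CP B" and k: "k \<in> star_hom CP B"
    and "\<And>x. x \<in> carrier A \<Longrightarrow> h (mono 0 x) = k (mono 0 x)" "h w = k w" and a: "a \<in> carrier CP"
  shows "h a = k a"
proof -
  interpret B: star_algebra B by fact
  have mono: "h (mono n x) = k (mono n x)" if "x \<in> carrier A" for n x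
    using that w_unitary assms(4,5) unfolding mono_eq[OF that, of n]
    by (simp add: star_hom_mult[OF h] star_hom_mult[OF k]
        star_hom_int_pow[OF h star_algebra_cp assms(1)] star_hom_int_pow[OF k star_algebra_cp assms(1)])
  show ?thesis
    using a
  proof (induction rule: cp_induct)
    case zero
    then show ?case
      using star_hom_zero[OF h star_algebra_cp assms(1)] star_hom_zero[OF k star_algebra_cp assms(1)] by simp
  next
    case (add b n x)
    then show ?case by (simp add: star_hom_add[OF h] star_hom_add[OF k] mono)
  qed
qed

end

locale cstar_Z_action = cstar_algebra A + Z_action A \<alpha> for A :: "('a, 'm) cstar_alg_scheme" (structure) and \<alpha>
begin

text \<open>Along \<open>mono 0\<close> a C*-seminorm restricts to one on A, so it is at most the
  norm of A by automatic continuity; on powers of the unitary \<open>w\<close> it is at most 1.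
  Hence the value at a function is at most the sum of the norms of its coefficients. The
  completeness of A enters here.\<close>

lemma bounded_cp: "bounded_relations CP {}"
proof
  fix a assume "a \<in> carrier CP"
  then show "\<exists>K. \<forall>p. cstar_seminorm CP p \<longrightarrow> (\<forall>r\<in>{}. p r = 0) \<longrightarrow> p a \<le> K"
  proof (induction rule: cp_induct)
    case zero
    have "p \<zero>\<^bsub>CP\<^esub> \<le> 0" if "cstar_seminorm CP p" for p :: "(int \<Rightarrow> 'a) \<Rightarrow> real"
    proof -
      interpret P: seminormed_star_algebra CP p
        by (intro seminormed_star_algebraI star_algebra_cp that)
      show ?thesis by simp
    qed
    then show ?case by blast
  next
    case (add b n x)
    then obtain K where K: "\<And>p. cstar_seminorm CP p \<Longrightarrow> p b \<le> K" by auto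
    have "p (b \<oplus>\<^bsub>CP\<^esub> mono n x) \<le> K + cnorm A x" if p: "cstar_seminorm CP p" for p
    proof -
      interpret P: seminormed_star_algebra CP p
        by (intro seminormed_star_algebraI star_algebra_cp that)
      have "p (mono 0 x) \<le> cnorm A x"
        using seminorm_le_cnorm[OF cstar_seminorm_pullback[OF mono_0_hom p] add(2)] by simp
      moreover have "p (mono n x) \<le> p (mono 0 x) * p (w [^]\<^bsub>CP\<^esub> n)"
        unfolding mono_eq[OF add(2), of n] using add w_unitary by (intro P.p_mult) auto
      moreover have "p (mono 0 x) * p (w [^]\<^bsub>CP\<^esub> n) \<le> p (mono 0 x) * 1"
        using add P.p_unitary_le[OF CP.unitary_int_pow[OF w_unitary]] by (intro mult_left_mono) auto
      moreover have "p (b \<oplus>\<^bsub>CP\<^esub> mono n x) \<le> p b + p (mono n x)"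
        using add by (intro P.p_add) auto
      ultimately show ?thesis
        using K[OF p] by simp
    qed
    then show ?case by blast
  qed
qed simp

sublocale env: bounded_relations CP "{}"
  by (rule bounded_cp)

abbreviation "CX \<equiv> crossed_product A \<alpha>"

definition cx_embed :: "'a \<Rightarrow> (nat \<Rightarrow> int \<Rightarrow> 'a) set" where
  "cx_embed x = enveloping_map CP {} (mono 0 x)"

definition cx_unitary :: "(nat \<Rightarrow> int \<Rightarrow> 'a) set" where
  "cx_unitary = enveloping_map CP {} w"

lemma cstar_algebra_cx: "cstar_algebra CX"
  unfolding crossed_product_def by (rule env.cstar_algebra_enveloping)

lemma cx_map_hom: "enveloping_map CP {} \<in> star_hom CP CX"
  unfolding crossed_product_def by (rule env.enveloping_map_star_hom)

lemma cx_embed_hom: "cx_embed \<in> star_hom A CX"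
  using star_hom_comp[OF mono_0_hom cx_map_hom] by (simp add: cx_embed_def[abs_def])

lemma cx_unitary_unitary: "unitary_in CX cx_unitary"
  unfolding cx_unitary_def by (rule star_hom_unitary[OF cx_map_hom star_algebra_cp w_unitary])

lemma cx_covariant: "x \<in> carrier A \<Longrightarrow> cx_unitary \<otimes>\<^bsub>CX\<^esub> cx_embed x = cx_embed (\<alpha> x) \<otimes>\<^bsub>CX\<^esub> cx_unitary"
  using star_hom_mult[OF cx_map_hom, of w "mono 0 x"] star_hom_mult[OF cx_map_hom, of "mono 0 (\<alpha> x)" w]
    w_mono[of x] star_hom_closed[OF alpha_hom]
  by (simp add: cx_unitary_def cx_embed_def)

lemma cx_universal:
  assumes "cstar_algebra B" "\<pi> \<in> star_hom A B" "unitary_in B W"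
    and "\<And>x. x \<in> carrier A \<Longrightarrow> W \<otimes>\<^bsub>B\<^esub> \<pi> x = \<pi> (\<alpha> x) \<otimes>\<^bsub>B\<^esub> W"
  obtains H where "H \<in> star_hom CX B" "\<And>x. x \<in> carrier A \<Longrightarrow> H (cx_embed x) = \<pi> x" "H cx_unitary = W"
proof -
  interpret B: cstar_algebra B by fact
  obtain h where h: "h \<in> star_hom CP B" "\<And>n x. x \<in> carrier A \<Longrightarrow> h (mono n x) = \<pi> x \<otimes>\<^bsub>B\<^esub> W [^]\<^bsub>B\<^esub> n"
    using cp_hom_exists[OF B.star_algebra_axioms assms(2-4)] by blast
  obtain H where H: "H \<in> star_hom CX B" "\<And>a. a \<in> carrier CP \<Longrightarrow> H (enveloping_map CP {} a) = h a"
    using env.enveloping_universal[OF assms(1) h(1)] unfolding crossed_product_def by auto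
  show ?thesis
  proof (rule that[OF H(1)])
    show "H (cx_embed x) = \<pi> x" if "x \<in> carrier A" for x
      using that star_hom_closed[OF assms(2) that] by (simp add: cx_embed_def H h)
    show "H cx_unitary = W"
      using assms(3) unitary_inD(1)[OF assms(3)] by (simp add: cx_unitary_def H h star_hom_one[OF assms(2)])
  qed
qed

lemma cx_hom_eqI:
  assumes "cstar_algebra B" "h \<in> star_hom CX B" "k \<in> star_hom CX B"
    and "\<And>x. x \<in> carrier A \<Longrightarrow> h (cx_embed x) = k (cx_embed x)" "h cx_unitary = k cx_unitary" "z \<in> carrier CX"
  shows "h z = k z"
proof -
  interpret B: cstar_algebra B by fact
  have "h (enveloping_map CP {} a) = k (enveloping_map CP {} a)" if "a \<in> carrier CP" for a
    using assms(4,5)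
    by (intro cp_hom_eqI[OF B.star_algebra_axioms star_hom_comp[OF cx_map_hom assms(2)] star_hom_comp[OF cx_map_hom assms(3)] _ _ that])
      (simp_all add: cx_embed_def cx_unitary_def)
  from env.enveloping_hom_eqI[OF assms(1) assms(2,3)[unfolded crossed_product_def] this assms(6)[unfolded crossed_product_def]]
  show ?thesis .
qed

end

section \<open>Laurent polynomials\<close>

text \<open>The scalars as a member of the record type: the coefficient algebra of Laurent
  polynomials and the target of point evaluations on the circle.\<close>

definition complex_cstar :: "complex cstar_alg" where
  "complex_cstar = \<lparr>carrier = UNIV, monoid.mult = (*), one = 1, zero = 0, add = (+), smult = (*), adj = cnj, cnorm = cmod\<rparr>"

lemma complex_cstar_simps [simp]:
  "carrier complex_cstar = UNIV" "x \<otimes>\<^bsub>complex_cstar\<^esub> y = x * y" "\<one>\<^bsub>complex_cstar\<^esub> = 1" "\<zero>\<^bsub>complex_cstar\<^esub> = 0"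
  "x \<oplus>\<^bsub>complex_cstar\<^esub> y = x + y" "c \<odot>\<^bsub>complex_cstar\<^esub> x = c * x" "adj complex_cstar x = cnj x"
  by (simp_all add: complex_cstar_def)

lemma star_algebra_complex: "star_algebra complex_cstar"
proof -
  interpret ring complex_cstar
  proof (rule ringI)
    show "abelian_group complex_cstar"
      by (rule abelian_groupI) (auto simp: algebra_simps intro: exI[of _ "- _"])
    show "monoid complex_cstar"
      by (rule monoidI) auto
  qed (auto simp: algebra_simps)
  show ?thesis
    by unfold_locales (auto simp: algebra_simps)
qed

interpretation complex: star_algebra complex_cstar by (rule star_algebra_complex)

text \<open>Laurent polynomials are the finitely supported functions for the trivial action on the
  scalars. Their *-algebra laws and the evaluation at a unitary are thereby instances of what was
  shown for crossed products.\<close>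

interpretation L: Z_action complex_cstar "\<lambda>x. x"
  by unfold_locales (auto simp: star_iso_def star_hom_id bij_betw_def)

abbreviation "LP \<equiv> crossed_polys complex_cstar (\<lambda>x. x)"

lemma (in star_algebra) scalar_hom: "(\<lambda>c. c \<odot> \<one>) \<in> star_hom complex_cstar A"
  by (rule star_homI) (auto simp: add_smult smult_mult_left smult_smult adj_smult)

lemma (in star_algebra) laurent_hom_exists:
  assumes "unitary_in A u"
  shows "\<exists>h\<in>star_hom LP A. \<forall>n c. h (L.mono n c) = c \<odot> u [^] n"
proof -
  have u: "u \<in> carrier A" using assms by (rule unitary_inD)
  have "\<exists>h\<in>star_hom LP A. \<forall>n. \<forall>c\<in>carrier complex_cstar. h (L.mono n c) = (c \<odot> \<one>) \<otimes> u [^] n"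
    by (rule L.cp_hom_exists[OF star_algebra_axioms scalar_hom assms])
      (use u in \<open>simp add: smult_mult_left smult_mult_right\<close>)
  then show ?thesis
    using assms by (simp add: smult_mult_left)
qed

lemma LP_split:
  assumes "a \<in> carrier LP"
  shows "a(n := 0) \<in> carrier LP" "a = a(n := 0) \<oplus>\<^bsub>LP\<^esub> L.mono n (a n)"
proof -
  have *: "{i. (a(n := 0)) i \<noteq> 0} \<subseteq> {i. a i \<noteq> 0}" by auto
  show "a(n := 0) \<in> carrier LP"
    using assms finite_subset[OF *] unfolding L.cp_carrier by (simp del: fun_upd_apply)
  show "a = a(n := 0) \<oplus>\<^bsub>LP\<^esub> L.mono n (a n)"
    by (auto simp: fun_eq_iff L.cp_simps L.mono_def)
qed

text \<open>A crude bound, sharpened later by applying it to high powers of one element.\<close>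

lemma laurent_norm_le:
  assumes "cstar_algebra A" "unitary_in A u" and h: "h \<in> star_hom LP A" "\<And>n c. h (L.mono n c) = c \<odot>\<^bsub>A\<^esub> u [^]\<^bsub>A\<^esub> n"
    and "finite F" "a \<in> carrier LP" "{n. a n \<noteq> 0} \<subseteq> F"
  shows "cnorm A (h a) \<le> (\<Sum>n\<in>F. cmod (a n))"
  using assms(5-)
proof (induction F arbitrary: a rule: finite_induct)
  case empty
  interpret A: cstar_algebra A by fact
  have "a = \<zero>\<^bsub>LP\<^esub>" using empty by (auto simp: fun_eq_iff L.cp_simps)
  then show ?case
    using star_hom_zero[OF h(1) L.star_algebra_cp A.star_algebra_axioms] by simp
next
  case (insert n F)
  interpret A: cstar_algebra A by fact
  let ?b = "a(n := 0)"
  note b = LP_split[OF insert(4), of n]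
  have "cnorm A (h a) = cnorm A (h ?b \<oplus>\<^bsub>A\<^esub> a n \<odot>\<^bsub>A\<^esub> u [^]\<^bsub>A\<^esub> n)"
    by (subst b(2)) (simp add: star_hom_add[OF h(1)] b(1) h(2))
  also have "\<dots> \<le> cnorm A (h ?b) + cnorm A (a n \<odot>\<^bsub>A\<^esub> u [^]\<^bsub>A\<^esub> n)"
    using b(1) assms(2) by (intro A.p_add) (auto simp: star_hom_closed[OF h(1)])
  also have "cnorm A (a n \<odot>\<^bsub>A\<^esub> u [^]\<^bsub>A\<^esub> n) = cmod (a n) * cnorm A (u [^]\<^bsub>A\<^esub> n)"
    using assms(2) by (simp add: A.p_smult)
  also have "\<dots> \<le> cmod (a n) * 1"
    using A.p_unitary_le[OF A.unitary_int_pow[OF assms(2)]] by (intro mult_left_mono) auto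
  also have "cnorm A (h ?b) \<le> (\<Sum>k\<in>F. cmod (?b k))"
    by (intro insert.IH b(1)) (use insert in auto)
  also have "(\<Sum>k\<in>F. cmod (?b k)) = (\<Sum>k\<in>F. cmod (a k))"
    using insert by (intro sum.cong) auto
  finally show ?case
    using insert by simp
qed

lemma laurent_eval_eq_sum:
  assumes h: "h \<in> star_hom LP complex_cstar" "\<And>n c. h (L.mono n c) = c * z powi n"
    and "finite F" "a \<in> carrier LP" "{n. a n \<noteq> 0} \<subseteq> F"
  shows "h a = (\<Sum>n\<in>F. a n * z powi n)"
  using assms(3-)
proof (induction F arbitrary: a rule: finite_induct)
  case empty
  have "a = \<zero>\<^bsub>LP\<^esub>" using empty by (auto simp: fun_eq_iff L.cp_simps)
  then show ?case
    using star_hom_zero[OF h(1) L.star_algebra_cp star_algebra_complex] by simp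
next
  case (insert n F)
  let ?b = "a(n := 0)"
  note b = LP_split[OF insert(4), of n]
  have "h a = h ?b + a n * z powi n"
    by (subst b(2)) (simp add: star_hom_add[OF h(1)] b(1) h(2))
  also have "h ?b = (\<Sum>k\<in>F. ?b k * z powi k)"
    by (intro insert.IH b(1)) (use insert in auto)
  also have "\<dots> = (\<Sum>k\<in>F. a k * z powi k)"
    using insert by (intro sum.cong) auto
  finally show ?case
    using insert by simp
qed

lemma LP_mult_support:
  assumes "a \<in> carrier LP" "b \<in> carrier LP" "{n. a n \<noteq> 0} \<subseteq> {-i..i}" "{n. b n \<noteq> 0} \<subseteq> {-j..j}"
  shows "{n. (a \<otimes>\<^bsub>LP\<^esub> b) n \<noteq> 0} \<subseteq> {-(i + j)..i + j}"
proof
  fix n assume n: "n \<in> {n. (a \<otimes>\<^bsub>LP\<^esub> b) n \<noteq> 0}"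
  \<comment> \<open>The action is trivial, so the twist in the product disappears; this includes
    negative exponents, where \<open>inv_into\<close> of the identity is iterated.\<close>
  have phi: "int_iterate UNIV (\<lambda>x. x) m x = x" for m and x :: complex
  proof -
    have *: "inv_into UNIV (\<lambda>x::complex. x) y = y" for y using inv_f_f[OF inj_on_id2, of y] by simp
    have "((\<lambda>x::complex. x) ^^ k) x = x" "(inv_into UNIV (\<lambda>x::complex. x) ^^ k) x = x" for k
      by (induction k) (simp_all add: *)
    then show ?thesis by (simp add: int_iterate_def)
  qed
  have "\<exists>m. a m \<noteq> 0 \<and> b (n - m) \<noteq> 0"
  proof (rule ccontr)
    assume *: "\<nexists>m. a m \<noteq> 0 \<and> b (n - m) \<noteq> 0"
    have "finite {m. a m \<noteq> 0}" using finite_subset[OF assms(3)] by simp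
    from L.cp_mult_eq[OF assms(1,2) this] have "(a \<otimes>\<^bsub>LP\<^esub> b) n = finsum complex_cstar (\<lambda>m. a m * b (n - m)) {m. a m \<noteq> 0}"
      by (simp add: phi)
    also have "\<dots> = \<zero>\<^bsub>complex_cstar\<^esub>"
      by (rule complex.add.finprod_one_eqI) (use * in auto)
    finally show False using n by simp
  qed
  then obtain m where "a m \<noteq> 0" "b (n - m) \<noteq> 0" by blast
  then have "m \<in> {-i..i}" "n - m \<in> {-j..j}" using assms by blast+
  then show "n \<in> {-(i + j)..i + j}" by auto
qed

section \<open>Fourier coefficients by averaging over roots of unity\<close>

lemma sum_roots_of_unity:
  fixes m :: int and N :: nat
  assumes "\<bar>m\<bar> < int N"
  shows "(\<Sum>j<N. cis (2 * pi * real j / real N) powi m) = (if m = 0 then of_nat N else 0)"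
proof (cases "m = 0")
  case False
  \<comment> \<open>For m nonzero with |m| < N this is an N-th root of unity different from 1, so
    the geometric sum of its powers vanishes.\<close>
  define \<omega> where "\<omega> = cis (2 * pi * of_int m / real N)"
  have N: "N > 0" using assms by (auto intro: gr0I)
  have "cis (2 * pi * real j / real N) powi m = \<omega> ^ j" for j
    by (simp add: cis_power_int \<omega>_def Complex.DeMoivre field_simps)
  then have "(\<Sum>j<N. cis (2 * pi * real j / real N) powi m) = (\<Sum>j<N. \<omega> ^ j)"
    by simp
  moreover have "\<omega> ^ N = 1"
    using N cis_multiple_2pi[of "of_int m"] by (simp add: \<omega>_def Complex.DeMoivre mult_ac)
  moreover have "\<omega> \<noteq> 1"
  proof
    assume "\<omega> = 1"
    then obtain k :: int where "2 * pi * of_int m / real N = of_int (2 * k) * pi"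
      by (auto simp: \<omega>_def cis_conv_exp exp_eq_1)
    then have "of_int m = of_int k * real N"
      using N by (simp add: field_simps)
    then have "m = k * int N"
      by (metis of_int_eq_iff of_int_mult of_int_of_nat_eq)
    with False assms show False
      by (auto simp: abs_mult)
  qed
  ultimately show ?thesis
    using False by (simp add: geometric_sum)
qed simp

text \<open>Multiplication by z^(-k) moves the k-th coefficient to the constant term, and the
  average over N-th roots of unity extracts it. An average is at most the largest of the values in
  modulus. The finite average takes the place of the Fourier integral.\<close>

lemma laurent_coeff_le:
  fixes a :: "int \<Rightarrow> complex"
  assumes "\<And>z. cmod z = 1 \<Longrightarrow> cmod (\<Sum>n\<in>{-K..K}. a n * z powi n) \<le> M" "k \<in> {-K..K}"
  shows "cmod (a k) \<le> M"
proof -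
  \<comment> \<open>Differences of exponents in {-K..K} have absolute value at most 2 K, so this
    many roots of unity tell them apart.\<close>
  define N where "N = nat (2 * K + 1)"
  have N: "int N = 2 * K + 1" "N > 0" using assms(2) by (auto simp: N_def)
  define z where "z j = cis (2 * pi * real j / real N)" for j
  define S where "S w = (\<Sum>n\<in>{-K..K}. a n * w powi n)" for w
  have z1: "cmod (z j) = 1" "z j \<noteq> 0" for j by (simp_all add: z_def)
  have "(\<Sum>j<N. S (z j) * z j powi (- k)) = (\<Sum>j<N. \<Sum>n\<in>{-K..K}. a n * z j powi (n - k))"
    by (simp add: S_def sum_distrib_right power_int_add z1 flip: diff_conv_add_uminus mult.assoc)
      (simp add: power_int_diff z1 power_int_minus field_simps)
  also have "\<dots> = (\<Sum>n\<in>{-K..K}. a n * (\<Sum>j<N. z j powi (n - k)))"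
    by (subst sum.swap) (simp add: sum_distrib_left)
  also have "\<dots> = (\<Sum>n\<in>{-K..K}. if n = k then a n * of_nat N else 0)"
  proof (rule sum.cong)
    fix n assume n: "n \<in> {-K..K}"
    have "\<bar>n - k\<bar> < int N" using n assms(2) N(1) by auto
    from sum_roots_of_unity[OF this] show "a n * (\<Sum>j<N. z j powi (n - k)) = (if n = k then a n * of_nat N else 0)"
      unfolding z_def by simp
  qed simp
  also have "\<dots> = a k * of_nat N" using assms(2) by simp
  finally have "cmod (a k) * real N = cmod (\<Sum>j<N. S (z j) * z j powi (- k))"
    by (simp add: norm_mult)
  also have "\<dots> \<le> (\<Sum>j<N. cmod (S (z j) * z j powi (- k)))"
    by (rule norm_sum)
  also have "\<dots> \<le> (\<Sum>j<N. M)"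
    using assms(1)[OF z1(1)] by (intro sum_mono) (simp add: S_def norm_mult norm_power_int z1)
  finally show ?thesis using N by simp
qed

text \<open>If y < x, put r = y / x. Then (C m + 1) r^m tends to 0, although the hypothesis keeps it
  at least 1 along m = 2^n.\<close>

lemma le_if_powers_le_linear:
  fixes x y C :: real
  assumes "0 \<le> x" "0 \<le> y" "\<And>n. x ^ (2 ^ n) \<le> (C * 2 ^ n + 1) * y ^ (2 ^ n)"
  shows "x \<le> y"
proof (rule ccontr)
  assume "\<not> x \<le> y"
  then have xy: "y < x" "0 < x" using assms by auto
  define r where "r = y / x"
  have r: "0 \<le> r" "r < 1" using xy assms by (auto simp: r_def)
  have "(\<lambda>m. C * (real m * r ^ m) + r ^ m) \<longlonglongrightarrow> C * 0 + 0"
    using r by (intro tendsto_intros powser_times_n_limit_0 LIMSEQ_power_zero) auto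
  then have "(\<lambda>m. C * (real m * r ^ m) + r ^ m) \<longlonglongrightarrow> 0" by simp
  moreover have "strict_mono (\<lambda>n::nat. (2::nat) ^ n)" by (auto simp: strict_mono_def)
  ultimately have lim: "((\<lambda>m. C * (real m * r ^ m) + r ^ m) \<circ> (\<lambda>n::nat. (2::nat) ^ n)) \<longlonglongrightarrow> 0"
    by (rule LIMSEQ_subseq_LIMSEQ)
  have "1 \<le> ((\<lambda>m. C * (real m * r ^ m) + r ^ m) \<circ> (\<lambda>n::nat. (2::nat) ^ n)) n" for n
  proof -
    have "1 \<le> (C * 2 ^ n + 1) * y ^ (2 ^ n) / x ^ (2 ^ n)"
      using assms(3)[of n] xy by simp
    also have "\<dots> = C * (real (2 ^ n) * r ^ (2 ^ n)) + r ^ (2 ^ n)"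
      by (simp add: r_def power_divide add_divide_distrib distrib_right)
    finally show ?thesis by simp
  qed
  then have "(1::real) \<le> 0"
    using LIMSEQ_le_const[OF lim, of 1] by blast
  then show False by simp
qed

section \<open>The algebra of continuous functions on the circle\<close>

abbreviation "CA \<equiv> circle_algebra"
abbreviation (input) "S1 \<equiv> sphere (0::complex) 1"

lemma circle_simps:
  "carrier CA = {g. continuous_on S1 g \<and> (\<forall>z. z \<notin> S1 \<longrightarrow> g z = 0)}"
  "(g \<otimes>\<^bsub>CA\<^esub> h) z = g z * h z" "\<one>\<^bsub>CA\<^esub> = circle_fun (\<lambda>z. 1)" "\<zero>\<^bsub>CA\<^esub> z = 0" "(g \<oplus>\<^bsub>CA\<^esub> h) z = g z + h z"
  "(c \<odot>\<^bsub>CA\<^esub> g) z = c * g z" "adj CA g z = cnj (g z)"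
  by (simp_all add: circle_algebra_def)

lemma circle_fun_closed: "continuous_on S1 g \<Longrightarrow> circle_fun g \<in> carrier CA"
  using continuous_on_cong[OF refl, of S1 "circle_fun g" g] by (auto simp: circle_simps(1) circle_fun_def)

lemma circle_fun_in: "cmod z = 1 \<Longrightarrow> circle_fun g z = g z"
  by (simp add: circle_fun_def)

lemma circle_carrierE:
  assumes "g \<in> carrier CA"
  shows "continuous_on S1 g" "circle_fun g = g"
  using assms by (auto simp: circle_simps circle_fun_def)

lemma circle_closed_intros:
  "g \<in> carrier CA \<Longrightarrow> h \<in> carrier CA \<Longrightarrow> g \<oplus>\<^bsub>CA\<^esub> h \<in> carrier CA"
  "g \<in> carrier CA \<Longrightarrow> h \<in> carrier CA \<Longrightarrow> g \<otimes>\<^bsub>CA\<^esub> h \<in> carrier CA"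
  "g \<in> carrier CA \<Longrightarrow> c \<odot>\<^bsub>CA\<^esub> g \<in> carrier CA"
  "g \<in> carrier CA \<Longrightarrow> adj CA g \<in> carrier CA"
  "\<one>\<^bsub>CA\<^esub> \<in> carrier CA" "\<zero>\<^bsub>CA\<^esub> \<in> carrier CA"
  by (auto simp: circle_algebra_def circle_fun_closed[unfolded circle_algebra_def, simplified] intro!: continuous_intros)

lemma star_algebra_circle: "star_algebra CA"
proof -
  have neg: "\<exists>y\<in>carrier CA. y \<oplus>\<^bsub>CA\<^esub> g = \<zero>\<^bsub>CA\<^esub>" if "g \<in> carrier CA" for g
    using that by (intro bexI[of _ "(-1) \<odot>\<^bsub>CA\<^esub> g"]) (auto simp: fun_eq_iff circle_simps(2-) circle_closed_intros)
  have one: "\<one>\<^bsub>CA\<^esub> \<otimes>\<^bsub>CA\<^esub> g = g" "g \<otimes>\<^bsub>CA\<^esub> \<one>\<^bsub>CA\<^esub> = g" if "g \<in> carrier CA" for g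
    using that by (auto simp: fun_eq_iff circle_simps circle_fun_def)
  interpret ring CA
  proof (rule ringI)
    show "abelian_group CA"
      by (rule abelian_groupI)
        (use neg in \<open>auto simp: circle_closed_intros fun_eq_iff circle_simps(2-) algebra_simps\<close>)
    show "monoid CA"
      by (rule monoidI)
        (use one in \<open>auto simp: circle_closed_intros fun_eq_iff circle_simps(2,4-) algebra_simps\<close>)
  qed (auto simp: fun_eq_iff circle_simps(2-) algebra_simps)
  show ?thesis
    by unfold_locales (auto simp: circle_closed_intros fun_eq_iff circle_simps(2-) algebra_simps)
qed

interpretation CA: star_algebra CA by (rule star_algebra_circle)

definition sup_norm :: "(complex \<Rightarrow> complex) \<Rightarrow> real" where
  "sup_norm g = (SUP z\<in>S1. cmod (g z))"

lemma sphere_nonempty: "S1 \<noteq> {}"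
  by (auto intro!: exI[of _ 1])

lemma sup_norm_upper:
  assumes "g \<in> carrier CA" "cmod z = 1"
  shows "cmod (g z) \<le> sup_norm g"
  unfolding sup_norm_def
proof (rule cSUP_upper)
  have "compact ((\<lambda>z. cmod (g z)) ` S1)"
    using circle_carrierE(1)[OF assms(1)] by (intro compact_continuous_image continuous_intros) auto
  then show "bdd_above ((\<lambda>z. cmod (g z)) ` S1)"
    by (intro bounded_imp_bdd_above compact_imp_bounded)
qed (use assms in simp)

lemma sup_norm_least: "(\<And>z. cmod z = 1 \<Longrightarrow> cmod (g z) \<le> M) \<Longrightarrow> sup_norm g \<le> M"
  unfolding sup_norm_def by (rule cSUP_least[OF sphere_nonempty]) simp

lemma sup_norm_nonneg: "g \<in> carrier CA \<Longrightarrow> 0 \<le> sup_norm g"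
  by (rule order_trans[OF norm_ge_zero sup_norm_upper[of g 1]]) auto

lemma seminormed_circle: "seminormed_star_algebra CA sup_norm"
proof (rule seminormed_star_algebraI[OF star_algebra_circle])
  have smult_le: "sup_norm (c \<odot>\<^bsub>CA\<^esub> g) \<le> cmod c * sup_norm g" if "g \<in> carrier CA" for c g
    using that by (intro sup_norm_least) (simp add: circle_simps(6) norm_mult mult_left_mono sup_norm_upper)
  show "cstar_seminorm CA sup_norm"
    unfolding cstar_seminorm_def
  proof (intro conjI ballI allI)
    fix g assume g: "g \<in> carrier CA"
    show "0 \<le> sup_norm g" using g by (rule sup_norm_nonneg)
    show "sup_norm (c \<odot>\<^bsub>CA\<^esub> g) = cmod c * sup_norm g" for c
    proof (cases "c = 0")
      case True
      then show ?thesis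
        using smult_le[OF g, of c] sup_norm_nonneg[of "c \<odot>\<^bsub>CA\<^esub> g"] g by simp
    next
      case False
      have "cmod c * sup_norm g \<le> sup_norm (c \<odot>\<^bsub>CA\<^esub> g)"
        using smult_le[of "c \<odot>\<^bsub>CA\<^esub> g" "1 / c"] g False CA.smult_smult[of g "1 / c" c]
        by (simp add: norm_divide field_simps)
      then show ?thesis
        using smult_le[OF g, of c] by simp
    qed
    show "sup_norm (adj CA g \<otimes>\<^bsub>CA\<^esub> g) = (sup_norm g)\<^sup>2"
    proof (rule antisym)
      show "sup_norm (adj CA g \<otimes>\<^bsub>CA\<^esub> g) \<le> (sup_norm g)\<^sup>2"
        using g sup_norm_upper[OF g]
        by (intro sup_norm_least) (simp add: circle_simps(2,7) norm_mult power_mono flip: power2_eq_square)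
      have "sup_norm g \<le> sqrt (sup_norm (adj CA g \<otimes>\<^bsub>CA\<^esub> g))"
      proof (rule sup_norm_least)
        fix z :: complex assume "cmod z = 1"
        with sup_norm_upper[of "adj CA g \<otimes>\<^bsub>CA\<^esub> g" z] g show "cmod (g z) \<le> sqrt (sup_norm (adj CA g \<otimes>\<^bsub>CA\<^esub> g))"
          by (intro real_le_rsqrt) (simp add: circle_simps(2,7) norm_mult power2_eq_square)
      qed
      then show "(sup_norm g)\<^sup>2 \<le> sup_norm (adj CA g \<otimes>\<^bsub>CA\<^esub> g)"
        using sup_norm_nonneg[OF g] sup_norm_nonneg[of "adj CA g \<otimes>\<^bsub>CA\<^esub> g"] g
          power_mono[of "sup_norm g" "sqrt (sup_norm (adj CA g \<otimes>\<^bsub>CA\<^esub> g))" 2] by simp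
    qed
    fix h assume h: "h \<in> carrier CA"
    show "sup_norm (g \<oplus>\<^bsub>CA\<^esub> h) \<le> sup_norm g + sup_norm h"
    proof (rule sup_norm_least)
      fix z :: complex assume "cmod z = 1"
      then show "cmod ((g \<oplus>\<^bsub>CA\<^esub> h) z) \<le> sup_norm g + sup_norm h"
        using sup_norm_upper[OF g, of z] sup_norm_upper[OF h, of z] norm_triangle_ineq[of "g z" "h z"]
        by (simp add: circle_simps(5))
    qed
    show "sup_norm (g \<otimes>\<^bsub>CA\<^esub> h) \<le> sup_norm g * sup_norm h"
      using sup_norm_upper[OF g] sup_norm_upper[OF h] sup_norm_nonneg[OF g]
      by (intro sup_norm_least) (simp add: circle_simps(2) norm_mult mult_mono)
  qed
qed

interpretation CA: seminormed_star_algebra CA sup_norm by (rule seminormed_circle)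

text \<open>Here the source is known only as a seminormed algebra, so the square root is written
  down pointwise instead of being found by iteration.\<close>

lemma circle_hom_contractive:
  assumes "cstar_algebra B" "h \<in> star_hom CA B" "g \<in> carrier CA"
  shows "cnorm B (h g) \<le> sup_norm g"
proof -
  interpret B: cstar_algebra B by fact
  have "cstar_seminorm CA (\<lambda>g. cnorm B (h g))"
    by (rule cstar_seminorm_pullback[OF assms(2) B.cnorm_seminorm]) simp
  then show ?thesis
  proof (rule CA.seminorm_le_if_sqrt[OF _ _ assms(3)])
    fix g assume g: "g \<in> carrier CA" "adj CA g = g" "sup_norm g < 1"
    \<comment> \<open>A self-adjoint g is real on the circle, so its square is the square of its
      modulus. The modulus makes the radicand visibly real, and the supremum norm below 1 makes it
      nonnegative.\<close>
    define s where "s = circle_fun (\<lambda>z. of_real (sqrt (1 - (cmod (g z))\<^sup>2)))"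
    have s: "s \<in> carrier CA"
      unfolding s_def using circle_carrierE(1)[OF g(1)] by (intro circle_fun_closed continuous_intros) auto
    have "adj CA s = s" by (auto simp: fun_eq_iff circle_simps s_def circle_fun_def)
    moreover have "g \<otimes>\<^bsub>CA\<^esub> s = s \<otimes>\<^bsub>CA\<^esub> g" by (auto simp: fun_eq_iff circle_simps)
    moreover have "g \<otimes>\<^bsub>CA\<^esub> g \<oplus>\<^bsub>CA\<^esub> s \<otimes>\<^bsub>CA\<^esub> s = \<one>\<^bsub>CA\<^esub>"
    proof
      fix z
      show "(g \<otimes>\<^bsub>CA\<^esub> g \<oplus>\<^bsub>CA\<^esub> s \<otimes>\<^bsub>CA\<^esub> s) z = \<one>\<^bsub>CA\<^esub> z"
      proof (cases "cmod z = 1")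
        case True
        have "cmod (g z) \<le> 1" using sup_norm_upper[OF g(1) True] g(3) by simp
        then have "(cmod (g z))\<^sup>2 \<le> 1" by (simp add: power_le_one)
        then have "s z * s z = of_real (1 - (cmod (g z))\<^sup>2)"
          using True by (simp add: s_def circle_fun_in flip: of_real_mult)
        moreover have "cnj (g z) = g z" using g(2) by (simp add: fun_eq_iff circle_simps)
        then have "g z * g z = of_real ((cmod (g z))\<^sup>2)"
          by (metis complex_norm_square)
        ultimately show ?thesis
          using True by (simp add: circle_simps circle_fun_in)
      next
        case False
        then show ?thesis using g(1) s by (simp add: circle_simps circle_fun_def)
      qed
    qed
    ultimately show "\<exists>s\<in>carrier CA. adj CA s = s \<and> g \<otimes>\<^bsub>CA\<^esub> s = s \<otimes>\<^bsub>CA\<^esub> g \<and> g \<otimes>\<^bsub>CA\<^esub> g \<oplus>\<^bsub>CA\<^esub> s \<otimes>\<^bsub>CA\<^esub> s = \<one>\<^bsub>CA\<^esub>"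
      using s by blast
  qed
qed

abbreviation circle_id :: "complex \<Rightarrow> complex" where
  "circle_id \<equiv> circle_fun (\<lambda>z. z)"

lemma circle_id_unitary: "unitary_in CA circle_id"
proof -
  have "cnj z * z = 1" if "cmod z = 1" for z
    using that complex_norm_square[of z] by (simp add: mult.commute)
  then show ?thesis
    using circle_fun_closed[OF continuous_on_id]
    by (auto simp: unitary_in_def fun_eq_iff circle_simps(2-) circle_fun_in mult.commute) (auto simp: circle_fun_def mult.commute)
qed

lemma circle_eval_hom: "cmod z = 1 \<Longrightarrow> (\<lambda>g. g z) \<in> star_hom CA complex_cstar"
  by (rule star_homI) (auto simp: circle_simps(2-) circle_fun_in)

lemma complex_int_pow:
  assumes "cmod z = 1"
  shows "unitary_in complex_cstar z" "z [^]\<^bsub>complex_cstar\<^esub> (n::int) = z powi n"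
proof -
  have inv: "cnj z = inverse z"
    using assms complex_norm_square[of z] by (intro inverse_unique[symmetric]) simp
  show u: "unitary_in complex_cstar z"
    using assms complex_norm_square[of z] by (simp add: unitary_in_def mult.commute)
  have nat: "z [^]\<^bsub>complex_cstar\<^esub> (k::nat) = z ^ k" for k
    by (induction k) auto
  have "inv\<^bsub>complex_cstar\<^esub> (z ^ k) = inverse (z ^ k)" for k
    using complex.unitary_inv[OF complex.unitary_nat_pow[OF u, of k]] inv by (simp add: nat power_inverse)
  then show "z [^]\<^bsub>complex_cstar\<^esub> (n::int) = z powi n"
    unfolding int_pow_def2 nat power_int_def by (simp add: power_inverse)
qed

text \<open>A Laurent polynomial as a function on the circle. It is chosen as a homomorphism, so
  that the *-algebra rules are immediate; \<open>laurent_eq_sum\<close> recovers the values.\<close>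

definition laurent :: "(int \<Rightarrow> complex) \<Rightarrow> complex \<Rightarrow> complex" where
  "laurent = (SOME h. h \<in> star_hom LP CA \<and> (\<forall>n c. h (L.mono n c) = c \<odot>\<^bsub>CA\<^esub> circle_id [^]\<^bsub>CA\<^esub> n))"

lemma laurent_hom: "laurent \<in> star_hom LP CA"
  and laurent_mono: "laurent (L.mono n c) = c \<odot>\<^bsub>CA\<^esub> circle_id [^]\<^bsub>CA\<^esub> n"
proof -
  have "\<exists>h. h \<in> star_hom LP CA \<and> (\<forall>n c. h (L.mono n c) = c \<odot>\<^bsub>CA\<^esub> circle_id [^]\<^bsub>CA\<^esub> n)"
    using CA.laurent_hom_exists[OF circle_id_unitary] by blast
  from someI_ex[OF this] show "laurent \<in> star_hom LP CA" "laurent (L.mono n c) = c \<odot>\<^bsub>CA\<^esub> circle_id [^]\<^bsub>CA\<^esub> n"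
    unfolding laurent_def by auto
qed

lemma laurent_eq_sum:
  assumes "cmod z = 1" "finite F" "a \<in> carrier LP" "{n. a n \<noteq> 0} \<subseteq> F"
  shows "laurent a z = (\<Sum>n\<in>F. a n * z powi n)"
proof (rule laurent_eval_eq_sum[OF star_hom_comp[OF laurent_hom circle_eval_hom[OF assms(1)]] _ assms(2-)])
  show "laurent (L.mono n c) z = c * z powi n" for n c
    using star_hom_int_pow[OF circle_eval_hom[OF assms(1)] star_algebra_circle star_algebra_complex circle_id_unitary, of n]
      complex_int_pow(2)[OF assms(1)] assms(1)
    by (simp add: laurent_mono circle_simps(6) circle_fun_in)
qed

lemma laurent_norm_estimate:
  assumes "cstar_algebra A" "unitary_in A u" and h: "h \<in> star_hom LP A" "\<And>n c. h (L.mono n c) = c \<odot>\<^bsub>A\<^esub> u [^]\<^bsub>A\<^esub> n"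
    and a: "a \<in> carrier LP"
  shows "cnorm A (h a) \<le> sup_norm (laurent a)"
proof -
  interpret A: cstar_algebra A by fact
  define M where "M = sup_norm (laurent a)"
  have la: "laurent a \<in> carrier CA" using star_hom_closed[OF laurent_hom a] .
  have M: "0 \<le> M" using sup_norm_nonneg[OF la] by (simp add: M_def)
  \<comment> \<open>The element \<open>adj LP a \<otimes> a\<close> is self-adjoint, so the
    C*-identity makes the norms of its repeated squares exact powers. The bound M on the function
    becomes the square of M.\<close>
  define b where "b = adj LP a \<otimes>\<^bsub>LP\<^esub> a"
  have b: "b \<in> carrier LP" "adj LP b = b"
    using a by (simp_all add: b_def L.CP.adj_mult)
  have bM: "cmod (laurent b z) \<le> M\<^sup>2" if "cmod z = 1" for z
    using sup_norm_upper[OF la that] a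
    by (simp add: b_def star_hom_ops[OF laurent_hom] circle_simps(2,7) norm_mult power2_eq_square mult_mono M_def)
  \<comment> \<open>The spectral radius formula: \<open>s n\<close> is \<open>b\<close> to the power \<open>2\<^sup>n\<close>, whose norm is at most the number of its
    coefficients, linear in \<open>2\<^sup>n\<close>, times a bound for each of them.\<close>
  define s where "s n = ((\<lambda>x. x \<otimes>\<^bsub>LP\<^esub> x) ^^ n) b" for n
  have s_Suc: "s (Suc n) = s n \<otimes>\<^bsub>LP\<^esub> s n" and s_0: "s 0 = b" for n
    by (simp_all add: s_def)
  have s: "s n \<in> carrier LP" for n
    by (induction n) (use b in \<open>auto simp: s_Suc s_0\<close>)
  have s_adj: "adj LP (s n) = s n" for n
    by (induction n) (use b s in \<open>auto simp: s_Suc s_0 L.CP.adj_mult\<close>)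
  have s_eval: "laurent (s n) z = laurent b z ^ (2 ^ n)" for n z
    by (induction n) (use s in \<open>simp_all add: s_Suc s_0 star_hom_mult[OF laurent_hom] circle_simps(2) power_mult mult.commute[of 2] power2_eq_square\<close>)
  have s_norm: "cnorm A (h (s n)) = cnorm A (h b) ^ (2 ^ n)" for n
  proof (induction n)
    case (Suc n)
    have "h (s (Suc n)) = adj A (h (s n)) \<otimes>\<^bsub>A\<^esub> h (s n)"
      using s s_adj[of n] star_hom_adj[OF h(1) s[of n]] by (simp add: s_Suc star_hom_mult[OF h(1)])
    then have "cnorm A (h (s (Suc n))) = (cnorm A (h (s n)))\<^sup>2"
      using star_hom_closed[OF h(1) s] by (simp add: A.p_adj_mult)
    with Suc show ?case by (simp add: power_mult[symmetric] mult.commute)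
  qed (simp add: s_0)
  have fin: "finite {n. b n \<noteq> 0}" using b L.cp_finite by simp
  \<comment> \<open>The sum of the absolute values of all exponents in the support serves as a bound
    for each of them.\<close>
  obtain K :: int where K: "0 \<le> K" "{n. b n \<noteq> 0} \<subseteq> {-K..K}"
  proof
    show "0 \<le> (\<Sum>n | b n \<noteq> 0. \<bar>n\<bar>)" by (rule sum_nonneg) simp
    show "{n. b n \<noteq> 0} \<subseteq> {- (\<Sum>n | b n \<noteq> 0. \<bar>n\<bar>)..(\<Sum>n | b n \<noteq> 0. \<bar>n\<bar>)}"
    proof
      fix n assume "n \<in> {n. b n \<noteq> 0}"
      from member_le_sum[OF this _ fin, of abs] show "n \<in> {- (\<Sum>n | b n \<noteq> 0. \<bar>n\<bar>)..(\<Sum>n | b n \<noteq> 0. \<bar>n\<bar>)}"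
        by auto
    qed
  qed
  \<comment> \<open>Each squaring doubles the range of exponents, so the number of coefficients of
    \<open>s n\<close> grows only linearly in 2^n.\<close>
  have s_supp: "{k. s n k \<noteq> 0} \<subseteq> {-(K * 2 ^ n)..K * 2 ^ n}" for n
  proof (induction n)
    case (Suc n)
    have "K * 2 ^ Suc n = K * 2 ^ n + K * 2 ^ n" by simp
    with LP_mult_support[OF s s Suc Suc] show ?case by (simp only: s_Suc)
  qed (use K in \<open>simp add: s_0\<close>)
  have "cnorm A (h b) ^ (2 ^ n) \<le> (2 * of_int K * 2 ^ n + 1) * (M\<^sup>2) ^ (2 ^ n)" for n
  proof -
    let ?K = "K * 2 ^ n"
    have "cmod (laurent (s n) z) \<le> (M\<^sup>2) ^ (2 ^ n)" if "cmod z = 1" for z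
      using power_mono[OF bM[OF that] norm_ge_zero, of "2 ^ n"] by (simp add: s_eval norm_power)
    then have coeff: "cmod (s n k) \<le> (M\<^sup>2) ^ (2 ^ n)" if "k \<in> {-?K..?K}" for k
      using that laurent_coeff_le[where K = ?K and a = "s n"] laurent_eq_sum[OF _ _ s s_supp] by simp
    have "cnorm A (h (s n)) \<le> (\<Sum>k\<in>{-?K..?K}. cmod (s n k))"
      using laurent_norm_le[OF assms(1,2) h _ s s_supp] by simp
    also have "\<dots> \<le> (\<Sum>k\<in>{-?K..?K}. (M\<^sup>2) ^ (2 ^ n))"
      by (intro sum_mono coeff)
    \<comment> \<open>The interval contains 2 K 2^n + 1 integers, which is the linear factor of
      \<open>le_if_powers_le_linear\<close> with C = 2 K.\<close>
    also have "\<dots> = (2 * of_int K * 2 ^ n + 1) * (M\<^sup>2) ^ (2 ^ n)"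
      using K(1) by simp
    finally show ?thesis by (simp add: s_norm)
  qed
  then have "cnorm A (h b) \<le> M\<^sup>2"
    using M star_hom_closed[OF h(1) b(1)] le_if_powers_le_linear[of "cnorm A (h b)" "M\<^sup>2" "2 * of_int K"] by simp
  then have "(cnorm A (h a))\<^sup>2 \<le> M\<^sup>2"
    using a star_hom_closed[OF h(1) a] by (simp add: b_def star_hom_ops[OF h(1)] A.p_adj_mult)
  then show ?thesis
    using power2_le_imp_le[OF _ M] by (simp add: M_def)
qed

text \<open>On the circle the conjugate of z is 1/z, so Re and Im are Laurent polynomials, and so is
  every real polynomial in them. Stone-Weierstrass then approximates the real and the imaginary part
  of g separately.\<close>

lemma laurent_dense: "dense_in CA sup_norm (laurent ` carrier LP)"
proof -
  let ?S = "laurent ` carrier LP"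
  note l = star_hom_ops[OF laurent_hom]
  have add: "g \<oplus>\<^bsub>CA\<^esub> h \<in> ?S" and mult: "g \<otimes>\<^bsub>CA\<^esub> h \<in> ?S" if "g \<in> ?S" "h \<in> ?S" for g h
    using that by (auto simp: l(2,3)[symmetric])
  have smult: "c \<odot>\<^bsub>CA\<^esub> g \<in> ?S" and adj: "adj CA g \<in> ?S" if "g \<in> ?S" for c g
    using that by (auto simp: l(5,6)[symmetric])
  have one: "\<one>\<^bsub>CA\<^esub> \<in> ?S"
    using l(4) L.CP.one_closed by (metis image_eqI)
  have "laurent (L.mono 1 1) = circle_id"
    using circle_id_unitary by (simp add: laurent_mono unitary_inD(1))
  moreover have "L.mono 1 1 \<in> carrier LP" by simp
  ultimately have id: "circle_id \<in> ?S" by (metis image_eqI)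
  have "circle_fun (\<lambda>z. of_real (Re z)) = (1/2) \<odot>\<^bsub>CA\<^esub> (circle_id \<oplus>\<^bsub>CA\<^esub> adj CA circle_id)"
    "circle_fun (\<lambda>z. of_real (Im z)) = (1/(2*\<i>)) \<odot>\<^bsub>CA\<^esub> (circle_id \<oplus>\<^bsub>CA\<^esub> (-1) \<odot>\<^bsub>CA\<^esub> adj CA circle_id)"
    by (auto simp: fun_eq_iff circle_simps(2-) circle_fun_def complex_eq_iff)
  then have ReIm: "circle_fun (\<lambda>z. of_real (Re z)) \<in> ?S" "circle_fun (\<lambda>z. of_real (Im z)) \<in> ?S"
    using add smult adj id by simp_all
  have poly: "circle_fun (\<lambda>z. complex_of_real (f z)) \<in> ?S" if "real_polynomial_function f" for f
    using that
  proof induction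
    \<comment> \<open>A real linear function on the complex plane is a combination of Re and
      Im.\<close>
    case (linear f)
    interpret f: bounded_linear f by fact
    have lin: "f z = Re z * f 1 + Im z * f \<i>" for z
    proof -
      have "z = Re z *\<^sub>R 1 + Im z *\<^sub>R \<i>" by (simp add: complex_eq_iff)
      then have "f z = f (Re z *\<^sub>R 1 + Im z *\<^sub>R \<i>)" by simp
      then show ?thesis by (simp only: f.add f.scaleR) simp
    qed
    have "circle_fun (\<lambda>z. complex_of_real (f z)) = circle_fun (\<lambda>z. complex_of_real (Re z * f 1 + Im z * f \<i>))"
      by (intro arg_cong[where f = circle_fun] ext arg_cong[where f = complex_of_real] lin)
    also have "\<dots> =
      of_real (f 1) \<odot>\<^bsub>CA\<^esub> circle_fun (\<lambda>z. of_real (Re z)) \<oplus>\<^bsub>CA\<^esub> of_real (f \<i>) \<odot>\<^bsub>CA\<^esub> circle_fun (\<lambda>z. of_real (Im z))"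
      by (auto simp: fun_eq_iff circle_simps(2-) circle_fun_def)
    finally show ?case using ReIm add smult by simp
  next
    case (const c)
    have "circle_fun (\<lambda>z. complex_of_real c) = of_real c \<odot>\<^bsub>CA\<^esub> \<one>\<^bsub>CA\<^esub>"
      by (auto simp: fun_eq_iff circle_simps(2-) circle_fun_def)
    then show ?case using one smult by simp
  next
    case (add f g)
    have "circle_fun (\<lambda>z. of_real (f z + g z)) = circle_fun (\<lambda>z. of_real (f z)) \<oplus>\<^bsub>CA\<^esub> circle_fun (\<lambda>z. of_real (g z))"
      by (auto simp: fun_eq_iff circle_simps(2-) circle_fun_def)
    then show ?case using add \<open>\<And>h g. g \<in> ?S \<Longrightarrow> h \<in> ?S \<Longrightarrow> g \<oplus>\<^bsub>CA\<^esub> h \<in> ?S\<close> by simp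
  next
    case (mult f g)
    have "circle_fun (\<lambda>z. of_real (f z * g z)) = circle_fun (\<lambda>z. of_real (f z)) \<otimes>\<^bsub>CA\<^esub> circle_fun (\<lambda>z. of_real (g z))"
      by (auto simp: fun_eq_iff circle_simps(2-) circle_fun_def)
    then show ?case using mult \<open>\<And>h g. g \<in> ?S \<Longrightarrow> h \<in> ?S \<Longrightarrow> g \<otimes>\<^bsub>CA\<^esub> h \<in> ?S\<close> by simp
  qed
  show ?thesis
    unfolding dense_in_def
  proof (intro conjI ballI allI impI)
    show "?S \<subseteq> carrier CA" using l(1) by blast
    fix g and e :: real assume g: "g \<in> carrier CA" and e: "e > 0"
    note cont = circle_carrierE(1)[OF g]
    have "continuous_on S1 (\<lambda>z. Re (g z))" "continuous_on S1 (\<lambda>z. Im (g z))"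
      using cont by (auto intro: continuous_intros)
    \<comment> \<open>With e/4 for each part the pointwise error is below e/2; the supremum is then
      at most e/2, hence strictly below e.\<close>
    then obtain p q where pq: "real_polynomial_function p" "\<And>z. z \<in> S1 \<Longrightarrow> \<bar>Re (g z) - p z\<bar> < e / 4"
      "real_polynomial_function q" "\<And>z. z \<in> S1 \<Longrightarrow> \<bar>Im (g z) - q z\<bar> < e / 4"
      using Stone_Weierstrass_real_polynomial_function[OF compact_sphere, of 0 1 _ "e / 4"] e
      by (metis divide_pos_pos zero_less_numeral)
    define s where "s = circle_fun (\<lambda>z. of_real (p z)) \<oplus>\<^bsub>CA\<^esub> \<i> \<odot>\<^bsub>CA\<^esub> circle_fun (\<lambda>z. of_real (q z))"
    have s: "s \<in> ?S" unfolding s_def using poly pq add smult by simp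
    then have sc: "s \<in> carrier CA" using l(1) by blast
    have "sup_norm (g \<ominus>\<^bsub>CA\<^esub> s) \<le> e / 2"
    proof (rule sup_norm_least)
      fix z :: complex assume z: "cmod z = 1"
      have "(g \<ominus>\<^bsub>CA\<^esub> s) z = g z - (of_real (p z) + \<i> * of_real (q z))"
        using g sc z by (simp add: CA.minus_eq_smult circle_simps(5,6)) (simp add: s_def circle_simps(5,6) circle_fun_in)
      also have "cmod \<dots> \<le> \<bar>Re (g z) - p z\<bar> + \<bar>Im (g z) - q z\<bar>"
        using cmod_le[of "g z - (of_real (p z) + \<i> * of_real (q z))"] by simp
      finally show "cmod ((g \<ominus>\<^bsub>CA\<^esub> s) z) \<le> e / 2"
        using pq(2,4)[of z] z by simp
    qed
    with s e show "\<exists>s\<in>?S. sup_norm (g \<ominus>\<^bsub>CA\<^esub> s) < e"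
      by (intro bexI[of _ s]) auto
  qed
qed

section \<open>Continuous functional calculus of a unitary\<close>

text \<open>Evaluation of Laurent polynomials at u is dominated by the supremum norm, so it extends
  from them to all continuous functions.\<close>

lemma circle_hom_exists:
  assumes "cstar_algebra A" "unitary_in A u"
  shows "\<exists>\<Phi>\<in>star_hom CA A. \<Phi> circle_id = u"
proof -
  interpret A: cstar_algebra A by fact
  obtain h where h: "h \<in> star_hom LP A" "\<And>n c. h (L.mono n c) = c \<odot>\<^bsub>A\<^esub> u [^]\<^bsub>A\<^esub> n"
    using A.laurent_hom_exists[OF assms(2)] by blast
  have "\<exists>\<Phi>\<in>star_hom CA A. \<forall>a\<in>carrier LP. \<Phi> (laurent a) = h a"
    by (rule star_hom_extension[OF L.star_algebra_cp seminormed_circle assms(1) laurent_hom h(1) laurent_dense])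
      (rule laurent_norm_estimate[OF assms h])
  then obtain \<Phi> where \<Phi>: "\<Phi> \<in> star_hom CA A" "\<And>a. a \<in> carrier LP \<Longrightarrow> \<Phi> (laurent a) = h a"
    by blast
  have "\<Phi> circle_id = u"
    using \<Phi>(2)[of "L.mono 1 1"] circle_id_unitary assms(2) by (simp add: laurent_mono h unitary_inD(1))
  with \<Phi> show ?thesis by blast
qed

text \<open>The two homomorphisms agree on Laurent polynomials, which are dense, and both are
  contractive for the supremum norm.\<close>

lemma circle_hom_eqI:
  assumes "cstar_algebra A" "\<Phi> \<in> star_hom CA A" "\<Psi> \<in> star_hom CA A" "\<Phi> circle_id = \<Psi> circle_id" "g \<in> carrier CA"
  shows "\<Phi> g = \<Psi> g"
proof -
  interpret A: cstar_algebra A by fact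
  have "\<Phi> (laurent a) = \<Psi> (laurent a)" if "a \<in> carrier LP" for a
  proof (rule L.cp_hom_eqI[OF A.star_algebra_axioms star_hom_comp[OF laurent_hom assms(2)] star_hom_comp[OF laurent_hom assms(3)] _ _ that])
    show "\<Phi> (laurent (L.mono 0 x)) = \<Psi> (laurent (L.mono 0 x))" for x
      by (simp add: laurent_mono star_hom_smult[OF assms(2)] star_hom_smult[OF assms(3)] star_hom_one[OF assms(2)] star_hom_one[OF assms(3)])
    show "\<Phi> (laurent L.w) = \<Psi> (laurent L.w)"
      using circle_id_unitary assms(4) by (simp add: laurent_mono unitary_inD(1))
  qed
  then show ?thesis
    using circle_hom_contractive[OF assms(1,2)] circle_hom_contractive[OF assms(1,3)]
    by (intro star_hom_eq_on_dense[OF seminormed_circle assms(1-3) _ _ laurent_dense _ assms(5)]) auto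
qed

lemma unitary_calculus_eq:
  assumes "cstar_algebra A" "\<Phi> \<in> star_hom CA A" "\<Phi> circle_id = u" "continuous_on S1 g"
  shows "unitary_calculus A u g = \<Phi> (circle_fun g)"
  unfolding unitary_calculus_def
proof (rule the_equality)
  show "\<exists>\<Phi>'\<in>star_hom CA A. \<Phi>' circle_id = u \<and> \<Phi>' (circle_fun g) = \<Phi> (circle_fun g)"
    using assms by blast
  fix b assume "\<exists>\<Phi>'\<in>star_hom CA A. \<Phi>' circle_id = u \<and> \<Phi>' (circle_fun g) = b"
  then show "b = \<Phi> (circle_fun g)"
    using circle_hom_eqI[OF assms(1) _ assms(2) _ circle_fun_closed[OF assms(4)]] assms(3) by metis
qed

lemma unitary_calculusE:
  assumes "cstar_algebra A" "unitary_in A u"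
  obtains \<Phi> where "\<Phi> \<in> star_hom CA A" "\<Phi> circle_id = u"
    "\<And>g. continuous_on S1 g \<Longrightarrow> unitary_calculus A u g = \<Phi> (circle_fun g)"
  using circle_hom_exists[OF assms] unitary_calculus_eq[OF assms(1)] by blast

lemma calculus_cong:
  assumes "\<And>z. cmod z = 1 \<Longrightarrow> g z = g' z"
  shows "unitary_calculus A u g = unitary_calculus A u g'"
proof -
  have "circle_fun g = circle_fun g'" using assms by (auto simp: circle_fun_def)
  then show ?thesis by (simp add: unitary_calculus_def)
qed

text \<open>The calculus of u followed by h is a homomorphism that takes \<open>circle_id\<close> to
  h u, and there is only one such homomorphism.\<close>

lemma calculus_natural:
  assumes "cstar_algebra A" "cstar_algebra B" "h \<in> star_hom A B" "unitary_in A u" "continuous_on S1 g"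
  shows "h (unitary_calculus A u g) = unitary_calculus B (h u) g"
proof -
  obtain \<Phi> where \<Phi>: "\<Phi> \<in> star_hom CA A" "\<Phi> circle_id = u" "unitary_calculus A u g = \<Phi> (circle_fun g)"
    using unitary_calculusE[OF assms(1,4)] assms(5) by metis
  show ?thesis
    using unitary_calculus_eq[OF assms(2) star_hom_comp[OF \<Phi>(1) assms(3)] _ assms(5), of "h u"] \<Phi> by simp
qed

text \<open>The rotation z \<mapsto> c z of the circle induces an endomorphism of \<open>CA\<close>.
  Followed by the calculus of u, it takes \<open>circle_id\<close> to c u, so by uniqueness it is
  the calculus of c u.\<close>

lemma calculus_rotate:
  assumes "cstar_algebra A" "unitary_in A u" "continuous_on S1 g" "cmod c = 1"
  shows "unitary_calculus A (c \<odot>\<^bsub>A\<^esub> u) g = unitary_calculus A u (\<lambda>z. g (c * z))"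
proof -
  obtain \<Phi> where \<Phi>: "\<Phi> \<in> star_hom CA A" "\<Phi> circle_id = u"
    "\<And>g. continuous_on S1 g \<Longrightarrow> unitary_calculus A u g = \<Phi> (circle_fun g)"
    using unitary_calculusE[OF assms(1,2)] by blast
  define \<rho> where "\<rho> g = circle_fun (\<lambda>z. g (c * z))" for g :: "complex \<Rightarrow> complex"
  have cont: "continuous_on S1 (\<lambda>z. g (c * z))" if "continuous_on S1 g" for g :: "complex \<Rightarrow> complex"
    by (rule continuous_on_compose2[OF that]) (auto intro!: continuous_intros simp: norm_mult assms(4))
  have \<rho>: "\<rho> \<in> star_hom CA CA"
  proof (rule star_homI)
    fix g assume "g \<in> carrier CA"
    then show "\<rho> g \<in> carrier CA"
      unfolding \<rho>_def by (intro circle_fun_closed cont circle_carrierE)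
  qed (auto simp: \<rho>_def fun_eq_iff circle_fun_def circle_simps(2-) norm_mult assms(4))
  have "\<rho> circle_id = c \<odot>\<^bsub>CA\<^esub> circle_id"
    by (auto simp: \<rho>_def fun_eq_iff circle_fun_def circle_simps(2-) norm_mult assms(4))
  then have "\<Phi> (\<rho> circle_id) = c \<odot>\<^bsub>A\<^esub> u"
    using \<Phi> unitary_inD(1)[OF circle_id_unitary] by (simp add: star_hom_smult[OF \<Phi>(1)])
  then have "unitary_calculus A (c \<odot>\<^bsub>A\<^esub> u) g = \<Phi> (\<rho> (circle_fun g))"
    using unitary_calculus_eq[OF assms(1) star_hom_comp[OF \<rho> \<Phi>(1)] _ assms(3)] by simp
  also have "\<rho> (circle_fun g) = circle_fun (\<lambda>z. g (c * z))"
    by (auto simp: \<rho>_def fun_eq_iff circle_fun_def norm_mult assms(4))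
  also have "\<Phi> (circle_fun (\<lambda>z. g (c * z))) = unitary_calculus A u (\<lambda>z. g (c * z))"
    using \<Phi>(3)[OF cont[OF assms(3)]] by simp
  finally show ?thesis .
qed

lemma circle_fun_ops:
  "circle_fun (\<lambda>z. g z * g' z) = circle_fun g \<otimes>\<^bsub>CA\<^esub> circle_fun g'"
  "circle_fun (\<lambda>z. cnj (g z)) = adj CA (circle_fun g)"
  by (auto simp: fun_eq_iff circle_fun_def circle_simps(2-))

section \<open>Rules of the functional calculus\<close>

context
  fixes A :: "('a, 'm) cstar_alg_scheme" and u
  assumes A: "cstar_algebra A" and u: "unitary_in A u"
begin

lemma calculus_closed: "continuous_on S1 g \<Longrightarrow> unitary_calculus A u g \<in> carrier A"
  by (rule unitary_calculusE[OF A u]) (metis circle_fun_closed star_hom_closed)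

lemma calculus_mult:
  assumes "continuous_on S1 g" "continuous_on S1 g'"
  shows "unitary_calculus A u (\<lambda>z. g z * g' z) = unitary_calculus A u g \<otimes>\<^bsub>A\<^esub> unitary_calculus A u g'"
proof -
  obtain \<Phi> where \<Phi>: "\<Phi> \<in> star_hom CA A" "\<And>g. continuous_on S1 g \<Longrightarrow> unitary_calculus A u g = \<Phi> (circle_fun g)"
    using unitary_calculusE[OF A u] by blast
  have "continuous_on S1 (\<lambda>z. g z * g' z)" using assms by (intro continuous_intros)
  then show ?thesis
    using assms by (simp add: \<Phi>(2) circle_fun_ops star_hom_mult[OF \<Phi>(1)] circle_fun_closed)
qed

lemma calculus_adj:
  assumes "continuous_on S1 g"
  shows "unitary_calculus A u (\<lambda>z. cnj (g z)) = adj A (unitary_calculus A u g)"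
proof -
  obtain \<Phi> where \<Phi>: "\<Phi> \<in> star_hom CA A" "\<And>g. continuous_on S1 g \<Longrightarrow> unitary_calculus A u g = \<Phi> (circle_fun g)"
    using unitary_calculusE[OF A u] by blast
  have "continuous_on S1 (\<lambda>z. cnj (g z))" using assms by (intro continuous_intros)
  then show ?thesis
    using assms by (simp add: \<Phi>(2) circle_fun_ops star_hom_adj[OF \<Phi>(1)] circle_fun_closed)
qed

lemma calculus_one: "unitary_calculus A u (\<lambda>z. 1) = \<one>\<^bsub>A\<^esub>"
proof -
  obtain \<Phi> where \<Phi>: "\<Phi> \<in> star_hom CA A" "\<And>g. continuous_on S1 g \<Longrightarrow> unitary_calculus A u g = \<Phi> (circle_fun g)"
    using unitary_calculusE[OF A u] by blast
  then show ?thesis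
    using star_hom_one[OF \<Phi>(1)] by (simp add: circle_simps(3))
qed

lemma calculus_id: "unitary_calculus A u (\<lambda>z. z) = u"
  by (rule unitary_calculusE[OF A u]) (simp add: continuous_on_id)

lemma calculus_unitary:
  assumes "continuous_on S1 g" "\<And>z. cmod z = 1 \<Longrightarrow> cmod (g z) = 1"
  shows "unitary_in A (unitary_calculus A u g)"
proof -
  have "cnj (g z) * g z = 1" "g z * cnj (g z) = 1" if "cmod z = 1" for z
    using complex_norm_square[of "g z"] assms(2)[OF that] by (simp_all add: mult.commute)
  then have "unitary_calculus A u (\<lambda>z. cnj (g z) * g z) = \<one>\<^bsub>A\<^esub>" "unitary_calculus A u (\<lambda>z. g z * cnj (g z)) = \<one>\<^bsub>A\<^esub>"
    using calculus_cong[of "\<lambda>z. cnj (g z) * g z" "\<lambda>z. 1" A u] calculus_cong[of "\<lambda>z. g z * cnj (g z)" "\<lambda>z. 1" A u]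
    by (simp_all add: calculus_one)
  moreover have "continuous_on S1 (\<lambda>z. cnj (g z))" using assms by (intro continuous_intros)
  ultimately show ?thesis
    using assms by (simp add: unitary_in_def calculus_closed calculus_mult calculus_adj)
qed

lemma calculus_power_int: "unitary_calculus A u (\<lambda>z. z powi n) = u [^]\<^bsub>A\<^esub> n"
proof -
  interpret A: cstar_algebra A by (rule A)
  obtain \<Phi> where \<Phi>: "\<Phi> \<in> star_hom CA A" "\<Phi> circle_id = u"
    "\<And>g. continuous_on S1 g \<Longrightarrow> unitary_calculus A u g = \<Phi> (circle_fun g)"
    using unitary_calculusE[OF A u] by blast
  have closed: "circle_id [^]\<^bsub>CA\<^esub> n \<in> carrier CA"
    using circle_id_unitary by simp
  have "(circle_id [^]\<^bsub>CA\<^esub> n) z = z powi n" if "cmod z = 1" for z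
    using star_hom_int_pow[OF circle_eval_hom[OF that] star_algebra_circle star_algebra_complex circle_id_unitary, of n]
      complex_int_pow(2)[OF that] that by (simp add: circle_fun_in)
  then have "circle_fun (\<lambda>z. z powi n) = circle_id [^]\<^bsub>CA\<^esub> n"
    using closed by (auto simp: fun_eq_iff circle_fun_def circle_simps(1))
  moreover have "continuous_on S1 (\<lambda>z. z powi n)"
    by (intro continuous_intros) auto
  ultimately show ?thesis
    using star_hom_int_pow[OF \<Phi>(1) star_algebra_circle A.star_algebra_axioms circle_id_unitary, of n] by (simp add: \<Phi>)
qed

end

section \<open>The automorphisms of the rotation algebra\<close>

text \<open>The function g of the relations. The factor z^d absorbs the power u^d into the calculus,
  so that only a single function of u has to be carried along.\<close>

definition twist :: "int \<Rightarrow> (complex \<Rightarrow> real) \<Rightarrow> complex \<Rightarrow> complex" where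
  "twist d f z = turn (f z) * z powi d"

lemma cmod_turn [simp]: "cmod (turn t) = 1"
  by (simp add: norm_exp_eq_Re)

lemma cmod_twist: "cmod z = 1 \<Longrightarrow> cmod (twist d f z) = 1"
  by (simp add: twist_def norm_mult norm_power_int)

lemma continuous_turn: "continuous_on S1 f \<Longrightarrow> continuous_on S1 (\<lambda>z. turn (f z))"
  by (intro continuous_intros)

lemma continuous_twist:
  assumes "continuous_on S1 f"
  shows "continuous_on S1 (twist d f)"
  unfolding twist_def by (intro continuous_on_mult continuous_turn assms continuous_intros) auto

lemma cnj_eq_inverse: "cmod z = 1 \<Longrightarrow> cnj z = inverse z"
  using complex_norm_square[of z] by (intro inverse_unique[symmetric]) simp

text \<open>On the circle conjugation is inversion. This is the origin of -d and -f in the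
  theorem.\<close>

lemma cnj_twist: "cmod z = 1 \<Longrightarrow> cnj (twist d f z) = twist (- d) (\<lambda>z. - f z) z"
  by (simp add: twist_def cnj_eq_inverse power_int_minus power_int_inverse flip: exp_cnj exp_minus)

lemma calculus_twist:
  assumes "cstar_algebra A" "unitary_in A u" "continuous_on S1 f"
  shows "unitary_calculus A u (twist d f) = unitary_calculus A u (\<lambda>z. turn (f z)) \<otimes>\<^bsub>A\<^esub> u [^]\<^bsub>A\<^esub> d"
proof -
  have "continuous_on S1 (\<lambda>z::complex. z powi d)" by (intro continuous_intros) auto
  then show ?thesis
    using calculus_mult[OF assms(1,2) continuous_turn[OF assms(3)], of "\<lambda>z. z powi d"] calculus_power_int[OF assms(1,2), of d]
    by (simp add: twist_def[abs_def])
qed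

lemma calculus_commutes:
  assumes "cstar_algebra A" "unitary_in A u" "continuous_on S1 g"
  shows "u \<otimes>\<^bsub>A\<^esub> unitary_calculus A u g = unitary_calculus A u g \<otimes>\<^bsub>A\<^esub> u"
  using calculus_mult[OF assms(1,2) continuous_on_id assms(3)] calculus_mult[OF assms(1,2) assms(3) continuous_on_id]
    calculus_id[OF assms(1,2)] by (simp add: mult.commute)

text \<open>As g(u) commutes with u, the unitaries c u and g(u) v satisfy the rotation relation with
  the same \<theta>, and the universal property applies.\<close>

lemma rotation_endomorphism_exists:
  fixes \<theta> :: real
  assumes g: "continuous_on S1 g" "\<And>z. cmod z = 1 \<Longrightarrow> cmod (g z) = 1" and c: "cmod c = 1"
  defines "A \<equiv> rotation_algebra \<theta>"
  obtains h where "h \<in> star_hom A A" "h (rot_u \<theta>) = c \<odot>\<^bsub>A\<^esub> rot_u \<theta>"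
    "h (rot_v \<theta>) = unitary_calculus A (rot_u \<theta>) g \<otimes>\<^bsub>A\<^esub> rot_v \<theta>"
proof -
  have cA: "cstar_algebra A" unfolding A_def by (rule cstar_algebra_rotation)
  interpret A: cstar_algebra A by (rule cA)
  let ?u = "rot_u \<theta>" and ?v = "rot_v \<theta>"
  have u: "unitary_in A ?u" and v: "unitary_in A ?v" and vu: "?v \<otimes>\<^bsub>A\<^esub> ?u = turn \<theta> \<odot>\<^bsub>A\<^esub> (?u \<otimes>\<^bsub>A\<^esub> ?v)"
    unfolding A_def by (rule rotation_algebra_relations)+
  let ?G = "unitary_calculus A ?u g"
  have G: "unitary_in A ?G" using calculus_unitary[OF cA u g] .
  note cl = unitary_inD(1)[OF u] unitary_inD(1)[OF v] unitary_inD(1)[OF G]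
  have "?G \<otimes>\<^bsub>A\<^esub> ?v \<otimes>\<^bsub>A\<^esub> (c \<odot>\<^bsub>A\<^esub> ?u) = c \<odot>\<^bsub>A\<^esub> (?G \<otimes>\<^bsub>A\<^esub> (?v \<otimes>\<^bsub>A\<^esub> ?u))"
    using cl by (simp add: A.smult_mult_right A.m_assoc)
  also have "\<dots> = c \<odot>\<^bsub>A\<^esub> (turn \<theta> \<odot>\<^bsub>A\<^esub> ((?G \<otimes>\<^bsub>A\<^esub> ?u) \<otimes>\<^bsub>A\<^esub> ?v))"
    unfolding vu using cl by (simp add: A.smult_mult_right A.m_assoc)
  also have "\<dots> = turn \<theta> \<odot>\<^bsub>A\<^esub> (c \<odot>\<^bsub>A\<^esub> ?u \<otimes>\<^bsub>A\<^esub> (?G \<otimes>\<^bsub>A\<^esub> ?v))"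
    unfolding calculus_commutes[OF cA u g(1), symmetric]
    using cl by (simp add: A.smult_mult_left A.m_assoc mult.commute flip: A.smult_smult)
  finally show ?thesis
    using rotation_algebra_universal[OF cA A.unitary_smult[OF u c] A.unitary_mult[OF G v], of \<theta>] that
    unfolding A_def by blast
qed

text \<open>By naturality h takes g'(u) to g'(c u), which is the calculus of z \<mapsto> g'(c z) at
  u. So h(k(v)) is v multiplied by the calculus of the product in \<open>gg\<close>, and the
  composite fixes both generators.\<close>

lemma rotation_endomorphism_inverse:
  fixes \<theta> :: real
  defines "A \<equiv> rotation_algebra \<theta>"
  assumes g: "continuous_on S1 g" "continuous_on S1 g'" and c: "cmod c = 1" "c * c' = 1"
    and gg: "\<And>z. cmod z = 1 \<Longrightarrow> g' (c * z) * g z = 1"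
    and h: "h \<in> star_hom A A" "h (rot_u \<theta>) = c \<odot>\<^bsub>A\<^esub> rot_u \<theta>"
      "h (rot_v \<theta>) = unitary_calculus A (rot_u \<theta>) g \<otimes>\<^bsub>A\<^esub> rot_v \<theta>"
    and k: "k \<in> star_hom A A" "k (rot_u \<theta>) = c' \<odot>\<^bsub>A\<^esub> rot_u \<theta>"
      "k (rot_v \<theta>) = unitary_calculus A (rot_u \<theta>) g' \<otimes>\<^bsub>A\<^esub> rot_v \<theta>"
    and x: "x \<in> carrier A"
  shows "h (k x) = x"
proof -
  have cA: "cstar_algebra A" unfolding A_def by (rule cstar_algebra_rotation)
  interpret A: cstar_algebra A by (rule cA)
  let ?u = "rot_u \<theta>" and ?v = "rot_v \<theta>"
  have u: "unitary_in A ?u" and v: "unitary_in A ?v"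
    unfolding A_def by (rule rotation_algebra_relations)+
  note cl = unitary_inD(1)[OF u] unitary_inD(1)[OF v] calculus_closed[OF cA u]
  note ho = star_hom_ops[OF h(1)]
  have hku: "h (k ?u) = ?u"
    using cl(1) c by (simp add: h k ho mult.commute flip: A.smult_smult)
  have cont: "continuous_on S1 (\<lambda>z. g' (c * z))"
    by (rule continuous_on_compose2[OF g(2)]) (auto intro!: continuous_intros simp: norm_mult c)
  have "h (k ?v) = h (unitary_calculus A ?u g') \<otimes>\<^bsub>A\<^esub> (unitary_calculus A ?u g \<otimes>\<^bsub>A\<^esub> ?v)"
    using cl(2) cl(3)[OF g(2)] by (simp add: h k ho)
  also have "h (unitary_calculus A ?u g') = unitary_calculus A ?u (\<lambda>z. g' (c * z))"
    using calculus_natural[OF cA cA h(1) u g(2)] calculus_rotate[OF cA u g(2) c(1)] by (simp add: h)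
  also have "\<dots> \<otimes>\<^bsub>A\<^esub> (unitary_calculus A ?u g \<otimes>\<^bsub>A\<^esub> ?v) = unitary_calculus A ?u (\<lambda>z. g' (c * z) * g z) \<otimes>\<^bsub>A\<^esub> ?v"
    using cl(2) cl(3)[OF g(1)] cl(3)[OF cont] by (simp add: calculus_mult[OF cA u cont g(1)] A.m_assoc)
  also have "unitary_calculus A ?u (\<lambda>z. g' (c * z) * g z) = \<one>\<^bsub>A\<^esub>"
    using calculus_cong[of "\<lambda>z. g' (c * z) * g z" "\<lambda>z. 1" A ?u] gg calculus_one[OF cA u] by simp
  finally have hkv: "h (k ?v) = ?v"
    using cl(2) by simp
  show ?thesis
    using rotation_hom_eqI[OF cA[unfolded A_def] star_hom_comp[OF k(1) h(1), unfolded A_def] star_hom_id, of x] hku hkv x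
    unfolding A_def by simp
qed

lemma rotation_automorphism_exists:
  fixes \<theta> :: real
  assumes g: "continuous_on S1 g" "\<And>z. cmod z = 1 \<Longrightarrow> cmod (g z) = 1" and c: "cmod c = 1"
  defines "A \<equiv> rotation_algebra \<theta>"
  obtains h where "h \<in> star_iso A A" "h (rot_u \<theta>) = c \<odot>\<^bsub>A\<^esub> rot_u \<theta>"
    "h (rot_v \<theta>) = unitary_calculus A (rot_u \<theta>) g \<otimes>\<^bsub>A\<^esub> rot_v \<theta>"
proof -
  have cc: "c * cnj c = 1" "cnj c * c = 1"
    using complex_norm_square[of c] c by (simp_all add: mult.commute)
  \<comment> \<open>The solution of g'(c z) g(z) = 1 on the circle: there g has modulus 1, so its
    inverse is its conjugate, and the inverse of c is \<open>cnj c\<close>.\<close>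
  define g' where "g' z = cnj (g (cnj c * z))" for z
  have "continuous_on S1 (\<lambda>z. g (cnj c * z))"
    by (rule continuous_on_compose2[OF g(1)]) (auto intro!: continuous_intros simp: norm_mult c)
  then have g': "continuous_on S1 g'" "\<And>z. cmod z = 1 \<Longrightarrow> cmod (g' z) = 1"
    unfolding g'_def using g(2) c by (auto intro!: continuous_intros simp: norm_mult)
  obtain h where h: "h \<in> star_hom A A" "h (rot_u \<theta>) = c \<odot>\<^bsub>A\<^esub> rot_u \<theta>"
    "h (rot_v \<theta>) = unitary_calculus A (rot_u \<theta>) g \<otimes>\<^bsub>A\<^esub> rot_v \<theta>"
    using rotation_endomorphism_exists[OF g c] unfolding A_def by blast
  obtain k where k: "k \<in> star_hom A A" "k (rot_u \<theta>) = cnj c \<odot>\<^bsub>A\<^esub> rot_u \<theta>"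
    "k (rot_v \<theta>) = unitary_calculus A (rot_u \<theta>) g' \<otimes>\<^bsub>A\<^esub> rot_v \<theta>"
    using rotation_endomorphism_exists[OF g', of "cnj c" \<theta>] c unfolding A_def by auto
  have gg: "cnj (g z) * g z = 1" "g z * cnj (g z) = 1" if "cmod z = 1" for z
    using complex_norm_square[of "g z"] g(2)[OF that] by (simp_all add: mult.commute)
  have 1: "g' (c * z) * g z = 1" if "cmod z = 1" for z
    using gg[OF that] cc by (simp add: g'_def flip: mult.assoc)
  have 2: "g (cnj c * z) * g' z = 1" if "cmod z = 1" for z
    using gg[of "cnj c * z"] that c by (simp add: g'_def norm_mult)
  have "h (k x) = x" "k (h x) = x" if "x \<in> carrier A" for x
    using rotation_endomorphism_inverse[OF g(1) g'(1) c cc(1) 1 h[unfolded A_def] k[unfolded A_def] that[unfolded A_def]]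
      rotation_endomorphism_inverse[OF g'(1) g(1) _ cc(2) 2 k[unfolded A_def] h[unfolded A_def] that[unfolded A_def]] c
    by simp_all
  then have "bij_betw h (carrier A) (carrier A)"
    using star_hom_closed[OF h(1)] star_hom_closed[OF k(1)] by (intro bij_betw_byWitness[where f' = k]) auto
  then show ?thesis
    using that[of h] h by (simp add: star_iso_def)
qed

lemma star_iso_restrict:
  assumes "star_algebra A" "h \<in> star_iso A B"
  shows "restrict h (carrier A) \<in> star_iso A B"
proof -
  interpret A: star_algebra A by fact
  have h: "h \<in> star_hom A B" "bij_betw h (carrier A) (carrier B)"
    using assms(2) by (auto simp: star_iso_def)
  have "restrict h (carrier A) \<in> star_hom A B"
    by (rule star_homI) (simp_all add: star_hom_ops[OF h(1)])
  moreover have "bij_betw (restrict h (carrier A)) (carrier A) (carrier B)"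
    using h(2) by (subst bij_betw_cong[of _ _ h]) auto
  ultimately show ?thesis by (simp add: star_iso_def)
qed

text \<open>The description in \<open>rot_aut\<close> denotes because a suitable automorphism exists
  and is unique: two candidates agree on the generators, hence on the carrier, and
  \<open>extensional\<close> fixes their values elsewhere.\<close>

lemma
  assumes f: "continuous_on S1 f"
  shows rot_aut_iso: "rot_aut \<theta> \<gamma> d f \<in> star_iso (rotation_algebra \<theta>) (rotation_algebra \<theta>)"
    and rot_aut_u: "rot_aut \<theta> \<gamma> d f (rot_u \<theta>) = turn \<gamma> \<odot>\<^bsub>rotation_algebra \<theta>\<^esub> rot_u \<theta>"
    and rot_aut_v: "rot_aut \<theta> \<gamma> d f (rot_v \<theta>) =
      unitary_calculus (rotation_algebra \<theta>) (rot_u \<theta>) (twist d f) \<otimes>\<^bsub>rotation_algebra \<theta>\<^esub> rot_v \<theta>"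
proof -
  define A where "A = rotation_algebra \<theta>"
  have cA: "cstar_algebra A" unfolding A_def by (rule cstar_algebra_rotation)
  interpret A: cstar_algebra A by (rule cA)
  have u: "unitary_in A (rot_u \<theta>)" and v: "unitary_in A (rot_v \<theta>)"
    unfolding A_def by (rule rotation_algebra_relations)+
  define P where "P \<alpha> \<longleftrightarrow> \<alpha> \<in> extensional (carrier A) \<and> \<alpha> \<in> star_iso A A \<and>
        \<alpha> (rot_u \<theta>) = turn \<gamma> \<odot>\<^bsub>A\<^esub> rot_u \<theta> \<and>
        \<alpha> (rot_v \<theta>) = unitary_calculus A (rot_u \<theta>) (\<lambda>z. turn (f z)) \<otimes>\<^bsub>A\<^esub> (rot_u \<theta> [^]\<^bsub>A\<^esub> d) \<otimes>\<^bsub>A\<^esub> rot_v \<theta>" for \<alpha>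
  note tw = calculus_twist[OF cA u f, of d, symmetric]
  have "\<exists>!\<alpha>. P \<alpha>"
  proof (rule ex_ex1I)
    obtain h where h: "h \<in> star_iso A A" "h (rot_u \<theta>) = turn \<gamma> \<odot>\<^bsub>A\<^esub> rot_u \<theta>"
      "h (rot_v \<theta>) = unitary_calculus A (rot_u \<theta>) (twist d f) \<otimes>\<^bsub>A\<^esub> rot_v \<theta>"
      using rotation_automorphism_exists[OF continuous_twist[OF f] cmod_twist cmod_turn] unfolding A_def by metis
    \<comment> \<open>Restriction makes the map extensional and keeps its values at both generators,
      since they lie in the carrier.\<close>
    have "P (restrict h (carrier A))"
      unfolding P_def tw using h star_iso_restrict[OF A.star_algebra_axioms h(1)] unitary_inD(1)[OF u] unitary_inD(1)[OF v]
      by simp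
    then show "\<exists>\<alpha>. P \<alpha>" by blast
    fix \<alpha> \<beta> assume \<alpha>: "P \<alpha>" and \<beta>: "P \<beta>"
    then have hom: "\<alpha> \<in> star_hom A A" "\<beta> \<in> star_hom A A"
      by (auto simp: P_def star_iso_def)
    have eq: "\<alpha> (rot_u \<theta>) = \<beta> (rot_u \<theta>)" "\<alpha> (rot_v \<theta>) = \<beta> (rot_v \<theta>)"
      using \<alpha> \<beta> unfolding P_def by simp_all
    show "\<alpha> = \<beta>"
    proof (rule extensionalityI)
      show "\<alpha> \<in> extensional (carrier A)" "\<beta> \<in> extensional (carrier A)"
        using \<alpha> \<beta> by (auto simp: P_def)
      show "\<alpha> x = \<beta> x" if "x \<in> carrier A" for x
        by (rule rotation_hom_eqI[OF cstar_algebra_rotation hom[unfolded A_def] eq that[unfolded A_def]])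
    qed
  qed
  then have "P (THE \<alpha>. P \<alpha>)" by (rule theI')
  moreover have "rot_aut \<theta> \<gamma> d f = (THE \<alpha>. P \<alpha>)"
    by (simp add: rot_aut_def P_def[abs_def] A_def Let_def)
  ultimately have P: "P (rot_aut \<theta> \<gamma> d f)" by simp
  show "rot_aut \<theta> \<gamma> d f \<in> star_iso (rotation_algebra \<theta>) (rotation_algebra \<theta>)"
    "rot_aut \<theta> \<gamma> d f (rot_u \<theta>) = turn \<gamma> \<odot>\<^bsub>rotation_algebra \<theta>\<^esub> rot_u \<theta>"
    "rot_aut \<theta> \<gamma> d f (rot_v \<theta>) = unitary_calculus (rotation_algebra \<theta>) (rot_u \<theta>) (twist d f) \<otimes>\<^bsub>rotation_algebra \<theta>\<^esub> rot_v \<theta>"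
    using P unfolding P_def tw by (simp_all flip: A_def)
qed

section \<open>Generators and relations of the crossed product\<close>

text \<open>The relations mention no automorphism and make sense in any C*-algebra, so generators of
  either crossed product can be tested against the presentation of the other.\<close>

definition furstenberg_triple ::
  "('a, 'm) cstar_alg_scheme \<Rightarrow> real \<Rightarrow> real \<Rightarrow> (complex \<Rightarrow> complex) \<Rightarrow> 'a \<Rightarrow> 'a \<Rightarrow> 'a \<Rightarrow> bool" where
  "furstenberg_triple B \<theta> \<gamma> g u v w \<longleftrightarrow>
     unitary_in B u \<and> unitary_in B v \<and> unitary_in B w \<and>
     v \<otimes>\<^bsub>B\<^esub> u = turn \<theta> \<odot>\<^bsub>B\<^esub> (u \<otimes>\<^bsub>B\<^esub> v) \<and>
     w \<otimes>\<^bsub>B\<^esub> u = turn \<gamma> \<odot>\<^bsub>B\<^esub> (u \<otimes>\<^bsub>B\<^esub> w) \<and>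
     w \<otimes>\<^bsub>B\<^esub> v = unitary_calculus B u g \<otimes>\<^bsub>B\<^esub> v \<otimes>\<^bsub>B\<^esub> w"

text \<open>The unitary u keeps its place, so both sides use the calculus of the same element.
  Multiplying w v = g(u) v w by the adjoint of g(u) gives the exchanged relation, and that adjoint
  is the calculus of the conjugate function.\<close>

lemma furstenberg_triple_swap:
  assumes B: "cstar_algebra B" and f: "continuous_on S1 f" and t: "furstenberg_triple B \<theta> \<gamma> (twist d f) u v w"
  shows "furstenberg_triple B \<gamma> \<theta> (twist (- d) (\<lambda>z. - f z)) u w v"
proof -
  interpret B: cstar_algebra B by fact
  note r = t[unfolded furstenberg_triple_def]
  have u: "unitary_in B u" using r by simp
  have cl: "v \<in> carrier B" "w \<in> carrier B" using r by (auto dest: unitary_inD(1))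
  let ?G = "unitary_calculus B u (twist d f)"
  have G: "unitary_in B ?G"
    by (rule calculus_unitary[OF B u continuous_twist[OF f] cmod_twist])
  have "unitary_calculus B u (twist (- d) (\<lambda>z. - f z)) = adj B ?G"
    using calculus_cong[of "\<lambda>z. cnj (twist d f z)", OF cnj_twist, of B u] calculus_adj[OF B u continuous_twist[OF f]] by simp
  moreover have "adj B ?G \<otimes>\<^bsub>B\<^esub> w \<otimes>\<^bsub>B\<^esub> v = adj B ?G \<otimes>\<^bsub>B\<^esub> (?G \<otimes>\<^bsub>B\<^esub> (v \<otimes>\<^bsub>B\<^esub> w))"
    using r cl unitary_inD(1)[OF G] by (simp add: B.m_assoc)
  moreover have "\<dots> = v \<otimes>\<^bsub>B\<^esub> w"
    using cl by (simp add: B.unitary_cancel[OF G])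
  ultimately show ?thesis
    using r by (simp add: furstenberg_triple_def)
qed

locale rotation_crossed =
  fixes \<theta> \<gamma> :: real and d :: int and f :: "complex \<Rightarrow> real"
  assumes f: "continuous_on S1 f"
begin

abbreviation "RA \<equiv> rotation_algebra \<theta>"

sublocale cstar_Z_action RA "rot_aut \<theta> \<gamma> d f"
proof -
  interpret cstar_algebra RA by (rule cstar_algebra_rotation)
  show "cstar_Z_action RA (rot_aut \<theta> \<gamma> d f)"
    by unfold_locales (rule rot_aut_iso[OF f])
qed

abbreviation "U \<equiv> cx_embed (rot_u \<theta>)"
abbreviation "V \<equiv> cx_embed (rot_v \<theta>)"
abbreviation "W \<equiv> cx_unitary"

lemma triple: "furstenberg_triple CX \<theta> \<gamma> (twist d f) U V W"
proof -
  interpret CX: cstar_algebra CX by (rule cstar_algebra_cx)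
  note e = star_hom_ops[OF cx_embed_hom]
  note u = rot_u_unitary[of \<theta>] and v = rot_v_unitary[of \<theta>]
  note uc = unitary_inD(1)[OF u] and vc = unitary_inD(1)[OF v]
  note gc = calculus_closed[OF cstar_algebra_rotation u continuous_twist[OF f], of d]
  have "V \<otimes>\<^bsub>CX\<^esub> U = turn \<theta> \<odot>\<^bsub>CX\<^esub> (U \<otimes>\<^bsub>CX\<^esub> V)"
    using uc vc by (simp add: rot_vu flip: e(2,3,5))
  moreover have "W \<otimes>\<^bsub>CX\<^esub> U = turn \<gamma> \<odot>\<^bsub>CX\<^esub> (U \<otimes>\<^bsub>CX\<^esub> W)"
    using uc cx_covariant[OF uc] unitary_inD(1)[OF cx_unitary_unitary]
    by (simp add: rot_aut_u[OF f] e CX.smult_mult_left)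
  \<comment> \<open>Naturality of the calculus carries g(u) from the rotation algebra into the
    crossed product.\<close>
  moreover have "W \<otimes>\<^bsub>CX\<^esub> V = unitary_calculus CX U (twist d f) \<otimes>\<^bsub>CX\<^esub> V \<otimes>\<^bsub>CX\<^esub> W"
    using vc gc cx_covariant[OF vc] calculus_natural[OF cstar_algebra_rotation cstar_algebra_cx cx_embed_hom u continuous_twist[OF f], of d]
    by (simp add: rot_aut_v[OF f] e)
  ultimately show ?thesis
    unfolding furstenberg_triple_def
    using star_hom_unitary[OF cx_embed_hom star_algebra_axioms] u v cx_unitary_unitary by blast
qed

text \<open>The relation between u and v yields a homomorphism \<pi> of the rotation algebra.
  Covariance is known only for the two generators; it spreads to the whole algebra because
  conjugation of \<pi> by w' and \<pi> after the automorphism are both *-homomorphisms, and these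
  are determined by their values at the generators.\<close>

lemma universal:
  assumes B: "cstar_algebra B" and t: "furstenberg_triple B \<theta> \<gamma> (twist d f) u v w'"
  obtains H where "H \<in> star_hom CX B" "H U = u" "H V = v" "H W = w'"
proof -
  interpret B: cstar_algebra B by fact
  note r = t[unfolded furstenberg_triple_def]
  have u: "unitary_in B u" and v: "unitary_in B v" and w': "unitary_in B w'" using r by auto
  note cl = unitary_inD(1)[OF u] unitary_inD(1)[OF v] unitary_inD(1)[OF w']
  note \<theta>u = rot_u_unitary[of \<theta>] and \<theta>v = rot_v_unitary[of \<theta>]
  note uc = unitary_inD(1)[OF \<theta>u] and vc = unitary_inD(1)[OF \<theta>v]
  obtain \<pi> where \<pi>: "\<pi> \<in> star_hom RA B" "\<pi> (rot_u \<theta>) = u" "\<pi> (rot_v \<theta>) = v"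
    using rotation_algebra_universal[OF B u v] r by metis
  note p = star_hom_ops[OF \<pi>(1)]
  note gc = calculus_closed[OF cstar_algebra_rotation \<theta>u continuous_twist[OF f], of d]
  have G: "unitary_calculus B u (twist d f) \<in> carrier B"
    by (rule calculus_closed[OF B u continuous_twist[OF f]])
  have Ad: "(\<lambda>x. w' \<otimes>\<^bsub>B\<^esub> \<pi> x \<otimes>\<^bsub>B\<^esub> adj B w') \<in> star_hom RA B"
  proof (rule star_homI)
    fix x y assume xy: "x \<in> carrier RA" "y \<in> carrier RA"
    have "(w' \<otimes>\<^bsub>B\<^esub> \<pi> x \<otimes>\<^bsub>B\<^esub> adj B w') \<otimes>\<^bsub>B\<^esub> (w' \<otimes>\<^bsub>B\<^esub> \<pi> y \<otimes>\<^bsub>B\<^esub> adj B w')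
        = w' \<otimes>\<^bsub>B\<^esub> \<pi> x \<otimes>\<^bsub>B\<^esub> (adj B w' \<otimes>\<^bsub>B\<^esub> (w' \<otimes>\<^bsub>B\<^esub> (\<pi> y \<otimes>\<^bsub>B\<^esub> adj B w')))"
      using xy cl by (simp add: B.m_assoc p)
    also have "\<dots> = w' \<otimes>\<^bsub>B\<^esub> \<pi> x \<otimes>\<^bsub>B\<^esub> (\<pi> y \<otimes>\<^bsub>B\<^esub> adj B w')"
      using xy cl by (simp add: B.unitary_cancel[OF w'] p)
    finally show "w' \<otimes>\<^bsub>B\<^esub> \<pi> (x \<otimes>\<^bsub>RA\<^esub> y) \<otimes>\<^bsub>B\<^esub> adj B w'
        = (w' \<otimes>\<^bsub>B\<^esub> \<pi> x \<otimes>\<^bsub>B\<^esub> adj B w') \<otimes>\<^bsub>B\<^esub> (w' \<otimes>\<^bsub>B\<^esub> \<pi> y \<otimes>\<^bsub>B\<^esub> adj B w')"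
      using xy cl by (simp add: B.m_assoc p)
    show "w' \<otimes>\<^bsub>B\<^esub> \<pi> (x \<oplus>\<^bsub>RA\<^esub> y) \<otimes>\<^bsub>B\<^esub> adj B w'
        = (w' \<otimes>\<^bsub>B\<^esub> \<pi> x \<otimes>\<^bsub>B\<^esub> adj B w') \<oplus>\<^bsub>B\<^esub> (w' \<otimes>\<^bsub>B\<^esub> \<pi> y \<otimes>\<^bsub>B\<^esub> adj B w')"
      using xy cl by (simp add: B.l_distr B.r_distr p)
  next
    fix x c assume x: "x \<in> carrier RA"
    show "w' \<otimes>\<^bsub>B\<^esub> \<pi> x \<otimes>\<^bsub>B\<^esub> adj B w' \<in> carrier B"
      using x cl by (simp add: p)
    show "w' \<otimes>\<^bsub>B\<^esub> \<pi> (c \<odot>\<^bsub>RA\<^esub> x) \<otimes>\<^bsub>B\<^esub> adj B w' = c \<odot>\<^bsub>B\<^esub> (w' \<otimes>\<^bsub>B\<^esub> \<pi> x \<otimes>\<^bsub>B\<^esub> adj B w')"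
      using x cl by (simp add: p B.smult_mult_left B.smult_mult_right)
    show "w' \<otimes>\<^bsub>B\<^esub> \<pi> (adj RA x) \<otimes>\<^bsub>B\<^esub> adj B w' = adj B (w' \<otimes>\<^bsub>B\<^esub> \<pi> x \<otimes>\<^bsub>B\<^esub> adj B w')"
      using x cl by (simp add: p B.adj_mult B.m_assoc)
  next
    show "w' \<otimes>\<^bsub>B\<^esub> \<pi> \<one>\<^bsub>RA\<^esub> \<otimes>\<^bsub>B\<^esub> adj B w' = \<one>\<^bsub>B\<^esub>"
      using cl unitary_inD(3)[OF w'] by (simp add: p)
  qed
  have Ad_u: "w' \<otimes>\<^bsub>B\<^esub> \<pi> (rot_u \<theta>) \<otimes>\<^bsub>B\<^esub> adj B w' = \<pi> (rot_aut \<theta> \<gamma> d f (rot_u \<theta>))"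
    using r cl uc by (simp add: rot_aut_u[OF f] p \<pi> B.smult_mult_left B.unitary_cancel[OF w'])
  have Ad_v: "w' \<otimes>\<^bsub>B\<^esub> \<pi> (rot_v \<theta>) \<otimes>\<^bsub>B\<^esub> adj B w' = \<pi> (rot_aut \<theta> \<gamma> d f (rot_v \<theta>))"
    using r cl vc G gc calculus_natural[OF cstar_algebra_rotation B \<pi>(1) \<theta>u continuous_twist[OF f], of d]
    by (simp add: rot_aut_v[OF f] p \<pi> B.unitary_cancel[OF w'])
  have "w' \<otimes>\<^bsub>B\<^esub> \<pi> x = \<pi> (rot_aut \<theta> \<gamma> d f x) \<otimes>\<^bsub>B\<^esub> w'" if x: "x \<in> carrier RA" for x
  proof -
    have "w' \<otimes>\<^bsub>B\<^esub> \<pi> x \<otimes>\<^bsub>B\<^esub> adj B w' = \<pi> (rot_aut \<theta> \<gamma> d f x)"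
      by (rule rotation_hom_eqI[OF B Ad star_hom_comp[OF alpha_hom \<pi>(1)] Ad_u Ad_v x])
    then have "w' \<otimes>\<^bsub>B\<^esub> \<pi> x \<otimes>\<^bsub>B\<^esub> adj B w' \<otimes>\<^bsub>B\<^esub> w' = \<pi> (rot_aut \<theta> \<gamma> d f x) \<otimes>\<^bsub>B\<^esub> w'" by simp
    then show ?thesis
      using x cl by (simp add: B.unitary_cancel[OF w'] p)
  qed
  from cx_universal[OF B \<pi>(1) w' this] show ?thesis
    using that \<pi> uc vc by metis
qed

lemma hom_eqI:
  assumes "cstar_algebra B" "h \<in> star_hom CX B" "k \<in> star_hom CX B" "h U = k U" "h V = k V" "h W = k W"
    and "z \<in> carrier CX"
  shows "h z = k z"
proof (rule cx_hom_eqI[OF assms(1-3) _ assms(6,7)])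
  fix x assume "x \<in> carrier RA"
  then show "h (cx_embed x) = k (cx_embed x)"
    by (rule rotation_hom_eqI[OF assms(1) star_hom_comp[OF cx_embed_hom assms(2)] star_hom_comp[OF cx_embed_hom assms(3)] assms(4,5)])
qed

end

theorem lemma1p3:
  fixes \<theta> \<gamma> :: real and d :: int and f :: "complex \<Rightarrow> real"
  assumes "continuous_on (sphere 0 1) f"
  shows "crossed_product (rotation_algebra \<theta>) (rot_aut \<theta> \<gamma> d f) \<cong>\<^sub>C
         crossed_product (rotation_algebra \<gamma>) (rot_aut \<gamma> \<theta> (- d) (\<lambda>z. - f z))"
proof -
  have f': "continuous_on S1 (\<lambda>z. - f z)" using assms by (intro continuous_intros)
  interpret X: rotation_crossed \<theta> \<gamma> d f by unfold_locales (rule assms)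
  interpret Y: rotation_crossed \<gamma> \<theta> "- d" "\<lambda>z. - f z" by unfold_locales (rule f')
  \<comment> \<open>The parameters of \<open>Y\<close> are already negated, and the exchange negates
    them again, which brings back d and f.\<close>
  have swapped: "furstenberg_triple Y.CX \<theta> \<gamma> (twist d f) Y.U Y.W Y.V"
    using furstenberg_triple_swap[OF Y.cstar_algebra_cx f' Y.triple] by simp
  obtain H where H: "H \<in> star_hom X.CX Y.CX" "H X.U = Y.U" "H X.V = Y.W" "H X.W = Y.V"
    using X.universal[OF Y.cstar_algebra_cx swapped] by blast
  obtain K where K: "K \<in> star_hom Y.CX X.CX" "K Y.U = X.U" "K Y.V = X.W" "K Y.W = X.V"
    using Y.universal[OF X.cstar_algebra_cx furstenberg_triple_swap[OF X.cstar_algebra_cx assms X.triple]] by blast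
  \<comment> \<open>Each composite fixes the three generators, and homomorphisms from a crossed
    product are determined by these.\<close>
  have KH: "K (H x) = x" if "x \<in> carrier X.CX" for x
    by (rule X.hom_eqI[OF X.cstar_algebra_cx star_hom_comp[OF H(1) K(1)] star_hom_id _ _ _ that]) (simp_all add: H K)
  have HK: "H (K y) = y" if "y \<in> carrier Y.CX" for y
    by (rule Y.hom_eqI[OF Y.cstar_algebra_cx star_hom_comp[OF K(1) H(1)] star_hom_id _ _ _ that]) (simp_all add: H K)
  have "bij_betw H (carrier X.CX) (carrier Y.CX)"
    using star_hom_closed[OF H(1)] star_hom_closed[OF K(1)] KH HK by (intro bij_betw_byWitness[where f' = K]) auto
  then show ?thesis
    using H(1) X.cstar_algebra_cx Y.cstar_algebra_cx by (auto simp: cstar_isomorphic_def star_iso_def)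
qed

end
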